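(* Let $M$ be a closed manifold of dimension $n\ge2$, $T>0$, and let $(g,f)$ be a time-dependent metric-potential pair evolving under the $\mathsf k$-super Perelman-Ricci flow $$\partial_tg+2\,\mathrm{Ric}_f(g)\ge-2\mathsf k\,g,\qquad \mathsf k\ge0,$$ on $M\times[0,T]$. Let $u$ be a positive smooth solution of $(\partial_t-\Delta_f)u=\Sigma(u)$ with $0<u\le D$ in $M\times[0,T]$, and assume that $\Sigma(u)\ge0$ and $\Sigma(u)-2u\Sigma_u(u)\ge0$ along the solution $u$. Then $$t\,|\nabla\log u|^2\le(1+2\mathsf kt)\,[1+\log(D/u)],\qquad 0<t<T.$$ As a result, for any $s>0$, $x_1,x_2\in M$ and $0<t\le T$, $$u(x_1,t)\le(eD)^{s/(1+s)}\exp\left(d^2(x_1,x_2,t)\,\frac{1+2\mathsf kt}{4st}\right)[u(x_2,t)]^{1/(1+s)}.$$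
   Context: $\nabla,\Delta,\langle\cdot,\cdot\rangle,|\cdot|$ are taken with respect to $g=g(t)$; $\Delta_fv=\Delta v-\langle\nabla f,\nabla v\rangle$; $\mathrm{Ric}_f(g)=\mathrm{Ric}(g)+\mathrm{Hess}(f)$; tensor inequalities are in the sense of quadratic forms. The pair $(g,f)$ is a smooth solution of the flow inequality. $\Sigma=\Sigma(u)$ is a sufficiently smooth real function of $u>0$ with derivative $\Sigma_u$. "Along the solution $u$" means evaluated at $u=u(x,t)$ for all $(x,t)\in M\times[0,T]$. $d(x_1,x_2,t)$ is the Riemannian distance with respect to $g(t)$. *)

theory Defs
  imports "HOL-Analysis.Analysis"
begin

section \<open>Functions of class C^k\<close>

text \<open>
  Derivatives are taken within the set, hence one-sided at its boundary. This is used only for sets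
  on which such a derivative is unique: open sets, relatively open subsets of a nondegenerate compact
  interval, and products of a nondegenerate compact time interval with an open set.
\<close>

primrec Ck_on :: "nat \<Rightarrow> 'a::real_normed_vector set \<Rightarrow> ('a \<Rightarrow> 'b::real_normed_vector) \<Rightarrow> bool" where
  "Ck_on 0 S h \<longleftrightarrow> continuous_on S h"
| "Ck_on (Suc k) S h \<longleftrightarrow>
     h differentiable_on S \<and> (\<forall>v. Ck_on k S (\<lambda>x. frechet_derivative h (at x within S) v))"

definition smooth_on :: "'a::real_normed_vector set \<Rightarrow> ('a \<Rightarrow> 'b::real_normed_vector) \<Rightarrow> bool" where
  "smooth_on S h \<longleftrightarrow> (\<forall>k. Ck_on k S h)"


section \<open>Closed manifolds\<close>

text \<open>A chart is a pair of its domain and its coordinate map; the dimension is \<open>CARD('n)\<close>.\<close>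

type_synonym ('a, 'n) chart = "'a set \<times> ('a \<Rightarrow> real ^ 'n)"

abbreviation chart_dom :: "('a, 'n::finite) chart \<Rightarrow> 'a set" where
  "chart_dom c \<equiv> fst c"

abbreviation chart_map :: "('a, 'n::finite) chart \<Rightarrow> 'a \<Rightarrow> real ^ 'n" where
  "chart_map c \<equiv> snd c"

definition chart_inv :: "('a, 'n::finite) chart \<Rightarrow> real ^ 'n \<Rightarrow> 'a" where
  "chart_inv c = inv_into (chart_dom c) (chart_map c)"

definition chart_img :: "('a, 'n::finite) chart \<Rightarrow> (real ^ 'n) set" where
  "chart_img c = chart_map c ` chart_dom c"

definition smooth_atlas :: "'a::t2_space set \<Rightarrow> ('a, 'n::finite) chart set \<Rightarrow> bool" where
  "smooth_atlas M A \<longleftrightarrow>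
     (\<Union>c\<in>A. chart_dom c) = M \<and>
     (\<forall>c\<in>A. openin (top_of_set M) (chart_dom c) \<and> open (chart_img c) \<and>
             homeomorphism (chart_dom c) (chart_img c) (chart_map c) (chart_inv c)) \<and>
     (\<forall>c\<in>A. \<forall>d\<in>A. smooth_on (chart_map c ` (chart_dom c \<inter> chart_dom d)) (chart_map d \<circ> chart_inv c))"

text \<open>
  Charts map onto open subsets of Euclidean space, so there is no boundary; second countability
  follows from compactness. Connectedness is not required.
\<close>

definition closed_manifold :: "'a::t2_space set \<Rightarrow> ('a, 'n::finite) chart set \<Rightarrow> bool" where
  "closed_manifold M A \<longleftrightarrow> compact M \<and> smooth_atlas M A"


section \<open>Smooth time-dependent functions and metrics\<close>

definition smooth_function_family ::
  "('a, 'n::finite) chart set \<Rightarrow> real \<Rightarrow> (real \<Rightarrow> 'a \<Rightarrow> real) \<Rightarrow> bool" where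
  "smooth_function_family A T u \<longleftrightarrow>
     (\<forall>c\<in>A. smooth_on ({0..T} \<times> chart_img c) (\<lambda>(t, y). u t (chart_inv c y)))"

text \<open>The matrix of the differential of the coordinate change from \<open>c\<close> to \<open>d\<close>.\<close>

definition jacobian :: "('a, 'n::finite) chart \<Rightarrow> ('a, 'n) chart \<Rightarrow> 'a \<Rightarrow> real ^ 'n ^ 'n" where
  "jacobian c d x = matrix (frechet_derivative (chart_map d \<circ> chart_inv c) (at (chart_map c x)))"

text \<open>
  A tensor field of type (0,2) is given by its component matrices in all charts of the atlas, subject
  to the transformation law: \<open>g c t x $ i $ j\<close> is the value of \<open>g(t)\<close> at \<open>x\<close> on the \<open>i\<close>-th
  and \<open>j\<close>-th coordinate vector fields of the chart \<open>c\<close>.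
\<close>

type_synonym ('a, 'n) metric_family = "('a, 'n) chart \<Rightarrow> real \<Rightarrow> 'a \<Rightarrow> real ^ 'n ^ 'n"

definition smooth_metric_family ::
  "('a, 'n::finite) chart set \<Rightarrow> real \<Rightarrow> ('a, 'n) metric_family \<Rightarrow> bool" where
  "smooth_metric_family A T g \<longleftrightarrow>
     (\<forall>c\<in>A. smooth_on ({0..T} \<times> chart_img c) (\<lambda>(t, y). g c t (chart_inv c y))) \<and>
     (\<forall>c\<in>A. \<forall>t\<in>{0..T}. \<forall>x\<in>chart_dom c.
        transpose (g c t x) = g c t x \<and> (\<forall>v. v \<noteq> 0 \<longrightarrow> 0 < v \<bullet> (g c t x *v v))) \<and>
     (\<forall>c\<in>A. \<forall>d\<in>A. \<forall>t\<in>{0..T}. \<forall>x\<in>chart_dom c \<inter> chart_dom d.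
        g c t x = transpose (jacobian c d x) ** g d t x ** jacobian c d x)"


section \<open>Riemannian geometry in a chart\<close>

text \<open>
  In this section \<open>G\<close> is the component matrix of a single metric in the chart \<open>c\<close>, as a function
  on the domain of \<open>c\<close>.
\<close>

definition metric_inner :: "real ^ 'n ^ 'n \<Rightarrow> real ^ 'n \<Rightarrow> real ^ 'n \<Rightarrow> real" where
  "metric_inner P v w = v \<bullet> (P *v w)"

definition metric_norm :: "real ^ 'n ^ 'n \<Rightarrow> real ^ 'n \<Rightarrow> real" where
  "metric_norm P v = sqrt (metric_inner P v v)"

definition partial_deriv ::
  "('a, 'n::finite) chart \<Rightarrow> 'n \<Rightarrow> ('a \<Rightarrow> real) \<Rightarrow> 'a \<Rightarrow> real" where
  "partial_deriv c i v x = frechet_derivative (v \<circ> chart_inv c) (at (chart_map c x)) (axis i 1)"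

definition gradient ::
  "('a, 'n::finite) chart \<Rightarrow> ('a \<Rightarrow> real ^ 'n ^ 'n) \<Rightarrow> ('a \<Rightarrow> real) \<Rightarrow> 'a \<Rightarrow> real ^ 'n" where
  "gradient c G v x = matrix_inv (G x) *v (\<chi> i. partial_deriv c i v x)"

text \<open>\<open>christoffel c G k i j\<close> is the symbol with upper index \<open>k\<close> and lower indices \<open>i\<close>, \<open>j\<close>.\<close>

definition christoffel ::
  "('a, 'n::finite) chart \<Rightarrow> ('a \<Rightarrow> real ^ 'n ^ 'n) \<Rightarrow> 'n \<Rightarrow> 'n \<Rightarrow> 'n \<Rightarrow> 'a \<Rightarrow> real" where
  "christoffel c G k i j x =
     (1 / 2) * (\<Sum>l\<in>UNIV. matrix_inv (G x) $ k $ l *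
        (partial_deriv c i (\<lambda>z. G z $ j $ l) x + partial_deriv c j (\<lambda>z. G z $ i $ l) x
         - partial_deriv c l (\<lambda>z. G z $ i $ j) x))"

definition hessian ::
  "('a, 'n::finite) chart \<Rightarrow> ('a \<Rightarrow> real ^ 'n ^ 'n) \<Rightarrow> ('a \<Rightarrow> real) \<Rightarrow> 'a \<Rightarrow> real ^ 'n ^ 'n" where
  "hessian c G v x = (\<chi> i j. partial_deriv c i (partial_deriv c j v) x
     - (\<Sum>k\<in>UNIV. christoffel c G k i j x * partial_deriv c k v x))"

definition laplacian ::
  "('a, 'n::finite) chart \<Rightarrow> ('a \<Rightarrow> real ^ 'n ^ 'n) \<Rightarrow> ('a \<Rightarrow> real) \<Rightarrow> 'a \<Rightarrow> real" where
  "laplacian c G v x = (\<Sum>i\<in>UNIV. \<Sum>j\<in>UNIV. matrix_inv (G x) $ i $ j * hessian c G v x $ i $ j)"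

text \<open>The sign convention is the one for which round spheres have positive Ricci curvature.\<close>

definition ricci ::
  "('a, 'n::finite) chart \<Rightarrow> ('a \<Rightarrow> real ^ 'n ^ 'n) \<Rightarrow> 'a \<Rightarrow> real ^ 'n ^ 'n" where
  "ricci c G x = (\<chi> i j.
     (\<Sum>k\<in>UNIV. partial_deriv c k (christoffel c G k i j) x
              - partial_deriv c j (christoffel c G k i k) x)
     + (\<Sum>k\<in>UNIV. \<Sum>l\<in>UNIV. christoffel c G k k l x * christoffel c G l i j x
              - christoffel c G k j l x * christoffel c G l i k x))"

definition weighted_laplacian ::
  "('a, 'n::finite) chart \<Rightarrow> ('a \<Rightarrow> real ^ 'n ^ 'n) \<Rightarrow> ('a \<Rightarrow> real) \<Rightarrow> ('a \<Rightarrow> real) \<Rightarrow> 'a \<Rightarrow> real" where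
  "weighted_laplacian c G f v x =
     laplacian c G v x - metric_inner (G x) (gradient c G f x) (gradient c G v x)"

definition weighted_ricci ::
  "('a, 'n::finite) chart \<Rightarrow> ('a \<Rightarrow> real ^ 'n ^ 'n) \<Rightarrow> ('a \<Rightarrow> real) \<Rightarrow> 'a \<Rightarrow> real ^ 'n ^ 'n" where
  "weighted_ricci c G f x = ricci c G x + hessian c G f x"


section \<open>The flow inequality and the evolution equation\<close>

definition quadratic_le :: "real ^ 'n ^ 'n \<Rightarrow> real ^ 'n ^ 'n \<Rightarrow> bool" where
  "quadratic_le P Q \<longleftrightarrow> (\<forall>v. v \<bullet> (P *v v) \<le> v \<bullet> (Q *v v))"

text \<open>Both sides are tensors, so holding in one chart around a point and in all of them is the same.\<close>

definition super_perelman_ricci_flow ::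
  "('a, 'n::finite) chart set \<Rightarrow> real \<Rightarrow> real \<Rightarrow> ('a, 'n) metric_family \<Rightarrow> (real \<Rightarrow> 'a \<Rightarrow> real) \<Rightarrow> bool" where
  "super_perelman_ricci_flow A T k g f \<longleftrightarrow>
     (\<forall>c\<in>A. \<forall>x\<in>chart_dom c. \<forall>t\<in>{0..T}.
        quadratic_le ((- 2 * k) *\<^sub>R g c t x)
          (vector_derivative (\<lambda>s. g c s x) (at t within {0..T})
           + 2 *\<^sub>R weighted_ricci c (g c t) (f t) x))"

definition solves_nonlinear_heat ::
  "('a, 'n::finite) chart set \<Rightarrow> real \<Rightarrow> ('a, 'n) metric_family \<Rightarrow> (real \<Rightarrow> 'a \<Rightarrow> real)
     \<Rightarrow> (real \<Rightarrow> real) \<Rightarrow> (real \<Rightarrow> 'a \<Rightarrow> real) \<Rightarrow> bool" where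
  "solves_nonlinear_heat A T g f F u \<longleftrightarrow>
     (\<forall>c\<in>A. \<forall>x\<in>chart_dom c. \<forall>t\<in>{0..T}.
        vector_derivative (\<lambda>s. u s x) (at t within {0..T})
        - weighted_laplacian c (g c t) (f t) (u t) x = F (u t x))"


section \<open>Riemannian distance\<close>

text \<open>One-sided derivatives exist and are continuous up to the ends of each piece.\<close>

definition piecewise_C1_curve ::
  "'a::t2_space set \<Rightarrow> ('a, 'n::finite) chart set \<Rightarrow> (real \<Rightarrow> 'a) \<Rightarrow> bool" where
  "piecewise_C1_curve M A \<gamma> \<longleftrightarrow>
     continuous_on {0..1} \<gamma> \<and> \<gamma> ` {0..1} \<subseteq> M \<and>
     (\<exists>P. finite P \<and>
        (\<forall>a b. 0 \<le> a \<and> a < b \<and> b \<le> 1 \<and> {a<..<b} \<inter> P = {} \<longrightarrow>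
           (\<forall>c\<in>A. Ck_on 1 {s \<in> {a..b}. \<gamma> s \<in> chart_dom c} (chart_map c \<circ> \<gamma>))))"

text \<open>The speed does not depend on the chosen chart, by the transformation law of the metric.\<close>

definition curve_speed ::
  "('a, 'n::finite) chart set \<Rightarrow> ('a, 'n) metric_family \<Rightarrow> real \<Rightarrow> (real \<Rightarrow> 'a) \<Rightarrow> real \<Rightarrow> real" where
  "curve_speed A g t \<gamma> s =
     (let c = (SOME c. c \<in> A \<and> \<gamma> s \<in> chart_dom c)
      in metric_norm (g c t (\<gamma> s)) (vector_derivative (chart_map c \<circ> \<gamma>) (at s)))"

definition curve_length ::
  "('a, 'n::finite) chart set \<Rightarrow> ('a, 'n) metric_family \<Rightarrow> real \<Rightarrow> (real \<Rightarrow> 'a) \<Rightarrow> real" where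
  "curve_length A g t \<gamma> = integral {0..1} (curve_speed A g t \<gamma>)"

text \<open>
  Meaningful when \<open>x\<close> and \<open>y\<close> lie in the same component of \<open>M\<close>; otherwise the set of curves
  is empty and the distance, infinite by convention, is not represented by this real number.
\<close>

definition riemannian_dist ::
  "'a::t2_space set \<Rightarrow> ('a, 'n::finite) chart set \<Rightarrow> ('a, 'n) metric_family \<Rightarrow> real \<Rightarrow> 'a \<Rightarrow> 'a \<Rightarrow> real" where
  "riemannian_dist M A g t x y =
     Inf {curve_length A g t \<gamma> |\<gamma>. piecewise_C1_curve M A \<gamma> \<and> \<gamma> 0 = x \<and> \<gamma> 1 = y}"

end

theory Submission
  imports Defs
begin

text \<open>
  Write \<open>l = ln u\<close>, \<open>q = \<bar>grad l\<bar>\<^sup>2\<close> and \<open>w t = t / (1 + 2 k t)\<close>. The equation for \<open>u\<close> becomes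
  \<open>(\<partial>t - \<Delta>f) l = q + F u / u\<close>, and Bochner's formula turns it, together with the flow inequality and
  \<open>2 u F' u \<le> F u\<close>, into a differential inequality for \<open>R = w q + l\<close>. At a spatial maximum of \<open>R\<close> the
  drift terms vanish and \<open>\<partial>t R \<le> (w' + 2 k w - 1) q + (1 - w q) F u / u\<close>. The first coefficient is
  nonpositive, and where \<open>R > 1 + ln D\<close> one has \<open>w q > 1\<close>, so \<open>R\<close> cannot rise above \<open>1 + ln D\<close>, which
  bounds it at time \<open>0\<close>. The resulting estimate says that \<open>sqrt (1 + ln (D / u))\<close> is Lipschitz for the
  distance with constant \<open>sqrt ((1 + 2 k t) / t) / 2\<close>; squaring this and using
  \<open>2 x y \<le> s x\<^sup>2 + y\<^sup>2 / s\<close> gives the Harnack inequality.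
\<close>

section \<open>Smooth functions on open sets\<close>

text \<open>The coefficient \<open>-1\<close> of \<open>q\<close> comes from the vanishing gradient
  of \<open>R\<close>: it gives \<open>w <grad l, grad q> = - q\<close>, so the term
  \<open>2 w <grad l, grad q>\<close> of Bochner's formula counts \<open>- 2 q\<close> against the
  \<open>+ q\<close> in the equation for \<open>l\<close>. This surplus pays for \<open>w'\<close>
  and for the curvature term \<open>2 k w\<close>. The reaction term keeps its shape because the
  gradient of \<open>F u / u\<close> is \<open>(F' u - F u / u) grad l\<close>, and the growth
  hypothesis bounds that factor by \<open>- F u / (2 u)\<close>. The square of the Hessian is only
  used to be nonnegative, so no dimension enters the constants. The obstacle is regularity in time:
  the data are smooth on a closed time interval, hence only one-sidedly at its ends. All
  second-order calculus is therefore done on the open set of times strictly between \<open>0\<close>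
  and \<open>T\<close>, where time is one more constant direction and commutes with the spatial
  ones. The end times are reached through the continuity of first-order quantities alone.\<close>

definition dir_deriv ::
  "'a::real_normed_vector \<Rightarrow> ('a \<Rightarrow> 'b::real_normed_vector) \<Rightarrow> 'a \<Rightarrow> 'b" where
  "dir_deriv v h x = frechet_derivative h (at x) v"

lemma has_derivative_dir_deriv:
  "h differentiable at x \<Longrightarrow> (h has_derivative (\<lambda>v. dir_deriv v h x)) (at x)"
  unfolding dir_deriv_def using frechet_derivative_works[of h "at x"] by simp

lemma dir_deriv_eqI:
  assumes "(h has_derivative h') (at x)"
  shows "dir_deriv v h x = h' v"
  unfolding dir_deriv_def using frechet_derivative_at[OF assms] by simp

lemma dir_deriv_cong:
  assumes "open S" "x \<in> S" "\<And>y. y \<in> S \<Longrightarrow> h y = k y"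
  shows "dir_deriv v h x = dir_deriv v k x"
proof -
  have "(h has_derivative f') (at x) \<longleftrightarrow> (k has_derivative f') (at x)" for f'
    using assms has_derivative_transform_within_open[of h f' x UNIV S k]
      has_derivative_transform_within_open[of k f' x UNIV S h] by auto
  then show ?thesis
    by (simp add: dir_deriv_def frechet_derivative_def)
qed

lemma dir_deriv_const [simp]: "dir_deriv v (\<lambda>_. a) x = 0"
  by (simp add: dir_deriv_def)

lemma dir_deriv_linear:
  assumes "h differentiable at x"
  shows "dir_deriv (v + w) h x = dir_deriv v h x + dir_deriv w h x"
    and "dir_deriv (r *\<^sub>R v) h x = r *\<^sub>R dir_deriv v h x"
  using linear_frechet_derivative[OF assms]
  by (simp_all add: dir_deriv_def linear_add linear_scale)

lemma dir_deriv_add: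
  assumes "h differentiable at x" "k differentiable at x"
  shows "dir_deriv v (\<lambda>y. h y + k y) x = dir_deriv v h x + dir_deriv v k x"
  by (rule dir_deriv_eqI[OF has_derivative_add[OF assms[THEN has_derivative_dir_deriv]]])

lemma dir_deriv_diff:
  assumes "h differentiable at x" "k differentiable at x"
  shows "dir_deriv v (\<lambda>y. h y - k y) x = dir_deriv v h x - dir_deriv v k x"
  by (rule dir_deriv_eqI[OF has_derivative_diff[OF assms[THEN has_derivative_dir_deriv]]])

lemma dir_deriv_mult:
  fixes h k :: "'a::real_normed_vector \<Rightarrow> real"
  assumes "h differentiable at x" "k differentiable at x"
  shows "dir_deriv v (\<lambda>y. h y * k y) x = h x * dir_deriv v k x + dir_deriv v h x * k x"
  by (rule dir_deriv_eqI[OF has_derivative_mult[OF assms[THEN has_derivative_dir_deriv]]])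

lemma dir_deriv_sum:
  assumes "\<And>i. i \<in> I \<Longrightarrow> h i differentiable at x"
  shows "dir_deriv v (\<lambda>y. \<Sum>i\<in>I. h i y) x = (\<Sum>i\<in>I. dir_deriv v (h i) x)"
  by (rule dir_deriv_eqI[OF has_derivative_sum[OF assms[THEN has_derivative_dir_deriv]]])

lemma dir_deriv_bounded_linear:
  assumes "bounded_linear L" "h differentiable at x"
  shows "dir_deriv v (\<lambda>y. L (h y)) x = L (dir_deriv v h x)"
  by (rule dir_deriv_eqI[OF bounded_linear.has_derivative[OF assms(1) has_derivative_dir_deriv[OF assms(2)]]])

lemma dir_deriv_inverse:
  fixes h :: "'a::real_normed_vector \<Rightarrow> real"
  assumes "h differentiable at x" "h x \<noteq> 0"
  shows "dir_deriv v (\<lambda>y. inverse (h y)) x = - (inverse (h x) * dir_deriv v h x * inverse (h x))"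
  by (rule dir_deriv_eqI[OF Deriv.has_derivative_inverse[OF assms(2) has_derivative_dir_deriv[OF assms(1)]]])

lemma dir_deriv_ln:
  fixes h :: "'a::real_normed_vector \<Rightarrow> real"
  assumes "h differentiable at x" "h x > 0"
  shows "dir_deriv v (\<lambda>y. ln (h y)) x = dir_deriv v h x * inverse (h x)"
  by (rule dir_deriv_eqI[OF has_derivative_ln[OF assms(2) has_derivative_dir_deriv[OF assms(1)]]])


section \<open>Closure of the classes C^k under sums, products, inverses and logarithms\<close>

lemma has_derivative_within_cong:
  assumes "x \<in> S" "\<And>y. y \<in> S \<Longrightarrow> h y = h' y"
  shows "(h has_derivative f') (at x within S) \<longleftrightarrow> (h' has_derivative f') (at x within S)"
  using assms has_derivative_transform[of x S h h' f'] has_derivative_transform[of x S h' h f']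
  by auto

lemma Ck_on_cong:
  assumes "Ck_on k S h" "\<And>x. x \<in> S \<Longrightarrow> h x = h' x"
  shows "Ck_on k S h'"
  using assms
proof (induction k arbitrary: h h')
  case 0
  then show ?case using continuous_on_cong by fastforce
next
  case (Suc k)
  note * = has_derivative_within_cong[of _ S h h', OF _ Suc.prems(2)]
  have "h' differentiable_on S"
    using Suc.prems(1) * by (auto simp: differentiable_on_def differentiable_def)
  moreover have "Ck_on k S (\<lambda>x. frechet_derivative h' (at x within S) v)" for v
    by (rule Suc.IH[of "\<lambda>x. frechet_derivative h (at x within S) v"])
      (use Suc.prems(1) * in \<open>auto simp: frechet_derivative_def\<close>)
  ultimately show ?case by simp
qed

lemma Ck_on_Suc_imp: "Ck_on (Suc k) S h \<Longrightarrow> Ck_on k S h"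
proof (induction k arbitrary: h)
  case 0
  then show ?case using differentiable_imp_continuous_on by auto
next
  case (Suc k)
  then show ?case by (metis Ck_on.simps(2))
qed

text \<open>On an open set the derivative within the set is the full derivative. This replaces the
  defining recursion by one in terms of \<open>dir_deriv\<close>, to which the differentiation rules
  apply.\<close>

lemma Ck_on_open_Suc:
  assumes "open S"
  shows "Ck_on (Suc k) S h \<longleftrightarrow> (\<forall>x\<in>S. h differentiable at x) \<and> (\<forall>v. Ck_on k S (dir_deriv v h))"
proof -
  have "Ck_on k S (\<lambda>x. frechet_derivative h (at x within S) v) \<longleftrightarrow> Ck_on k S (dir_deriv v h)" for v
    using Ck_on_cong[of k S "\<lambda>x. frechet_derivative h (at x within S) v" "dir_deriv v h"]
      Ck_on_cong[of k S "dir_deriv v h" "\<lambda>x. frechet_derivative h (at x within S) v"]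
    by (auto simp: dir_deriv_def at_within_open[OF _ assms])
  then show ?thesis
    using assms by (simp add: differentiable_on_def at_within_open[OF _ assms])
qed

lemma Ck_on_open_subset:
  assumes "Ck_on k S h" "open S'" "S' \<subseteq> S"
  shows "Ck_on k S' h"
  using assms(1)
proof (induction k arbitrary: h)
  case 0
  then show ?case using assms continuous_on_subset by auto
next
  case (Suc k)
  have *: "at x within S = at x" if "x \<in> S'" for x
    using that assms interior_maximal at_within_interior by (metis subsetD)
  have "Ck_on k S' (dir_deriv v h)" for v
    by (rule Ck_on_cong[OF Suc.IH[of "\<lambda>x. frechet_derivative h (at x within S) v"]])
      (use Suc.prems * in \<open>auto simp: dir_deriv_def\<close>)
  then show ?case
    using Suc.prems * assms(3) unfolding Ck_on_open_Suc[OF assms(2)]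
    by (auto simp: differentiable_on_def) (metis subsetD)
qed

lemma Ck_on_bounded_linear:
  assumes "open S" "bounded_linear L" "Ck_on k S h"
  shows "Ck_on k S (\<lambda>x. L (h x))"
  using assms(3)
proof (induction k arbitrary: h)
  case 0
  then show ?case
    using bounded_linear.continuous_on[OF assms(2)] by auto
next
  case (Suc k)
  have d: "h differentiable at x" if "x \<in> S" for x
    using Suc.prems that Ck_on_open_Suc[OF assms(1)] by blast
  have "Ck_on k S (dir_deriv v (\<lambda>x. L (h x)))" for v
    by (rule Ck_on_cong[OF Suc.IH[of "dir_deriv v h"]])
      (use Suc.prems d in \<open>auto simp: Ck_on_open_Suc[OF assms(1)] dir_deriv_bounded_linear[OF assms(2)]
        simp del: Ck_on.simps\<close>)
  moreover have "(\<lambda>x. L (h x)) differentiable at x" if "x \<in> S" for x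
    using bounded_linear.has_derivative[OF assms(2) has_derivative_dir_deriv[OF d[OF that]]]
    by (auto simp: differentiable_def)
  ultimately show ?case unfolding Ck_on_open_Suc[OF assms(1)] by blast
qed


lemma Ck_on_const: "open S \<Longrightarrow> Ck_on k S (\<lambda>_. a)"
proof (induction k arbitrary: a)
  case (Suc k)
  have "dir_deriv v (\<lambda>_. a) = (\<lambda>_. 0)" for v :: 'a
    by auto
  then show ?case
    using Suc by (simp add: Ck_on_open_Suc del: Ck_on.simps)
qed simp

lemma Ck_on_add:
  assumes "open S" "Ck_on k S f" "Ck_on k S g"
  shows "Ck_on k S (\<lambda>x. f x + g x)"
  using assms(2,3)
proof (induction k arbitrary: f g)
  case (Suc k)
  note d = Suc.prems[unfolded Ck_on_open_Suc[OF assms(1)]]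
  have "Ck_on k S (dir_deriv v (\<lambda>x. f x + g x))" for v
    by (rule Ck_on_cong[OF Suc.IH[of "dir_deriv v f" "dir_deriv v g"]])
      (use d in \<open>auto simp: dir_deriv_add\<close>)
  then show ?case using d by (auto simp: Ck_on_open_Suc[OF assms(1)] simp del: Ck_on.simps)
qed (auto intro: continuous_intros)

lemma Ck_on_mult:
  fixes f g :: "'a::real_normed_vector \<Rightarrow> real"
  assumes "open S" "Ck_on k S f" "Ck_on k S g"
  shows "Ck_on k S (\<lambda>x. f x * g x)"
  using assms(2,3)
proof (induction k arbitrary: f g)
  case (Suc k)
  note d = Suc.prems[unfolded Ck_on_open_Suc[OF assms(1)]]
  have "Ck_on k S (dir_deriv v (\<lambda>x. f x * g x))" for v
    by (rule Ck_on_cong[OF Ck_on_add[OF assms(1) Suc.IH[of f "dir_deriv v g"] Suc.IH[of "dir_deriv v f" g]]])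
      (use d Suc.prems Ck_on_Suc_imp in \<open>auto simp: dir_deriv_mult simp del: Ck_on.simps\<close>)
  then show ?case using d by (auto simp: Ck_on_open_Suc[OF assms(1)] simp del: Ck_on.simps)
qed (auto intro: continuous_intros)

text \<open>The derivative of \<open>1 / f\<close> is a product of \<open>f'\<close> and two copies
  of \<open>1 / f\<close>, so it needs \<open>1 / f\<close> only at the order already reached and
  the induction closes.\<close>

lemma Ck_on_inverse:
  fixes f :: "'a::real_normed_vector \<Rightarrow> real"
  assumes "open S" "Ck_on k S f" "\<And>x. x \<in> S \<Longrightarrow> f x \<noteq> 0"
  shows "Ck_on k S (\<lambda>x. inverse (f x))"
  using assms(2)
proof (induction k)
  case 0
  then show ?case using assms(3) by (auto intro!: continuous_intros)
next
  case (Suc k)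
  note d = Suc.prems[unfolded Ck_on_open_Suc[OF assms(1)]]
  have i: "Ck_on k S (\<lambda>x. inverse (f x))"
    using Suc Ck_on_Suc_imp by blast
  have "Ck_on k S (dir_deriv v (\<lambda>x. inverse (f x)))" for v
    by (rule Ck_on_cong[OF Ck_on_mult[OF assms(1) Ck_on_mult[OF assms(1) Ck_on_mult[OF assms(1)
      Ck_on_const[OF assms(1), of k "- 1"] i] d[THEN conjunct2, rule_format, of v]] i]])
      (use d assms(3) in \<open>auto simp: dir_deriv_inverse\<close>)
  then show ?case using d assms(3) by (auto simp: Ck_on_open_Suc[OF assms(1)] simp del: Ck_on.simps)
qed

lemma Ck_on_ln:
  fixes f :: "'a::real_normed_vector \<Rightarrow> real"
  assumes "open S" "Ck_on k S f" "\<And>x. x \<in> S \<Longrightarrow> f x > 0"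
  shows "Ck_on k S (\<lambda>x. ln (f x))"
proof (cases k)
  case 0
  then show ?thesis using assms(2,3) by (force intro!: continuous_intros)
next
  case (Suc m)
  note d = assms(2)[unfolded Suc Ck_on_open_Suc[OF assms(1)]]
  have i: "Ck_on m S (\<lambda>x. inverse (f x))"
    using assms Ck_on_Suc_imp Suc by (intro Ck_on_inverse) force+
  have "Ck_on m S (dir_deriv v (\<lambda>x. ln (f x)))" for v
    by (rule Ck_on_cong[OF Ck_on_mult[OF assms(1) d[THEN conjunct2, rule_format, of v] i]])
      (use d assms(3) in \<open>auto simp: dir_deriv_ln\<close>)
  moreover have "(\<lambda>x. ln (f x)) differentiable at x" if "x \<in> S" for x
    using has_derivative_ln[OF assms(3)[OF that] has_derivative_dir_deriv[of f x]] d that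
    by (auto simp: differentiable_def)
  ultimately show ?thesis using Suc by (auto simp: Ck_on_open_Suc[OF assms(1)] simp del: Ck_on.simps)
qed

context
  fixes S :: "'a::real_normed_vector set"
  assumes S: "open S"
begin

lemma smooth_on_const: "smooth_on S (\<lambda>_. a)"
  using Ck_on_const[OF S] by (auto simp: smooth_on_def)

lemma smooth_on_add: "smooth_on S f \<Longrightarrow> smooth_on S g \<Longrightarrow> smooth_on S (\<lambda>x. f x + g x)"
  using Ck_on_add[OF S] unfolding smooth_on_def by blast

lemma smooth_on_sum:
  "(\<And>i. i \<in> I \<Longrightarrow> smooth_on S (f i)) \<Longrightarrow> smooth_on S (\<lambda>x. \<Sum>i\<in>I. f i x)"
proof (induction I rule: infinite_finite_induct)
  case (insert i I)
  then show ?case using smooth_on_add[of "f i" "\<lambda>x. \<Sum>i\<in>I. f i x"] by simp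
qed (use smooth_on_const in simp_all)

lemma smooth_on_mult:
  "smooth_on S f \<Longrightarrow> smooth_on S g \<Longrightarrow> smooth_on S (\<lambda>x. f x * (g x :: real))"
  using Ck_on_mult[OF S] by (auto simp: smooth_on_def)

lemma smooth_on_diff:
  "smooth_on S f \<Longrightarrow> smooth_on S g \<Longrightarrow> smooth_on S (\<lambda>x. f x - (g x :: real))"
  using smooth_on_add[of f "\<lambda>x. (-1) * g x"] smooth_on_mult[OF smooth_on_const, of g "-1"] by simp

lemma smooth_on_prod:
  "(\<And>i. i \<in> I \<Longrightarrow> smooth_on S (f i)) \<Longrightarrow> smooth_on S (\<lambda>x. \<Prod>i\<in>I. f i x :: real)"
proof (induction I rule: infinite_finite_induct)
  case (insert i I)
  then show ?case using smooth_on_mult[of "f i" "\<lambda>x. \<Prod>i\<in>I. f i x"] by simp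
qed (use smooth_on_const in simp_all)

lemma smooth_on_inverse:
  "smooth_on S f \<Longrightarrow> (\<And>x. x \<in> S \<Longrightarrow> f x \<noteq> 0) \<Longrightarrow> smooth_on S (\<lambda>x. inverse (f x :: real))"
  using Ck_on_inverse[OF S] by (auto simp: smooth_on_def)

lemma smooth_on_ln:
  "smooth_on S f \<Longrightarrow> (\<And>x. x \<in> S \<Longrightarrow> f x > 0) \<Longrightarrow> smooth_on S (\<lambda>x. ln (f x :: real))"
  using Ck_on_ln[OF S] by (auto simp: smooth_on_def)

lemma smooth_on_bounded_linear:
  "bounded_linear L \<Longrightarrow> smooth_on S h \<Longrightarrow> smooth_on S (\<lambda>x. L (h x))"
  using Ck_on_bounded_linear[OF S] by (auto simp: smooth_on_def)

lemma smooth_on_differentiable: "smooth_on S h \<Longrightarrow> x \<in> S \<Longrightarrow> h differentiable at x"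
  using Ck_on_open_Suc[OF S] unfolding smooth_on_def by blast

lemma smooth_on_dir_deriv: "smooth_on S h \<Longrightarrow> smooth_on S (dir_deriv v h)"
  using Ck_on_open_Suc[OF S] unfolding smooth_on_def by blast

lemma smooth_on_cong: "smooth_on S h \<Longrightarrow> (\<And>x. x \<in> S \<Longrightarrow> h x = h' x) \<Longrightarrow> smooth_on S h'"
  using Ck_on_cong unfolding smooth_on_def by blast

lemma smooth_on_continuous: "smooth_on S h \<Longrightarrow> continuous_on S h"
  unfolding smooth_on_def using Ck_on.simps(1) by blast

end

lemma smooth_on_open_subset: "smooth_on S h \<Longrightarrow> open S' \<Longrightarrow> S' \<subseteq> S \<Longrightarrow> smooth_on S' h"
  using Ck_on_open_subset unfolding smooth_on_def by blast

lemma smooth_on_det: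
  fixes G :: "'a::real_normed_vector \<Rightarrow> real^'n^'n"
  assumes "open S" "\<And>i j. smooth_on S (\<lambda>x. G x $ i $ j)"
  shows "smooth_on S (\<lambda>x. det (G x))"
  unfolding det_def using assms
  by (intro smooth_on_sum smooth_on_mult smooth_on_prod smooth_on_const) auto

lemma invertible_matrix_inv:
  fixes P :: "real^'n^'n"
  assumes "det P \<noteq> 0"
  shows "P ** matrix_inv P = mat 1" "matrix_inv P ** P = mat 1"
proof -
  have "\<exists>Q. P ** Q = mat 1 \<and> Q ** P = mat 1"
    using assms invertible_det_nz invertible_def by blast
  from someI_ex[OF this] show "P ** matrix_inv P = mat 1" "matrix_inv P ** P = mat 1"
    by (simp_all add: matrix_inv_def)
qed

text \<open>Cramer's rule exhibits the entries of the inverse as rational functions of the entries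
  of \<open>P\<close>; smoothness, and later continuity, of the inverse metric thus reduces to that
  of determinants.\<close>

lemma matrix_inv_cramer:
  fixes P :: "real^'n^'n"
  assumes "det P \<noteq> 0"
  shows "matrix_inv P $ k $ l = det (\<chi> i j. if j = k then axis l 1 $ i else P $ i $ j) * inverse (det P)"
proof -
  have "P *v (matrix_inv P *v axis l 1) = axis l 1"
    using invertible_matrix_inv[OF assms] by (simp add: matrix_vector_mul_assoc)
  from this[unfolded cramer[OF assms]] have "(matrix_inv P *v axis l 1) $ k =
      det (\<chi> i j. if j = k then axis l 1 $ i else P $ i $ j) / det P"
    by simp
  then show ?thesis
    by (simp add: matrix_vector_mult_basis column_def divide_inverse)
qed

lemma smooth_on_matrix_inv:
  fixes G :: "'a::real_normed_vector \<Rightarrow> real^'n^'n"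
  assumes S: "open S" and G: "\<And>i j. smooth_on S (\<lambda>x. G x $ i $ j)"
    and nz: "\<And>x. x \<in> S \<Longrightarrow> det (G x) \<noteq> 0"
  shows "smooth_on S (\<lambda>x. matrix_inv (G x) $ k $ l)"
proof -
  have "smooth_on S (\<lambda>x. (\<chi> i j. if j = k then axis l 1 $ i else G x $ i $ j) $ i $ j)" for i j
    using G[of i j] smooth_on_const[OF S] by (cases "j = k") simp_all
  then have "smooth_on S (\<lambda>x. det (\<chi> i j. if j = k then axis l 1 $ i else G x $ i $ j) * inverse (det (G x)))"
    by (intro smooth_on_mult smooth_on_inverse smooth_on_det S G nz) auto
  then show ?thesis
    by (rule smooth_on_cong[OF S]) (simp add: matrix_inv_cramer nz)
qed

section \<open>Restriction to lines: symmetry of second derivatives and the second derivative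
  test\<close>

lemma line_has_derivative:
  assumes "h differentiable at (x + s *\<^sub>R v)"
  shows "((\<lambda>r. h (x + r *\<^sub>R v)) has_vector_derivative dir_deriv v h (x + s *\<^sub>R v)) (at s)"
proof -
  have "((\<lambda>r. x + r *\<^sub>R v) has_derivative (\<lambda>r. r *\<^sub>R v)) (at s)"
    by (auto intro!: derivative_eq_intros)
  from diff_chain_at[OF this has_derivative_dir_deriv[OF assms]]
  show ?thesis
    using dir_deriv_linear(2)[OF assms] by (simp add: has_vector_derivative_def o_def)
qed

lemma line_DERIV:
  fixes h :: "'a::real_normed_vector \<Rightarrow> real"
  assumes "h differentiable at (x + s *\<^sub>R v)"
  shows "DERIV (\<lambda>r. h (x + r *\<^sub>R v)) s :> dir_deriv v h (x + s *\<^sub>R v)"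
  using line_has_derivative[OF assms] by (simp add: has_real_derivative_iff_has_vector_derivative)

text \<open>The mean value theorem is applied twice, along \<open>v\<close> to the difference of two
  translates of \<open>h\<close> and then along \<open>w\<close> to \<open>dir_deriv v h\<close>.
  The second difference is symmetric in \<open>v\<close> and \<open>w\<close>, the right-hand side
  is not; exchanging the two directions produces the other mixed derivative.\<close>

lemma second_difference_mean_value:
  fixes h :: "'a::real_normed_vector \<Rightarrow> real"
  assumes s: "s > 0"
    and d: "\<And>a b. a \<in> {0..s} \<Longrightarrow> b \<in> {0..s} \<Longrightarrow> h differentiable at (x + a *\<^sub>R v + b *\<^sub>R w)"
    and dd: "\<And>a b. a \<in> {0..s} \<Longrightarrow> b \<in> {0..s} \<Longrightarrow> dir_deriv v h differentiable at (x + a *\<^sub>R v + b *\<^sub>R w)"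
  shows "\<exists>a\<in>{0..s}. \<exists>b\<in>{0..s}. h (x + s *\<^sub>R v + s *\<^sub>R w) - h (x + s *\<^sub>R v) - h (x + s *\<^sub>R w) + h x
     = s * s * dir_deriv w (dir_deriv v h) (x + a *\<^sub>R v + b *\<^sub>R w)"
proof -
  have "DERIV (\<lambda>r. h (x + s *\<^sub>R w + r *\<^sub>R v) - h (x + r *\<^sub>R v)) a
      :> dir_deriv v h (x + s *\<^sub>R w + a *\<^sub>R v) - dir_deriv v h (x + a *\<^sub>R v)" if "a \<in> {0..s}" for a
    using d[of a s] d[of a 0] that s
    by (intro DERIV_diff line_DERIV) (auto simp: algebra_simps)
  from MVT2[OF s this] obtain a where a: "a > 0" "a < s"
    "h (x + s *\<^sub>R w + s *\<^sub>R v) - h (x + s *\<^sub>R v) - (h (x + s *\<^sub>R w) - h x)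
      = s * (dir_deriv v h (x + s *\<^sub>R w + a *\<^sub>R v) - dir_deriv v h (x + a *\<^sub>R v))"
    by auto
  have "DERIV (\<lambda>r. dir_deriv v h (x + a *\<^sub>R v + r *\<^sub>R w)) b
      :> dir_deriv w (dir_deriv v h) (x + a *\<^sub>R v + b *\<^sub>R w)" if "b \<in> {0..s}" for b
    using dd[of a b] that a by (intro line_DERIV) auto
  from MVT2[OF s this] obtain b where b: "b > 0" "b < s"
    "dir_deriv v h (x + a *\<^sub>R v + s *\<^sub>R w) - dir_deriv v h (x + a *\<^sub>R v)
      = s * dir_deriv w (dir_deriv v h) (x + a *\<^sub>R v + b *\<^sub>R w)"
    by auto
  show ?thesis
    by (rule bexI[of _ a], rule bexI[of _ b])
      (use a b in \<open>simp_all add: add_ac diff_diff_eq2 algebra_simps\<close>)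
qed

text \<open>Both iterated derivatives are limits of the same mixed second difference quotient.\<close>

lemma dir_deriv_commute:
  fixes h :: "'a::real_normed_vector \<Rightarrow> real"
  assumes S: "open S" and h: "smooth_on S h" and x: "x \<in> S"
  shows "dir_deriv v (dir_deriv w h) x = dir_deriv w (dir_deriv v h) x"
proof (rule ccontr)
  let ?A = "dir_deriv v (dir_deriv w h)" and ?B = "dir_deriv w (dir_deriv v h)"
  \<comment> \<open>Half the gap: no number lies within \<open>e\<close> of both \<open>?A x\<close>
    and \<open>?B x\<close>.\<close>
  define e where "e = \<bar>?A x - ?B x\<bar> / 2"
  assume "?A x \<noteq> ?B x"
  then have e: "e > 0" by (simp add: e_def)
  have "continuous_on S ?A" "continuous_on S ?B"
    using h by (auto intro!: smooth_on_continuous[OF S] smooth_on_dir_deriv[OF S])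
  then obtain r1 r2 where r: "r1 > 0" "\<And>y. y \<in> S \<Longrightarrow> dist y x < r1 \<Longrightarrow> dist (?A y) (?A x) < e"
     "r2 > 0" "\<And>y. y \<in> S \<Longrightarrow> dist y x < r2 \<Longrightarrow> dist (?B y) (?B x) < e"
    unfolding continuous_on_iff using e x by metis
  obtain r3 where r3: "r3 > 0" "ball x r3 \<subseteq> S"
    using S x open_contains_ball by blast
  define r where "r = min r1 (min r2 r3)"
  have r0: "r > 0" using r r3 by (simp add: r_def)
  \<comment> \<open>Small enough for the whole parallelogram spanned by \<open>s v\<close> and
    \<open>s w\<close> at \<open>x\<close> to stay in the ball of radius \<open>r\<close>; the
    summand \<open>1\<close> keeps the denominator positive when both directions vanish.\<close>
  define s where "s = r / (2 * (norm v + norm w + 1))"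
  have nn: "0 < 2 * (norm v + norm w + 1)"
    by (intro mult_pos_pos add_nonneg_pos add_nonneg_nonneg) auto
  have s0: "s > 0" using r0 nn by (simp add: s_def)
  have sr: "s * (norm v + norm w) < r"
  proof -
    have "s * (norm v + norm w) \<le> s * (norm v + norm w + 1)"
      using s0 by (simp add: mult_left_mono)
    also have "\<dots> = r / 2"
      using nn by (simp add: s_def field_simps)
    finally show ?thesis using r0 by simp
  qed
  have near: "dist (x + a *\<^sub>R v + b *\<^sub>R w) x < r" if "a \<in> {0..s}" "b \<in> {0..s}" for a b
  proof -
    have "dist (x + a *\<^sub>R v + b *\<^sub>R w) x = norm (a *\<^sub>R v + b *\<^sub>R w)"
      by (simp add: dist_norm)
    also have "\<dots> \<le> a * norm v + b * norm w"
      using that norm_triangle_ineq[of "a *\<^sub>R v" "b *\<^sub>R w"] by simp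
    also have "\<dots> \<le> s * norm v + s * norm w"
      using that by (intro add_mono mult_right_mono) auto
    finally show ?thesis using sr by (simp add: distrib_left)
  qed
  have inS: "x + a *\<^sub>R v + b *\<^sub>R w \<in> S" if "a \<in> {0..s}" "b \<in> {0..s}" for a b
    using near[OF that] r3(2) by (auto simp: r_def dist_commute)
  have dA: "dir_deriv w h differentiable at y" "dir_deriv v h differentiable at y" "h differentiable at y"
    if "y \<in> S" for y
    using that h by (auto intro!: smooth_on_differentiable[OF S] smooth_on_dir_deriv[OF S])
  obtain a b where ab: "a \<in> {0..s}" "b \<in> {0..s}"
      "h (x + s *\<^sub>R v + s *\<^sub>R w) - h (x + s *\<^sub>R v) - h (x + s *\<^sub>R w) + h x = s * s * ?B (x + a *\<^sub>R v + b *\<^sub>R w)"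
    using second_difference_mean_value[OF s0, of h x v w] inS dA by blast
  have inS': "x + b *\<^sub>R w + a *\<^sub>R v \<in> S" if "a \<in> {0..s}" "b \<in> {0..s}" for a b
    using inS[OF that] by (simp add: add_ac)
  obtain a' b' where ab': "a' \<in> {0..s}" "b' \<in> {0..s}"
      "h (x + s *\<^sub>R w + s *\<^sub>R v) - h (x + s *\<^sub>R w) - h (x + s *\<^sub>R v) + h x = s * s * ?A (x + a' *\<^sub>R w + b' *\<^sub>R v)"
    using second_difference_mean_value[OF s0, of h x w v] inS' dA by blast
  have *: "x + a' *\<^sub>R w + b' *\<^sub>R v = x + b' *\<^sub>R v + a' *\<^sub>R w" "x + s *\<^sub>R w + s *\<^sub>R v = x + s *\<^sub>R v + s *\<^sub>R w"
    by (simp_all add: add_ac)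
  have "?A (x + b' *\<^sub>R v + a' *\<^sub>R w) = ?B (x + a *\<^sub>R v + b *\<^sub>R w)"
    using ab(3) ab'(3) s0 unfolding * by (simp add: algebra_simps)
  moreover have "dist (?A (x + b' *\<^sub>R v + a' *\<^sub>R w)) (?A x) < e"
    using near[of b' a'] inS[of b' a'] ab' by (intro r(2)) (auto simp: r_def)
  moreover have "dist (?B (x + a *\<^sub>R v + b *\<^sub>R w)) (?B x) < e"
    using near[of a b] inS[of a b] ab by (intro r(4)) (auto simp: r_def)
  moreover have "\<lbrakk>\<bar>c - a\<bar> < \<bar>a - b\<bar> / 2; \<bar>c - b\<bar> < \<bar>a - b\<bar> / 2\<rbrakk> \<Longrightarrow> False" for a b c :: real
    by (auto simp: abs_if split: if_splits)
  ultimately show False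
    unfolding e_def dist_real_def by metis
qed

text \<open>If the second derivative were positive, the first would be positive just to the right of
  the maximum, and the mean value theorem would make \<open>h\<close> increase there. Only points on
  the line through \<open>x\<close> in direction \<open>v\<close> are compared, which later keeps
  time frozen.\<close>

lemma second_derivative_test:
  fixes h :: "'a::real_normed_vector \<Rightarrow> real"
  assumes S: "open S" "x \<in> S" and h: "\<And>y. y \<in> S \<Longrightarrow> h differentiable at y"
    and h': "dir_deriv v h differentiable at x"
    and max: "\<And>s. x + s *\<^sub>R v \<in> S \<Longrightarrow> h (x + s *\<^sub>R v) \<le> h x"
  shows "dir_deriv v h x = 0" "dir_deriv v (dir_deriv v h) x \<le> 0"
proof -
  have "open ((\<lambda>s. x + s *\<^sub>R v) -` S)"
    by (intro open_vimage S continuous_intros)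
  moreover have "0 \<in> (\<lambda>s. x + s *\<^sub>R v) -` S"
    using S(2) by simp
  ultimately obtain r where "r > 0" "\<forall>s. dist s 0 < r \<longrightarrow> s \<in> (\<lambda>s. x + s *\<^sub>R v) -` S"
    unfolding open_dist by blast
  then have r: "r > 0" "\<And>s. \<bar>s\<bar> < r \<Longrightarrow> x + s *\<^sub>R v \<in> S"
    by auto
  have D: "DERIV (\<lambda>s. h (x + s *\<^sub>R v)) s :> dir_deriv v h (x + s *\<^sub>R v)" if "\<bar>s\<bar> < r" for s
    using r(2)[OF that] h by (intro line_DERIV) auto
  have D2: "DERIV (\<lambda>s. dir_deriv v h (x + s *\<^sub>R v)) 0 :> dir_deriv v (dir_deriv v h) x"
    using line_DERIV[of "dir_deriv v h" x 0 v] h' by simp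
  show 0: "dir_deriv v h x = 0"
    by (rule DERIV_local_max[of "\<lambda>s. h (x + s *\<^sub>R v)" _ 0 r]) (use D[of 0] r max in auto)
  show "dir_deriv v (dir_deriv v h) x \<le> 0"
  proof (rule ccontr)
    assume "\<not> ?thesis"
    then obtain d where d: "d > 0" "\<And>s. s > 0 \<Longrightarrow> s < d \<Longrightarrow> dir_deriv v h (x + s *\<^sub>R v) > 0"
      using DERIV_pos_inc_right[OF D2] 0 by auto
    define s where "s = min d r / 2"
    have s: "0 < s" "s < d" "s < r" using d r by (auto simp: s_def)
    have "\<exists>z>0. z < s \<and> h (x + s *\<^sub>R v) - h (x + 0 *\<^sub>R v) = (s - 0) * dir_deriv v h (x + z *\<^sub>R v)"
      by (rule MVT2) (use s D in auto)
    then obtain z where "0 < z" "z < s" "h (x + s *\<^sub>R v) - h x = s * dir_deriv v h (x + z *\<^sub>R v)"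
      by auto
    moreover have "h (x + s *\<^sub>R v) \<le> h x"
      using s r by (intro max) auto
    moreover have "0 < s * dir_deriv v h (x + z *\<^sub>R v)"
      using s d(2)[of z] \<open>0 < z\<close> \<open>z < s\<close> by simp
    ultimately show False by linarith
  qed
qed

section \<open>Positive semidefinite matrices\<close>

text \<open>Lagrange reduction: a positive diagonal entry splits off a square and clears its row.\<close>

lemma psd_sum_of_squares:
  fixes P :: "real^'n^'n"
  assumes "transpose P = P" "\<And>v. 0 \<le> v \<bullet> (P *v v)"
  shows "\<exists>b :: 'n \<Rightarrow> real^'n. \<forall>i j. P $ i $ j = (\<Sum>a\<in>UNIV. b a $ i * b a $ j)"
proof -
  have "\<exists>b :: 'n \<Rightarrow> real^'n. \<forall>i j. P $ i $ j = (\<Sum>a\<in>I. b a $ i * b a $ j)"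
    if "finite I" "transpose P = P" "\<And>v. 0 \<le> v \<bullet> (P *v v)" "\<And>i j. i \<notin> I \<Longrightarrow> P $ i $ j = 0"
    for I and P :: "real^'n^'n"
    using that
  proof (induction I arbitrary: P rule: finite_induct)
    case (insert m I)
    have sym: "P $ i $ j = P $ j $ i" for i j
      using insert.prems(1) by (metis transpose_def vec_lambda_beta)
    have symB: "v \<bullet> (P *v w) = w \<bullet> (P *v v)" for v w
      using insert.prems(1) dot_lmul_matrix[of v P w]
      by (metis inner_commute transpose_matrix_vector)
    have ax: "axis i 1 \<bullet> (P *v v) = (P *v v) $ i" for i v
      by (simp add: inner_axis')
    have axx: "(P *v axis j 1) $ i = P $ i $ j" for i j
      by (simp add: matrix_vector_mult_basis column_def)
    have expand: "(v + c *\<^sub>R axis m 1) \<bullet> (P *v (v + c *\<^sub>R axis m 1))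
        = v \<bullet> (P *v v) + 2 * c * (P *v v) $ m + c * c * P $ m $ m" for v c
      using symB[of v "axis m 1"]
      by (simp add: matrix_vector_right_distrib matrix_vector_mult_scaleR inner_add_left inner_add_right
          ax axx algebra_simps)
    have pm: "P $ m $ m \<ge> 0"
      using insert.prems(2)[of "axis m 1"] by (simp add: ax axx)
    show ?case
    proof (cases "P $ m $ m = 0")
      case True
      have 0: "(P *v v) $ m = 0" for v
      proof (rule ccontr)
        let ?x = "(P *v v) $ m" and ?y = "v \<bullet> (P *v v)"
        assume nz: "?x \<noteq> 0"
        \<comment> \<open>With a zero diagonal entry the form is affine in \<open>c\<close>; a
          nonconstant affine function cannot stay nonnegative. At the \<open>c\<close> chosen below
          it equals \<open>-1\<close>.\<close>
        have "0 \<le> ?y + 2 * c * ?x" for c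
          using insert.prems(2)[of "v + c *\<^sub>R axis m 1"] expand[of v c] True by simp
        from this[of "- (?y + 1) / (2 * ?x)"] nz insert.prems(2)[of v] show False
          by (simp add: field_simps)
      qed
      have "P $ m $ j = 0" for j
        using 0[of "axis j 1"] axx by simp
      then have "P $ i $ j = 0" if "i \<notin> I" for i j
        using insert.prems(3)[of i j] that by (cases "i = m") auto
      with insert.IH[OF insert.prems(1,2)] obtain b :: "'n \<Rightarrow> real^'n"
        where b: "\<And>i j. P $ i $ j = (\<Sum>a\<in>I. b a $ i * b a $ j)" by blast
      have "P $ i $ j = (\<Sum>a\<in>insert m I. (b(m := 0)) a $ i * (b(m := 0)) a $ j)" for i j
        using insert.hyps b[of i j] by (simp, intro sum.cong) auto
      then show ?thesis by blast
    next
      case False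
      then have p: "P $ m $ m > 0" using pm by simp
      define Q :: "real^'n^'n" where "Q = (\<chi> i j. P $ i $ j - P $ i $ m * P $ j $ m / P $ m $ m)"
      have "transpose Q = Q"
        by (simp add: Q_def transpose_def vec_eq_iff sym mult.commute)
      moreover have "0 \<le> v \<bullet> (Q *v v)" for v
      proof -
        \<comment> \<open>The value of \<open>c\<close> that minimises the form of \<open>P\<close>
          along the \<open>m\<close>-th axis through \<open>v\<close>; the minimum is the form of
          the Schur complement \<open>Q\<close> at \<open>v\<close>.\<close>
        define c where "c = - ((P *v v) $ m) / P $ m $ m"
        have s: "(P *v v) $ m = (\<Sum>j\<in>UNIV. P $ j $ m * v $ j)"
          by (simp add: matrix_vector_mult_def sym[of m])
        have "v \<bullet> (Q *v v) = (\<Sum>i\<in>UNIV. v $ i * (\<Sum>j\<in>UNIV. P $ i $ j * v $ j)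
             - v $ i * (P $ i $ m * (\<Sum>j\<in>UNIV. P $ j $ m * v $ j) / P $ m $ m))"
          by (simp add: Q_def inner_vec_def matrix_vector_mult_def left_diff_distrib right_diff_distrib
             sum_subtractf sum_distrib_left sum_divide_distrib mult_ac)
        also have "\<dots> = v \<bullet> (P *v v) - (\<Sum>i\<in>UNIV. P $ i $ m * v $ i) * (P *v v) $ m / P $ m $ m"
          unfolding s by (simp add: sum_subtractf inner_vec_def matrix_vector_mult_def[of P]
             sum_distrib_right sum_divide_distrib mult_ac)
        also have "\<dots> = v \<bullet> (P *v v) - (P *v v) $ m * (P *v v) $ m / P $ m $ m"
          by (simp add: s)
        also have "\<dots> = (v + c *\<^sub>R axis m 1) \<bullet> (P *v (v + c *\<^sub>R axis m 1))"
          unfolding expand using p by (simp add: c_def field_simps)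
        finally show ?thesis using insert.prems(2) by simp
      qed
      moreover have "Q $ i $ j = 0" if "i \<notin> I" for i j
        using insert.prems(3)[of i j] insert.prems(3)[of i m] that p
        by (cases "i = m") (auto simp: Q_def sym[of m j])
      ultimately obtain b :: "'n \<Rightarrow> real^'n"
        where b: "\<And>i j. Q $ i $ j = (\<Sum>a\<in>I. b a $ i * b a $ j)"
        using insert.IH[of Q] by blast
      define b' where "b' = b(m := (1 / sqrt (P $ m $ m)) *\<^sub>R (\<chi> i. P $ i $ m))"
      have "(\<Sum>a\<in>I. b' a $ i * b' a $ j) = (\<Sum>a\<in>I. b a $ i * b a $ j)" for i j
        using insert.hyps by (intro sum.cong) (auto simp: b'_def)
      then have "P $ i $ j = (\<Sum>a\<in>insert m I. b' a $ i * b' a $ j)" for i j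
        using insert.hyps b[of i j] p by (simp add: b'_def Q_def field_simps)
      then show ?thesis by blast
    qed
  qed (simp add: vec_eq_iff)
  from this[of UNIV P] assms show ?thesis by simp
qed

text \<open>Writing \<open>P\<close> as a sum of squares turns the trace into a sum of values of the
  form \<open>H\<close> at the vectors \<open>b a\<close>. It will serve with \<open>P\<close> the
  inverse metric and \<open>H\<close> the second derivatives at a maximum.\<close>

lemma psd_trace_nonpos:
  fixes P :: "real^'n^'n"
  assumes "transpose P = P" "\<And>v. 0 \<le> v \<bullet> (P *v v)"
    and "\<And>w :: real^'n. (\<Sum>i\<in>UNIV. \<Sum>j\<in>UNIV. w $ i * w $ j * H i j) \<le> 0"
  shows "(\<Sum>i\<in>UNIV. \<Sum>j\<in>UNIV. P $ i $ j * H i j) \<le> (0::real)"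
proof -
  obtain b :: "'n \<Rightarrow> real^'n" where b: "\<And>i j. P $ i $ j = (\<Sum>a\<in>UNIV. b a $ i * b a $ j)"
    using psd_sum_of_squares[OF assms(1,2)] by blast
  have "(\<Sum>i\<in>UNIV. \<Sum>j\<in>UNIV. P $ i $ j * H i j)
      = (\<Sum>i\<in>UNIV. \<Sum>j\<in>UNIV. \<Sum>a\<in>UNIV. b a $ i * b a $ j * H i j)"
    by (simp add: b sum_distrib_right)
  also have "\<dots> = (\<Sum>i\<in>UNIV. \<Sum>a\<in>UNIV. \<Sum>j\<in>UNIV. b a $ i * b a $ j * H i j)"
    by (intro sum.cong refl sum.swap)
  also have "\<dots> = (\<Sum>a\<in>UNIV. \<Sum>i\<in>UNIV. \<Sum>j\<in>UNIV. b a $ i * b a $ j * H i j)"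
    by (rule sum.swap)
  also have "\<dots> \<le> 0"
    by (rule sum_nonpos) (rule assms(3))
  finally show ?thesis .
qed

text \<open>The product \<open>A = P H\<close> need not be symmetric, but if \<open>P\<close> is the
  sum of the squares of the vectors \<open>b a\<close>, then the trace of \<open>A A\<close> is the
  trace of \<open>X X\<close> for the symmetric matrix \<open>X a a' = b a . H (b a')\<close>, a sum
  of squares. Invariantly this is |Hess|^2.\<close>

lemma psd_trace_square_nonneg:
  fixes P :: "real^'n^'n"
  assumes "transpose P = P" "\<And>v. 0 \<le> v \<bullet> (P *v v)"
    and sym: "\<And>i j. H i j = H j i"
    and A: "\<And>i j. A i j = (\<Sum>m\<in>UNIV. P $ i $ m * H j m)"
  shows "(\<Sum>i\<in>UNIV. \<Sum>j\<in>UNIV. A i j * A j i) \<ge> (0::real)"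
proof -
  obtain b :: "'n \<Rightarrow> real^'n" where b: "\<And>i j. P $ i $ j = (\<Sum>a\<in>UNIV. b a $ i * b a $ j)"
    using psd_sum_of_squares[OF assms(1,2)] by blast
  define c where "c a j = (\<Sum>m\<in>UNIV. b a $ m * H j m)" for a j
  define X where "X a a' = (\<Sum>i\<in>UNIV. b a $ i * c a' i)" for a a'
  have Ac: "A i j = (\<Sum>a\<in>UNIV. b a $ i * c a j)" for i j
    unfolding A b c_def sum_distrib_right sum_distrib_left
    by (subst sum.swap) (simp add: mult_ac)
  have Xsym: "X a a' = X a' a" for a a'
    unfolding X_def c_def sum_distrib_left
    by (subst sum.swap) (simp add: mult_ac sym)
  have "(\<Sum>i\<in>UNIV. \<Sum>j\<in>UNIV. A i j * A j i)
     = (\<Sum>i\<in>UNIV. \<Sum>j\<in>UNIV. \<Sum>a\<in>UNIV. \<Sum>a'\<in>UNIV. b a $ i * c a j * (b a' $ j * c a' i))"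
    by (simp add: Ac sum_product)
  also have "\<dots> = (\<Sum>i\<in>UNIV. \<Sum>a\<in>UNIV. \<Sum>j\<in>UNIV. \<Sum>a'\<in>UNIV. b a $ i * c a j * (b a' $ j * c a' i))"
    by (intro sum.cong refl sum.swap)
  also have "\<dots> = (\<Sum>a\<in>UNIV. \<Sum>i\<in>UNIV. \<Sum>j\<in>UNIV. \<Sum>a'\<in>UNIV. b a $ i * c a j * (b a' $ j * c a' i))"
    by (rule sum.swap)
  also have "\<dots> = (\<Sum>a\<in>UNIV. \<Sum>i\<in>UNIV. \<Sum>a'\<in>UNIV. \<Sum>j\<in>UNIV. b a $ i * c a j * (b a' $ j * c a' i))"
    by (intro sum.cong refl sum.swap)
  also have "\<dots> = (\<Sum>a\<in>UNIV. \<Sum>a'\<in>UNIV. \<Sum>i\<in>UNIV. \<Sum>j\<in>UNIV. b a $ i * c a j * (b a' $ j * c a' i))"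
    by (intro sum.cong refl sum.swap)
  also have "\<dots> = (\<Sum>a\<in>UNIV. \<Sum>a'\<in>UNIV. X a a' * X a' a)"
    unfolding X_def sum_product by (intro sum.cong refl) (simp add: mult_ac)
  also have "\<dots> \<ge> 0"
    by (intro sum_nonneg) (metis Xsym zero_le_square)
  finally show ?thesis .
qed

section \<open>Bochner's formula in coordinates\<close>

text \<open>The directions \<open>e i\<close> are not assumed to span the ambient space. In the
  application \<open>S\<close> lies in spacetime, the \<open>e i\<close> are the spatial unit
  vectors, and time is a further constant direction. Derivatives in constant directions commute, so
  one calculus covers the spatial tensors and their evolution.\<close>

locale coordinate_metric =
  fixes S :: "'e::real_normed_vector set"
    and e :: "'n::finite \<Rightarrow> 'e"
    and G :: "'e \<Rightarrow> real^'n^'n"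
  assumes open_S: "open S"
    and smooth_G: "\<And>i j. smooth_on S (\<lambda>z. G z $ i $ j)"
    and sym_G: "\<And>z. z \<in> S \<Longrightarrow> transpose (G z) = G z"
    and det_G: "\<And>z. z \<in> S \<Longrightarrow> det (G z) \<noteq> 0"
begin

abbreviation D :: "'n \<Rightarrow> ('e \<Rightarrow> real) \<Rightarrow> 'e \<Rightarrow> real" where "D i \<equiv> dir_deriv (e i)"

definition GG :: "'n \<Rightarrow> 'n \<Rightarrow> 'e \<Rightarrow> real" where "GG i j z = G z $ i $ j"

definition PP :: "'n \<Rightarrow> 'n \<Rightarrow> 'e \<Rightarrow> real" where "PP i j z = matrix_inv (G z) $ i $ j"

definition Gam :: "'n \<Rightarrow> 'n \<Rightarrow> 'n \<Rightarrow> 'e \<Rightarrow> real" where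
  "Gam k i j z = 1 / 2 * (\<Sum>l\<in>UNIV. PP k l z * (D i (GG j l) z + D j (GG i l) z - D l (GG i j) z))"

definition grad :: "('e \<Rightarrow> real) \<Rightarrow> 'n \<Rightarrow> 'e \<Rightarrow> real" where
  "grad h i z = (\<Sum>j\<in>UNIV. PP i j z * D j h z)"

definition hess :: "('e \<Rightarrow> real) \<Rightarrow> 'n \<Rightarrow> 'n \<Rightarrow> 'e \<Rightarrow> real" where
  "hess h i j z = D i (D j h) z - (\<Sum>k\<in>UNIV. Gam k i j z * D k h z)"

definition lap :: "('e \<Rightarrow> real) \<Rightarrow> 'e \<Rightarrow> real" where
  "lap h z = (\<Sum>i\<in>UNIV. \<Sum>j\<in>UNIV. PP i j z * hess h i j z)"

definition ric :: "'n \<Rightarrow> 'n \<Rightarrow> 'e \<Rightarrow> real" where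
  "ric i j z = (\<Sum>k\<in>UNIV. D k (Gam k i j) z - D j (Gam k i k) z)
     + (\<Sum>k\<in>UNIV. \<Sum>l\<in>UNIV. Gam k k l z * Gam l i j z - Gam k j l z * Gam l i k z)"

definition inn :: "('e \<Rightarrow> real) \<Rightarrow> ('e \<Rightarrow> real) \<Rightarrow> 'e \<Rightarrow> real" where
  "inn h k z = (\<Sum>i\<in>UNIV. grad h i z * D i k z)"

text \<open>\<open>A h\<close> is the covariant derivative of the gradient of \<open>h\<close>, with upper index first.\<close>

definition A :: "('e \<Rightarrow> real) \<Rightarrow> 'n \<Rightarrow> 'n \<Rightarrow> 'e \<Rightarrow> real" where
  "A h i j z = D j (grad h i) z + (\<Sum>m\<in>UNIV. Gam i j m z * grad h m z)"

lemma smooth_GG: "smooth_on S (GG i j)"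
  using smooth_G unfolding GG_def[abs_def] .

lemma smooth_PP: "smooth_on S (PP i j)"
  using smooth_on_matrix_inv[OF open_S smooth_G det_G] unfolding PP_def[abs_def] by simp

lemmas smooth_intros = smooth_on_const[OF open_S] smooth_on_add[OF open_S] smooth_on_diff[OF open_S]
  smooth_on_mult[OF open_S] smooth_on_sum[OF open_S] smooth_on_dir_deriv[OF open_S]

lemma smooth_Gam: "smooth_on S (Gam i j k)"
  unfolding Gam_def[abs_def] by (intro smooth_intros smooth_PP smooth_GG)

lemma smooth_grad: "smooth_on S h \<Longrightarrow> smooth_on S (grad h i)"
  unfolding grad_def[abs_def] by (intro smooth_intros smooth_PP)

lemma smooth_hess: "smooth_on S h \<Longrightarrow> smooth_on S (hess h i j)"
  unfolding hess_def[abs_def] by (intro smooth_intros smooth_Gam)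

lemma smooth_lap: "smooth_on S h \<Longrightarrow> smooth_on S (lap h)"
  unfolding lap_def[abs_def] by (intro smooth_intros smooth_PP smooth_hess)

lemma smooth_inn: "smooth_on S h \<Longrightarrow> smooth_on S k \<Longrightarrow> smooth_on S (inn h k)"
  unfolding inn_def[abs_def] by (intro smooth_intros smooth_grad)

lemma smooth_A: "smooth_on S h \<Longrightarrow> smooth_on S (A h i j)"
  unfolding A_def[abs_def] by (intro smooth_intros smooth_grad smooth_Gam)

lemmas smooth = smooth_intros smooth_GG smooth_PP smooth_Gam smooth_grad smooth_hess smooth_lap
  smooth_inn smooth_A

lemmas diff_at = smooth_on_differentiable[OF open_S]

section \<open>Metric compatibility, the Ricci identity and Bochner's formula at a point\<close>

context
  fixes z assumes z: "z \<in> S"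
begin

lemma D_add: "smooth_on S h \<Longrightarrow> smooth_on S k \<Longrightarrow>
    dir_deriv v (\<lambda>z. h z + k z) z = dir_deriv v h z + dir_deriv v (k :: _ \<Rightarrow> real) z"
  using dir_deriv_add diff_at z by blast

lemma D_diff: "smooth_on S h \<Longrightarrow> smooth_on S k \<Longrightarrow>
    dir_deriv v (\<lambda>z. h z - k z) z = dir_deriv v h z - dir_deriv v (k :: _ \<Rightarrow> real) z"
  using dir_deriv_diff diff_at z by blast

lemma D_mult: "smooth_on S h \<Longrightarrow> smooth_on S k \<Longrightarrow>
    dir_deriv v (\<lambda>z. h z * k z) z = h z * dir_deriv v k z + dir_deriv v h z * (k z :: real)"
  using dir_deriv_mult diff_at z by blast

lemma D_sum: "(\<And>i. smooth_on S (h i)) \<Longrightarrow>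
    dir_deriv v (\<lambda>z. \<Sum>i\<in>UNIV. h (i::'n) z) z = (\<Sum>i\<in>UNIV. dir_deriv v (h i) z :: real)"
  by (rule dir_deriv_sum) (use diff_at z in blast)

lemmas D_rules = D_add D_diff D_mult D_sum

lemma PP_sym: "PP i j z = PP j i z"
  and GG_PP: "(\<Sum>l\<in>UNIV. GG i l z * PP l j z) = (if i = j then 1 else 0)"
  and PP_GG: "(\<Sum>l\<in>UNIV. PP i l z * GG l j z) = (if i = j then 1 else 0)"
proof -
  note inv = invertible_matrix_inv[OF det_G[OF z]]
  have "transpose (matrix_inv (G z)) = transpose (matrix_inv (G z)) ** (G z ** matrix_inv (G z))"
    by (simp add: inv)
  also have "\<dots> = transpose (G z ** matrix_inv (G z)) ** matrix_inv (G z)"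
    by (simp add: matrix_transpose_mul sym_G[OF z] matrix_mul_assoc)
  finally have *: "transpose (matrix_inv (G z)) = matrix_inv (G z)"
    by (simp add: inv)
  show "PP i j z = PP j i z" using arg_cong[OF *, of "\<lambda>X. X $ i $ j"]
    by (simp add: PP_def transpose_def)
  show "(\<Sum>l\<in>UNIV. GG i l z * PP l j z) = (if i = j then 1 else 0)"
    using arg_cong[OF inv(1), of "\<lambda>X. X $ i $ j"]
    by (simp add: matrix_matrix_mult_def mat_def GG_def PP_def)
  show "(\<Sum>l\<in>UNIV. PP i l z * GG l j z) = (if i = j then 1 else 0)"
    using arg_cong[OF inv(2), of "\<lambda>X. X $ i $ j"]
    by (simp add: matrix_matrix_mult_def mat_def GG_def PP_def)
qed

lemma D_GG_sym: "D k (GG i j) z = D k (GG j i) z"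
  using dir_deriv_cong[OF open_S z, of "GG i j" "GG j i"] sym_G
  by (simp add: GG_def transpose_def vec_eq_iff)

lemma Gam_sym: "Gam k i j z = Gam k j i z"
  unfolding Gam_def by (simp add: D_GG_sym[of _ i j] add.commute)

lemma contract_GG: "(\<Sum>l\<in>UNIV. GG i l z * (\<Sum>m\<in>UNIV. PP l m z * X m)) = X i"
proof -
  have "(\<Sum>l\<in>UNIV. GG i l z * (\<Sum>m\<in>UNIV. PP l m z * X m))
      = (\<Sum>m\<in>UNIV. (\<Sum>l\<in>UNIV. GG i l z * PP l m z) * X m)"
    unfolding sum_distrib_left sum_distrib_right by (subst sum.swap) (simp add: mult_ac)
  then show ?thesis by (simp add: GG_PP if_distrib[of "\<lambda>x. x * _"] cong: if_cong)
qed

lemma contract_PP: "(\<Sum>l\<in>UNIV. PP i l z * (\<Sum>m\<in>UNIV. GG l m z * X m)) = X i"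
proof -
  have "(\<Sum>l\<in>UNIV. PP i l z * (\<Sum>m\<in>UNIV. GG l m z * X m))
      = (\<Sum>m\<in>UNIV. (\<Sum>l\<in>UNIV. PP i l z * GG l m z) * X m)"
    unfolding sum_distrib_left sum_distrib_right by (subst sum.swap) (simp add: mult_ac)
  then show ?thesis by (simp add: PP_GG if_distrib[of "\<lambda>x. x * _"] cong: if_cong)
qed

lemma Gam_lower:
  "(\<Sum>l\<in>UNIV. GG i l z * Gam l k j z) = 1 / 2 * (D k (GG j i) z + D j (GG k i) z - D i (GG k j) z)"
proof -
  have "(\<Sum>l\<in>UNIV. GG i l z * Gam l k j z) = 1 / 2 * (\<Sum>l\<in>UNIV. GG i l z *
      (\<Sum>m\<in>UNIV. PP l m z * (D k (GG j m) z + D j (GG k m) z - D m (GG k j) z)))"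
    by (simp add: Gam_def sum_distrib_left mult_ac)
  then show ?thesis by (simp only: contract_GG)
qed

text \<open>The metric is parallel: in the two lowered Christoffel symbols all derivatives cancel
  except twice one half of the left-hand side.\<close>

lemma metric_compatible:
  "D k (GG i j) z = (\<Sum>l\<in>UNIV. GG i l z * Gam l k j z) + (\<Sum>l\<in>UNIV. GG j l z * Gam l k i z)"
  unfolding Gam_lower by (simp add: D_GG_sym[of _ j i] D_GG_sym[of j i k] field_simps)

text \<open>Differentiate \<open>G\<close> times its inverse, which is constant. The direction is
  arbitrary, so this also gives the time derivative of the inverse metric.\<close>

lemma dir_deriv_PP:
  "dir_deriv v (PP i j) z = - (\<Sum>a\<in>UNIV. \<Sum>b\<in>UNIV. PP i a z * dir_deriv v (GG a b) z * PP b j z)"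
proof -
  have "dir_deriv v (\<lambda>z. \<Sum>l\<in>UNIV. GG a l z * PP l j z) z = dir_deriv v (\<lambda>z. if a = j then 1 else 0) z" for a
    by (rule dir_deriv_cong[OF open_S z]) (rule coordinate_metric.GG_PP[OF coordinate_metric_axioms])
  then have *: "(\<Sum>l\<in>UNIV. GG a l z * dir_deriv v (PP l j) z) = - (\<Sum>l\<in>UNIV. dir_deriv v (GG a l) z * PP l j z)" for a
    by (simp add: D_rules smooth sum.distrib eq_neg_iff_add_eq_0)
  have "dir_deriv v (PP i j) z = (\<Sum>a\<in>UNIV. PP i a z * (\<Sum>l\<in>UNIV. GG a l z * dir_deriv v (PP l j) z))"
    by (simp only: contract_PP)
  then show ?thesis
    by (simp add: * sum_distrib_left sum_negf mult_ac)
qed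

text \<open>The inverse metric is parallel as well: after inserting \<open>metric_compatible\<close>
  into the derivative of the inverse, each term contains \<open>G\<close> contracted with its
  inverse.\<close>

lemma D_PP:
  "D k (PP i j) z = - (\<Sum>l\<in>UNIV. Gam i k l z * PP l j z) - (\<Sum>l\<in>UNIV. Gam j k l z * PP l i z)"
proof -
  have 1: "(\<Sum>a\<in>UNIV. \<Sum>b\<in>UNIV. PP i a z * (\<Sum>l\<in>UNIV. GG a l z * Gam l k b z) * PP b j z)
     = (\<Sum>b\<in>UNIV. Gam i k b z * PP b j z)" for i j
    by (subst sum.swap) (simp add: sum_distrib_right[symmetric] contract_PP)
  have 2: "(\<Sum>a\<in>UNIV. \<Sum>b\<in>UNIV. PP i a z * (\<Sum>l\<in>UNIV. GG b l z * Gam l k a z) * PP b j z)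
     = (\<Sum>b\<in>UNIV. Gam j k b z * PP b i z)"
    using 1[of j i] by (subst sum.swap) (simp add: PP_sym[of _ j] PP_sym[of _ i] mult_ac)
  show ?thesis
    unfolding dir_deriv_PP metric_compatible
    by (simp add: distrib_left distrib_right sum.distrib 1 2)
qed


text \<open>Raising an index commutes with covariant differentiation since the inverse metric is
  parallel. Of the two terms of \<open>D_PP\<close>, one cancels the connection term of
  \<open>A\<close> and the other is the connection term of the Hessian.\<close>

lemma A_hess:
  assumes h: "smooth_on S h"
  shows "A h i j z = (\<Sum>m\<in>UNIV. PP i m z * hess h j m z)"
proof -
  have "D j (grad h i) z = (\<Sum>m\<in>UNIV. PP i m z * D j (D m h) z) + (\<Sum>m\<in>UNIV. D j (PP i m) z * D m h z)"
    unfolding grad_def[abs_def] by (simp add: D_rules smooth h sum.distrib)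
  also have "(\<Sum>m\<in>UNIV. D j (PP i m) z * D m h z)
      = - (\<Sum>l\<in>UNIV. Gam i j l z * grad h l z) - (\<Sum>l\<in>UNIV. PP i l z * (\<Sum>m\<in>UNIV. Gam m j l z * D m h z))"
  proof -
    have "(\<Sum>m\<in>UNIV. (\<Sum>l\<in>UNIV. Gam i j l z * PP l m z) * D m h z) = (\<Sum>l\<in>UNIV. Gam i j l z * grad h l z)"
      unfolding grad_def sum_distrib_left sum_distrib_right by (subst sum.swap) (simp add: mult_ac)
    moreover have "(\<Sum>m\<in>UNIV. (\<Sum>l\<in>UNIV. Gam m j l z * PP l i z) * D m h z)
        = (\<Sum>l\<in>UNIV. PP i l z * (\<Sum>m\<in>UNIV. Gam m j l z * D m h z))"
      unfolding sum_distrib_left sum_distrib_right by (subst sum.swap) (simp add: mult_ac PP_sym[of _ i])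
    ultimately show ?thesis
      by (simp add: D_PP left_diff_distrib sum_subtractf sum_negf)
  qed
  finally show ?thesis
    by (simp add: A_def hess_def right_diff_distrib sum_subtractf)
qed

lemma hess_sym: "smooth_on S h \<Longrightarrow> hess h i j z = hess h j i z"
  unfolding hess_def by (simp add: Gam_sym[of _ i j] dir_deriv_commute[OF open_S _ z, of h "e i" "e j"])

lemma lap_trace: "smooth_on S h \<Longrightarrow> lap h z = (\<Sum>i\<in>UNIV. A h i i z)"
  by (simp add: lap_def A_hess)

lemma lap_divergence:
  "smooth_on S h \<Longrightarrow> lap h z = (\<Sum>i\<in>UNIV. D i (grad h i) z + (\<Sum>m\<in>UNIV. Gam i i m z * grad h m z))"
  by (simp add: lap_trace A_def)

text \<open>The Leibniz rule for the covariant derivative. The connection term left over from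
  differentiating \<open>grad h\<close> is exactly what completes the second derivatives of
  \<open>k\<close> to its Hessian.\<close>

lemma D_inn:
  assumes h: "smooth_on S h" and k: "smooth_on S k"
  shows "D j (inn h k) z = (\<Sum>m\<in>UNIV. grad h m z * hess k j m z) + (\<Sum>m\<in>UNIV. grad k m z * hess h j m z)"
proof -
  have gk: "(\<Sum>i\<in>UNIV. PP i m z * D i k z) = grad k m z" for m
    by (simp add: grad_def PP_sym[of _ m])
  have "D j (inn h k) z = (\<Sum>i\<in>UNIV. grad h i z * D j (D i k) z) + (\<Sum>i\<in>UNIV. D j (grad h i) z * D i k z)"
    unfolding inn_def[abs_def] by (simp add: D_rules smooth h k sum.distrib)
  moreover have "D j (grad h i) z = (\<Sum>m\<in>UNIV. PP i m z * hess h j m z) - (\<Sum>m\<in>UNIV. Gam i j m z * grad h m z)" for i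
    using A_hess[OF h, of i j] by (simp add: A_def)
  moreover have "(\<Sum>i\<in>UNIV. (\<Sum>m\<in>UNIV. PP i m z * hess h j m z) * D i k z) = (\<Sum>m\<in>UNIV. grad k m z * hess h j m z)"
    unfolding gk[symmetric] sum_distrib_right by (subst sum.swap) (simp add: mult_ac)
  moreover have "(\<Sum>i\<in>UNIV. (\<Sum>m\<in>UNIV. Gam i j m z * grad h m z) * D i k z)
      = (\<Sum>m\<in>UNIV. grad h m z * (\<Sum>i\<in>UNIV. Gam i j m z * D i k z))"
    unfolding sum_distrib_right sum_distrib_left by (subst sum.swap) (simp add: mult_ac)
  ultimately show ?thesis
    by (simp add: hess_def[of k] left_diff_distrib right_diff_distrib sum_subtractf)
qed

text \<open>The contracted Ricci identity for the vector field \<open>grad h\<close>. The left-hand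
  side is the divergence of \<open>A h\<close>, with \<open>+ Gam\<close> for its upper and
  \<open>- Gam\<close> for its lower index; the second derivatives of the field cancel by symmetry
  against those of \<open>D j (lap h)\<close>, and what remains is the coordinate expression of the
  Ricci tensor.\<close>

lemma commute_covariant:
  assumes h: "smooth_on S h"
  shows "(\<Sum>i\<in>UNIV. D i (A h i j) z) + (\<Sum>i\<in>UNIV. \<Sum>m\<in>UNIV. Gam i i m z * A h m j z)
      - (\<Sum>i\<in>UNIV. \<Sum>m\<in>UNIV. Gam m i j z * A h i m z)
    = D j (lap h) z + (\<Sum>m\<in>UNIV. ric m j z * grad h m z)"
proof -
  let ?v = "grad h"
  have lap: "D j (lap h) z = (\<Sum>i\<in>UNIV. D j (A h i i) z)"
    using dir_deriv_cong[OF open_S z, of "lap h" "\<lambda>z. \<Sum>i\<in>UNIV. A h i i z"]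
      coordinate_metric.lap_trace[OF coordinate_metric_axioms _ h]
    by (simp add: D_rules smooth h)
  have DA: "D k (A h i j) z = D k (D j (?v i)) z + (\<Sum>m\<in>UNIV. Gam i j m z * D k (?v m) z)
      + (\<Sum>m\<in>UNIV. D k (Gam i j m) z * ?v m z)" for i j k
    unfolding A_def[abs_def] by (simp add: D_rules smooth h sum.distrib)
  have c: "D i (D j (?v i)) z = D j (D i (?v i)) z" for i
    by (rule dir_deriv_commute[OF open_S _ z]) (simp add: smooth h)
  have e1: "(\<Sum>i\<in>UNIV. \<Sum>m\<in>UNIV. Gam i i m z * A h m j z)
     = (\<Sum>i\<in>UNIV. \<Sum>m\<in>UNIV. Gam i i m z * D j (?v m) z)
     + (\<Sum>i\<in>UNIV. \<Sum>m\<in>UNIV. \<Sum>p\<in>UNIV. Gam i i m z * Gam m j p z * ?v p z)"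
    by (simp add: A_def distrib_left sum.distrib sum_distrib_left mult_ac)
  have e2: "(\<Sum>i\<in>UNIV. \<Sum>m\<in>UNIV. Gam m i j z * A h i m z)
     = (\<Sum>i\<in>UNIV. \<Sum>m\<in>UNIV. Gam i j m z * D i (?v m) z)
     + (\<Sum>i\<in>UNIV. \<Sum>m\<in>UNIV. \<Sum>p\<in>UNIV. Gam m i j z * Gam i m p z * ?v p z)"
  proof -
    have "(\<Sum>i\<in>UNIV. \<Sum>m\<in>UNIV. Gam m i j z * D m (?v i) z) = (\<Sum>i\<in>UNIV. \<Sum>m\<in>UNIV. Gam i j m z * D i (?v m) z)"
      by (subst sum.swap) (simp add: Gam_sym[of _ j])
    then show ?thesis
      by (simp add: A_def distrib_left sum.distrib sum_distrib_left mult_ac)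
  qed
  \<comment> \<open>The Ricci contraction is brought to the index names in which its four sums occur
    in the expansion of the left-hand side.\<close>
  have r: "(\<Sum>m\<in>UNIV. ric m j z * ?v m z) = (\<Sum>i\<in>UNIV. \<Sum>m\<in>UNIV. D i (Gam i j m) z * ?v m z)
       - (\<Sum>i\<in>UNIV. \<Sum>m\<in>UNIV. D j (Gam i i m) z * ?v m z)
       + (\<Sum>i\<in>UNIV. \<Sum>m\<in>UNIV. \<Sum>p\<in>UNIV. Gam i i m z * Gam m j p z * ?v p z)
       - (\<Sum>i\<in>UNIV. \<Sum>m\<in>UNIV. \<Sum>p\<in>UNIV. Gam m i j z * Gam i m p z * ?v p z)"
  proof -
    have d: "dir_deriv w (Gam i a b) z = dir_deriv w (Gam i b a) z" for w i a b
      by (rule dir_deriv_cong[OF open_S z]) (rule coordinate_metric.Gam_sym[OF coordinate_metric_axioms])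
    have a: "(\<Sum>m\<in>UNIV. (\<Sum>i\<in>UNIV. X i m) * ?v m z) = (\<Sum>i\<in>UNIV. \<Sum>m\<in>UNIV. X i m * ?v m z)" for X :: "'n \<Rightarrow> 'n \<Rightarrow> real"
      unfolding sum_distrib_right by (rule sum.swap)
    have b: "(\<Sum>p\<in>UNIV. (\<Sum>i\<in>UNIV. \<Sum>m\<in>UNIV. X i m p) * ?v p z) = (\<Sum>i\<in>UNIV. \<Sum>m\<in>UNIV. \<Sum>p\<in>UNIV. X i m p * ?v p z)"
      for X :: "'n \<Rightarrow> 'n \<Rightarrow> 'n \<Rightarrow> real"
    proof -
      have "(\<Sum>p\<in>UNIV. (\<Sum>i\<in>UNIV. \<Sum>m\<in>UNIV. X i m p) * ?v p z) = (\<Sum>i\<in>UNIV. \<Sum>p\<in>UNIV. \<Sum>m\<in>UNIV. X i m p * ?v p z)"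
        unfolding sum_distrib_right by (rule sum.swap)
      also have "\<dots> = (\<Sum>i\<in>UNIV. \<Sum>m\<in>UNIV. \<Sum>p\<in>UNIV. X i m p * ?v p z)"
        by (intro sum.cong refl sum.swap)
      finally show ?thesis .
    qed
    have "(\<Sum>i\<in>UNIV. \<Sum>m\<in>UNIV. \<Sum>p\<in>UNIV. Gam m i j z * Gam i m p z * ?v p z)
       = (\<Sum>i\<in>UNIV. \<Sum>m\<in>UNIV. \<Sum>p\<in>UNIV. Gam i j m z * Gam m p i z * ?v p z)"
      by (subst sum.swap) (simp add: Gam_sym)
    moreover have "ric m j z * ?v m z = (\<Sum>k\<in>UNIV. D k (Gam k j m) z) * ?v m z - (\<Sum>k\<in>UNIV. D j (Gam k k m) z) * ?v m z
       + (\<Sum>k\<in>UNIV. \<Sum>l\<in>UNIV. Gam k k l z * Gam l j m z) * ?v m z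
       - (\<Sum>k\<in>UNIV. \<Sum>l\<in>UNIV. Gam k j l z * Gam l m k z) * ?v m z" for m
      by (simp add: ric_def sum_subtractf d[of _ _ m] Gam_sym[of _ m j] algebra_simps)
    ultimately show ?thesis
      by (simp only: sum_subtractf sum.distrib a b)
  qed
  show ?thesis
    unfolding lap DA e1 e2 r by (simp add: sum.distrib c)
qed

text \<open>The gradient of \<open>inn h h\<close> is twice \<open>A h\<close> applied to
  \<open>grad h\<close>. Taking its divergence, one derivative falls on \<open>grad h\<close> and
  gives the trace of the square of \<open>A h\<close>, the other gives the divergence of
  \<open>A h\<close>, which \<open>commute_covariant\<close> evaluates.\<close>

lemma lap_norm_grad:
  assumes h: "smooth_on S h"
  shows "lap (inn h h) z = 2 * (\<Sum>i\<in>UNIV. \<Sum>m\<in>UNIV. A h i m z * A h m i z)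
     + 2 * (\<Sum>j\<in>UNIV. grad h j z * D j (lap h) z)
     + 2 * (\<Sum>j\<in>UNIV. \<Sum>m\<in>UNIV. ric m j z * grad h m z * grad h j z)"
proof -
  let ?v = "grad h"
  \<comment> \<open>The formula is differentiated again at \<open>z\<close>, so it is needed at
    every point of \<open>S\<close>; the pointwise facts are therefore instantiated afresh at
    \<open>y\<close>.\<close>
  have gq: "grad (inn h h) i y = (\<Sum>j\<in>UNIV. 2 * (?v j y * A h i j y))" if y: "y \<in> S" for i y
  proof -
    note L = coordinate_metric.D_inn[OF coordinate_metric_axioms y h h]
      coordinate_metric.A_hess[OF coordinate_metric_axioms y h]
      coordinate_metric.hess_sym[OF coordinate_metric_axioms y h]
    have "grad (inn h h) i y = (\<Sum>k\<in>UNIV. \<Sum>j\<in>UNIV. PP i k y * (2 * (?v j y * hess h k j y)))"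
      by (simp add: grad_def[of "inn h h"] L(1) sum_distrib_left mult_2[symmetric] mult_ac)
    also have "\<dots> = (\<Sum>j\<in>UNIV. \<Sum>k\<in>UNIV. PP i k y * (2 * (?v j y * hess h j k y)))"
      by (subst sum.swap) (simp add: L(3))
    finally show ?thesis
      by (simp add: L(2) sum_distrib_left mult_ac)
  qed
  have dv: "D i (?v m) z = A h m i z - (\<Sum>p\<in>UNIV. Gam m i p z * ?v p z)" for i m
    by (simp add: A_def)
  have "D i (grad (inn h h) i) z = (\<Sum>j\<in>UNIV. 2 * (?v j z * D i (A h i j) z + D i (?v j) z * A h i j z))" for i
  proof -
    have "D i (grad (inn h h) i) z = D i (\<lambda>y. \<Sum>j\<in>UNIV. 2 * (?v j y * A h i j y)) z"
      by (rule dir_deriv_cong[OF open_S z gq])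
    then show ?thesis
      by (simp add: D_rules smooth h)
  qed
  then have "lap (inn h h) z = 2 * (\<Sum>i\<in>UNIV. \<Sum>j\<in>UNIV. ?v j z * D i (A h i j) z)
       + 2 * (\<Sum>i\<in>UNIV. \<Sum>j\<in>UNIV. D i (?v j) z * A h i j z)
       + 2 * (\<Sum>i\<in>UNIV. \<Sum>m\<in>UNIV. Gam i i m z * (\<Sum>j\<in>UNIV. ?v j z * A h m j z))"
    by (simp add: lap_divergence smooth h gq[OF z] sum.distrib sum_distrib_left algebra_simps)
  moreover have "(\<Sum>i\<in>UNIV. \<Sum>j\<in>UNIV. ?v j z * D i (A h i j) z) = (\<Sum>j\<in>UNIV. ?v j z * (\<Sum>i\<in>UNIV. D i (A h i j) z))"
    by (subst sum.swap) (simp add: sum_distrib_left)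
  moreover have "(\<Sum>i\<in>UNIV. \<Sum>j\<in>UNIV. D i (?v j) z * A h i j z)
      = (\<Sum>i\<in>UNIV. \<Sum>j\<in>UNIV. A h i j z * A h j i z) - (\<Sum>j\<in>UNIV. ?v j z * (\<Sum>i\<in>UNIV. \<Sum>m\<in>UNIV. Gam m i j z * A h i m z))"
  proof -
    have "(\<Sum>i\<in>UNIV. \<Sum>m\<in>UNIV. (\<Sum>j\<in>UNIV. Gam m i j z * ?v j z) * A h i m z)
        = (\<Sum>i\<in>UNIV. \<Sum>j\<in>UNIV. \<Sum>m\<in>UNIV. ?v j z * (Gam m i j z * A h i m z))"
      unfolding sum_distrib_right by (rule sum.cong[OF refl], subst sum.swap) (simp add: mult_ac)
    also have "\<dots> = (\<Sum>j\<in>UNIV. ?v j z * (\<Sum>i\<in>UNIV. \<Sum>m\<in>UNIV. Gam m i j z * A h i m z))"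
      unfolding sum_distrib_left by (rule sum.swap)
    finally show ?thesis
      unfolding dv left_diff_distrib sum_subtractf by (simp add: mult_ac)
  qed
  moreover have "(\<Sum>i\<in>UNIV. \<Sum>m\<in>UNIV. Gam i i m z * (\<Sum>j\<in>UNIV. ?v j z * A h m j z))
      = (\<Sum>j\<in>UNIV. ?v j z * (\<Sum>i\<in>UNIV. \<Sum>m\<in>UNIV. Gam i i m z * A h m j z))"
  proof -
    have "(\<Sum>i\<in>UNIV. \<Sum>m\<in>UNIV. Gam i i m z * (\<Sum>j\<in>UNIV. ?v j z * A h m j z))
        = (\<Sum>i\<in>UNIV. \<Sum>j\<in>UNIV. \<Sum>m\<in>UNIV. ?v j z * (Gam i i m z * A h m j z))"
      unfolding sum_distrib_left by (rule sum.cong[OF refl], subst sum.swap) (simp add: mult_ac)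
    also have "\<dots> = (\<Sum>j\<in>UNIV. ?v j z * (\<Sum>i\<in>UNIV. \<Sum>m\<in>UNIV. Gam i i m z * A h m j z))"
      unfolding sum_distrib_left by (rule sum.swap)
    finally show ?thesis .
  qed
  ultimately have "lap (inn h h) z = 2 * (\<Sum>i\<in>UNIV. \<Sum>j\<in>UNIV. A h i j z * A h j i z)
     + 2 * (\<Sum>j\<in>UNIV. ?v j z * ((\<Sum>i\<in>UNIV. D i (A h i j) z)
      + (\<Sum>i\<in>UNIV. \<Sum>m\<in>UNIV. Gam i i m z * A h m j z) - (\<Sum>i\<in>UNIV. \<Sum>m\<in>UNIV. Gam m i j z * A h i m z)))"
    by (simp add: distrib_left right_diff_distrib sum.distrib sum_subtractf)
  then show ?thesis
    unfolding commute_covariant[OF h]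
    by (simp add: distrib_left sum.distrib sum_distrib_left mult_ac)
qed

text \<open>The squared norm pairs the differential of \<open>h\<close> with itself through the
  inverse metric. The derivative of the inverse is minus the derivative of \<open>G\<close> with
  both indices raised, hence the minus sign of the last term.\<close>

lemma dir_deriv_norm_grad:
  assumes h: "smooth_on S h"
  shows "dir_deriv v (inn h h) z = 2 * (\<Sum>j\<in>UNIV. grad h j z * D j (dir_deriv v h) z)
     - (\<Sum>i\<in>UNIV. \<Sum>j\<in>UNIV. dir_deriv v (GG i j) z * grad h i z * grad h j z)"
proof -
  have c: "dir_deriv v (D j h) z = D j (dir_deriv v h) z" for j
    by (rule dir_deriv_commute[OF open_S h z])
  have g: "(\<Sum>i\<in>UNIV. PP i a z * D i h z) = grad h a z" for a
    by (simp add: grad_def PP_sym[of _ a])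
  have 1: "dir_deriv v (inn h h) z = (\<Sum>i\<in>UNIV. grad h i z * D i (dir_deriv v h) z)
     + (\<Sum>i\<in>UNIV. dir_deriv v (grad h i) z * D i h z)"
    unfolding inn_def[abs_def] by (simp add: D_rules smooth h c sum.distrib)
  have 2: "dir_deriv v (grad h i) z = (\<Sum>j\<in>UNIV. PP i j z * D j (dir_deriv v h) z)
     - (\<Sum>a\<in>UNIV. PP i a z * (\<Sum>b\<in>UNIV. dir_deriv v (GG a b) z * grad h b z))" for i
  proof -
    have "(\<Sum>j\<in>UNIV. (\<Sum>a\<in>UNIV. \<Sum>b\<in>UNIV. PP i a z * dir_deriv v (GG a b) z * PP b j z) * D j h z)
        = (\<Sum>a\<in>UNIV. \<Sum>j\<in>UNIV. \<Sum>b\<in>UNIV. PP i a z * (dir_deriv v (GG a b) z * (PP b j z * D j h z)))"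
      unfolding sum_distrib_right by (subst sum.swap) (simp add: mult_ac)
    also have "\<dots> = (\<Sum>a\<in>UNIV. \<Sum>b\<in>UNIV. \<Sum>j\<in>UNIV. PP i a z * (dir_deriv v (GG a b) z * (PP b j z * D j h z)))"
      by (intro sum.cong refl sum.swap)
    finally show ?thesis
      unfolding grad_def[of h i, abs_def]
      by (simp add: D_rules smooth h c sum.distrib dir_deriv_PP sum_negf sum_subtractf grad_def[of h] sum_distrib_left)
  qed
  have 3: "(\<Sum>i\<in>UNIV. (\<Sum>a\<in>UNIV. PP i a z * X a) * D i h z) = (\<Sum>a\<in>UNIV. grad h a z * X a)" for X
    unfolding g[symmetric] sum_distrib_right by (subst sum.swap) (simp add: mult_ac)
  show ?thesis
    unfolding 1 2 left_diff_distrib sum_subtractf 3 by (simp add: sum_distrib_left mult_ac)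
qed

text \<open>The direction \<open>v\<close> plays the role of time.\<close>

theorem parabolic_bochner:
  assumes h: "smooth_on S h" and f: "smooth_on S f"
  shows "dir_deriv v (inn h h) z - (lap (inn h h) z - inn f (inn h h) z)
    = 2 * (\<Sum>j\<in>UNIV. grad h j z * D j (\<lambda>y. dir_deriv v h y - (lap h y - inn f h y)) z)
    - 2 * (\<Sum>i\<in>UNIV. \<Sum>m\<in>UNIV. A h i m z * A h m i z)
    - (\<Sum>i\<in>UNIV. \<Sum>j\<in>UNIV. (dir_deriv v (GG i j) z + 2 * (ric i j z + hess f i j z)) * grad h i z * grad h j z)"
proof -
  let ?v = "grad h"
  have 1: "inn f (inn h h) z = 2 * (\<Sum>i\<in>UNIV. \<Sum>m\<in>UNIV. grad f i z * ?v m z * hess h i m z)"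
    by (simp add: inn_def[of f "inn h h"] D_inn h sum_distrib_left mult_ac distrib_left sum.distrib)
  \<comment> \<open>The Hessian of \<open>f\<close> appears here, when the gradient is taken past
    the drift term; it completes the Ricci tensor to the weighted one. The other sum cancels against
    the drift of \<open>inn h h\<close>.\<close>
  have 2: "(\<Sum>j\<in>UNIV. ?v j z * D j (inn f h) z) = (\<Sum>i\<in>UNIV. \<Sum>m\<in>UNIV. grad f i z * ?v m z * hess h i m z)
     + (\<Sum>i\<in>UNIV. \<Sum>j\<in>UNIV. hess f i j z * ?v i z * ?v j z)"
  proof -
    have "(\<Sum>j\<in>UNIV. \<Sum>m\<in>UNIV. ?v j z * (grad f m z * hess h j m z))
       = (\<Sum>i\<in>UNIV. \<Sum>m\<in>UNIV. grad f i z * ?v m z * hess h i m z)"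
      by (subst sum.swap) (simp add: hess_sym[OF h] mult_ac)
    then show ?thesis
      by (simp add: D_inn h f distrib_left sum.distrib sum_distrib_left mult_ac)
  qed
  have 3: "(\<Sum>j\<in>UNIV. \<Sum>m\<in>UNIV. ric m j z * (?v m z * ?v j z)) = (\<Sum>i\<in>UNIV. \<Sum>j\<in>UNIV. ric i j z * (?v i z * ?v j z))"
    by (rule sum.swap)
  show ?thesis
    unfolding dir_deriv_norm_grad[OF h] lap_norm_grad[OF h] 1
    by (simp add: D_rules smooth h f distrib_left right_diff_distrib distrib_right sum.distrib sum_subtractf
       2 3 sum_distrib_left[symmetric] mult.assoc)
qed

end

section \<open>The differential inequality at a spatial maximum\<close>

lemma dir_deriv_combination:
  assumes "smooth_on S h" "z \<in> S"
  shows "dir_deriv (\<Sum>i\<in>UNIV. w i *\<^sub>R e i) h z = (\<Sum>i\<in>UNIV. w i * D i h z)"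
proof -
  have "linear (\<lambda>v. dir_deriv v h z)"
    unfolding dir_deriv_def using linear_frechet_derivative diff_at[OF assms] by blast
  from linear_sum[OF this, of "\<lambda>i. w i *\<^sub>R e i" UNIV] show ?thesis
    using dir_deriv_linear(2)[OF diff_at[OF assms]] by simp
qed

lemma inn_contract:
  assumes "z \<in> S"
  shows "(\<Sum>i\<in>UNIV. \<Sum>j\<in>UNIV. GG i j z * grad h i z * grad k j z) = inn h k z"
proof -
  have "(\<Sum>j\<in>UNIV. GG i j z * grad k j z) = D i k z" for i
    unfolding grad_def using contract_GG[OF assms] .
  then show ?thesis
    by (simp add: inn_def mult.assoc mult.left_commute[of "GG _ _ _"] sum_distrib_left[symmetric])
qed

text \<open>At a critical point the Christoffel terms of the Hessian vanish, so its trace is that of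
  the matrix of second derivatives, which is nonpositive as a quadratic form. Competitors differ
  from \<open>z\<close> only by combinations of the \<open>e i\<close>.\<close>

lemma spatial_maximum:
  assumes z: "z \<in> S" and h: "smooth_on S h"
    and max: "\<And>w. z + (\<Sum>i\<in>UNIV. w i *\<^sub>R e i) \<in> S \<Longrightarrow> h (z + (\<Sum>i\<in>UNIV. w i *\<^sub>R e i)) \<le> h z"
    and pos: "\<And>v. 0 \<le> v \<bullet> (matrix_inv (G z) *v v)"
  shows "D i h z = 0" "lap h z \<le> 0"
proof -
  have *: "dir_deriv (\<Sum>i\<in>UNIV. w i *\<^sub>R e i) h z = 0"
    "dir_deriv (\<Sum>i\<in>UNIV. w i *\<^sub>R e i) (dir_deriv (\<Sum>i\<in>UNIV. w i *\<^sub>R e i) h) z \<le> 0" for w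
  proof -
    have "h (z + s *\<^sub>R (\<Sum>i\<in>UNIV. w i *\<^sub>R e i)) \<le> h z" if "z + s *\<^sub>R (\<Sum>i\<in>UNIV. w i *\<^sub>R e i) \<in> S" for s
      using max[of "\<lambda>i. s * w i"] that by (simp add: scaleR_sum_right)
    from second_derivative_test[OF open_S z _ _ this]
    show "dir_deriv (\<Sum>i\<in>UNIV. w i *\<^sub>R e i) h z = 0"
      "dir_deriv (\<Sum>i\<in>UNIV. w i *\<^sub>R e i) (dir_deriv (\<Sum>i\<in>UNIV. w i *\<^sub>R e i) h) z \<le> 0"
      using diff_at[OF h] diff_at[OF smooth(6)[OF h] z] by blast+
  qed
  show D0: "D i h z = 0" for i
    using *(1)[of "\<lambda>j. if j = i then 1 else 0"]
    by (simp add: dir_deriv_combination[OF h z] if_distrib[of "\<lambda>x. x * _"] cong: if_cong)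
  have "(\<Sum>i\<in>UNIV. \<Sum>j\<in>UNIV. w i * w j * D i (D j h) z) \<le> 0" for w
  proof -
    have "dir_deriv (\<Sum>i\<in>UNIV. w i *\<^sub>R e i) (dir_deriv (\<Sum>i\<in>UNIV. w i *\<^sub>R e i) h) z
       = dir_deriv (\<Sum>i\<in>UNIV. w i *\<^sub>R e i) (\<lambda>y. \<Sum>j\<in>UNIV. w j * D j h y) z"
      by (rule dir_deriv_cong[OF open_S z dir_deriv_combination[OF h]])
    also have "\<dots> = (\<Sum>j\<in>UNIV. w j * (\<Sum>i\<in>UNIV. w i * D i (D j h) z))"
      by (simp add: D_rules[OF z] smooth h dir_deriv_combination[OF _ z])
    also have "\<dots> = (\<Sum>i\<in>UNIV. \<Sum>j\<in>UNIV. w i * w j * D i (D j h) z)"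
      unfolding sum_distrib_left by (subst sum.swap) (simp add: mult_ac)
    finally show ?thesis using *(2)[of w] by simp
  qed
  moreover have "transpose (matrix_inv (G z)) = matrix_inv (G z)"
    using PP_sym[OF z] by (simp add: PP_def transpose_def vec_eq_iff)
  ultimately have "(\<Sum>i\<in>UNIV. \<Sum>j\<in>UNIV. matrix_inv (G z) $ i $ j * D i (D j h) z) \<le> 0"
    using pos by (intro psd_trace_nonpos) auto
  then show "lap h z \<le> 0"
    by (simp add: lap_def hess_def D0 PP_def)
qed

text \<open>The vanishing gradient of \<open>p q + l\<close> is paired once with \<open>f\<close>,
  where it removes the drift, and once with \<open>l\<close>, where it gives
  \<open>p <grad l, grad q> = - q\<close>. The function \<open>N\<close> stands for the reaction
  term \<open>F u / u\<close>, whose gradient at \<open>z\<close> is a multiple \<open>c\<close> of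
  that of \<open>l\<close>, and \<open>\<tau>\<close> for the time direction.\<close>

lemma maximum_inequality:
  assumes z: "z \<in> S" and l: "smooth_on S l" and f: "smooth_on S f"
    and pos: "\<And>v. 0 \<le> v \<bullet> (matrix_inv (G z) *v v)"
    and eq: "\<And>y. y \<in> S \<Longrightarrow> dir_deriv \<tau> l y - (lap l y - inn f l y) = inn l l y + N y"
    and N: "N differentiable at z" "\<And>j. D j N z = c * D j l z"
    and flow: "\<And>w. - 2 * k * (\<Sum>i\<in>UNIV. \<Sum>j\<in>UNIV. GG i j z * w i * w j)
       \<le> (\<Sum>i\<in>UNIV. \<Sum>j\<in>UNIV. (dir_deriv \<tau> (GG i j) z + 2 * (ric i j z + hess f i j z)) * w i * w j)"
    and p: "p \<ge> 0"
    and max: "\<And>w. z + (\<Sum>i\<in>UNIV. w i *\<^sub>R e i) \<in> S \<Longrightarrow>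
        p * inn l l (z + (\<Sum>i\<in>UNIV. w i *\<^sub>R e i)) + l (z + (\<Sum>i\<in>UNIV. w i *\<^sub>R e i)) \<le> p * inn l l z + l z"
  shows "p * dir_deriv \<tau> (inn l l) z + dir_deriv \<tau> l z
     \<le> (2 * k * p - 1) * inn l l z + N z + 2 * p * c * inn l l z"
proof -
  let ?q = "inn l l"
  define R where "R = (\<lambda>y. p * ?q y + l y)"
  have sR: "smooth_on S R" unfolding R_def by (intro smooth l)
  have DR: "dir_deriv v R y = p * dir_deriv v ?q y + dir_deriv v l y" if "y \<in> S" for v y
    unfolding R_def by (simp add: D_rules[OF that] smooth l)
  have DDR: "D i (D j R) z = p * D i (D j ?q) z + D i (D j l) z" for i j
  proof -
    have "D i (D j R) z = D i (\<lambda>y. p * D j ?q y + D j l y) z"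
      by (rule dir_deriv_cong[OF open_S z DR])
    then show ?thesis by (simp add: D_rules[OF z] smooth l)
  qed
  have R0: "D i R z = 0" "lap R z \<le> 0" for i
    by (rule spatial_maximum[OF z sR _ pos]; use max in \<open>simp add: R_def\<close>)+
  have "hess R i j z = p * hess ?q i j z + hess l i j z" for i j
    by (simp add: hess_def DDR DR[OF z] distrib_left sum.distrib sum_distrib_left mult_ac right_diff_distrib)
  then have lapR: "lap R z = p * lap ?q z + lap l z"
    by (simp add: lap_def distrib_left sum.distrib sum_distrib_left mult_ac)
  have innR: "p * inn h ?q z + inn h l z = 0" for h
  proof -
    have "inn h R z = p * inn h ?q z + inn h l z"
      by (simp add: inn_def[of h] DR[OF z] distrib_left sum.distrib sum_distrib_left mult_ac)
    then show ?thesis by (simp add: inn_def[of h R] R0)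
  qed
  have b: "dir_deriv \<tau> ?q z - (lap ?q z - inn f ?q z) \<le> 2 * (inn l ?q z + c * ?q z) + 2 * k * ?q z"
  proof -
    have "D j (\<lambda>y. dir_deriv \<tau> l y - (lap l y - inn f l y)) z = D j (\<lambda>y. ?q y + N y) z" for j
      by (rule dir_deriv_cong[OF open_S z eq])
    then have "D j (\<lambda>y. dir_deriv \<tau> l y - (lap l y - inn f l y)) z = D j ?q z + c * D j l z" for j
      using dir_deriv_add[OF diff_at[of ?q, OF _ z] N(1)] by (simp add: N smooth l)
    then have "(\<Sum>j\<in>UNIV. grad l j z * D j (\<lambda>y. dir_deriv \<tau> l y - (lap l y - inn f l y)) z) = inn l ?q z + c * ?q z"
      by (simp add: inn_def[of l] distrib_left sum.distrib sum_distrib_left mult_ac)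
    moreover have "(\<Sum>i\<in>UNIV. \<Sum>m\<in>UNIV. A l i m z * A l m i z) \<ge> 0"
    proof (rule psd_trace_square_nonneg[OF _ pos])
      show "transpose (matrix_inv (G z)) = matrix_inv (G z)"
        using PP_sym[OF z] by (simp add: PP_def transpose_def vec_eq_iff)
      show "hess l i j z = hess l j i z" for i j
        by (rule hess_sym[OF z l])
      show "A l i j z = (\<Sum>m\<in>UNIV. matrix_inv (G z) $ i $ m * hess l j m z)" for i j
        using A_hess[OF z l] by (simp add: PP_def)
    qed
    moreover have "- 2 * k * ?q z \<le> (\<Sum>i\<in>UNIV. \<Sum>j\<in>UNIV.
        (dir_deriv \<tau> (GG i j) z + 2 * (ric i j z + hess f i j z)) * grad l i z * grad l j z)"
      using flow[of "\<lambda>i. grad l i z"] inn_contract[OF z] by simp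
    moreover have "X = a \<Longrightarrow> 0 \<le> Y \<Longrightarrow> - 2 * k * b \<le> Z \<Longrightarrow> 2 * X - 2 * Y - Z \<le> 2 * a + 2 * k * b" for X Y Z a b :: real
      by simp
    ultimately show ?thesis
      unfolding parabolic_bochner[OF z l f] by blast
  qed
  \<comment> \<open>Bochner's inequality \<open>b\<close> is multiplied by \<open>p\<close> and
    added to the equation for \<open>l\<close>; the two gradient identities and the sign of
    \<open>lap R\<close> then eliminate all spatial derivatives of \<open>q\<close>.\<close>
  have arith: "p * dq + dl \<le> (2 * k * p - 1) * q + n + 2 * p * c * q"
    if "dq - (lq - fq) \<le> 2 * (lnq + c * q) + 2 * k * q" "dl - (ll - fl) = q + n"
      "p * lnq + q = 0" "p * fq + fl = 0" "p * lq + ll \<le> 0" for dq lq fq lnq q dl ll fl n :: real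
  proof -
    have "p * dq \<le> p * (lq - fq + 2 * (lnq + c * q) + 2 * k * q)"
      using that(1) p by (intro mult_left_mono) auto
    then show ?thesis using that by (simp add: algebra_simps)
  qed
  show ?thesis
    by (rule arith[OF b eq[OF z] innR innR]) (use R0(2) lapR in simp)
qed

end

section \<open>Slices of functions on spacetime and positive definite matrices\<close>

lemma dir_deriv_slice:
  assumes "V differentiable at (t, y)"
  shows "(\<lambda>y. V (t, y)) differentiable at y"
    and "dir_deriv w (\<lambda>y. V (t, y)) y = dir_deriv (0, w) V (t, y)"
proof -
  have "((\<lambda>y. (t, y)) has_derivative (\<lambda>w. (0, w))) (at y)"
    by (auto intro!: derivative_eq_intros)
  from diff_chain_at[OF this has_derivative_dir_deriv[OF assms]]
  have *: "((\<lambda>y. V (t, y)) has_derivative (\<lambda>w. dir_deriv (0, w) V (t, y))) (at y)"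
    by (simp add: o_def)
  show "(\<lambda>y. V (t, y)) differentiable at y" "dir_deriv w (\<lambda>y. V (t, y)) y = dir_deriv (0, w) V (t, y)"
    using * dir_deriv_eqI[OF *] by (auto simp: differentiable_def)
qed

lemma time_slice_derivative:
  assumes "V differentiable at (t, y)"
  shows "((\<lambda>s. V (s, y)) has_vector_derivative dir_deriv (1, 0) V (t, y)) (at t)"
proof -
  have "((\<lambda>s. (s, y)) has_derivative (\<lambda>r. (r, 0))) (at t)"
    by (auto intro!: derivative_eq_intros)
  from diff_chain_at[OF this has_derivative_dir_deriv[OF assms]]
  have "((\<lambda>s. V (s, y)) has_derivative (\<lambda>r. dir_deriv (r, 0) V (t, y))) (at t)"
    by (simp add: o_def)
  moreover have "(\<lambda>r. dir_deriv (r, 0) V (t, y)) = (\<lambda>r. r *\<^sub>R dir_deriv (1, 0) V (t, y))"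
    using dir_deriv_linear(2)[OF assms, of _ "(1, 0)"] by (intro ext) (metis mult.right_neutral real_scaleR_def scaleR_Pair scaleR_zero_right)
  ultimately show ?thesis
    unfolding has_vector_derivative_def by (simp only:)
qed

lemma posdef_det_nonzero:
  fixes P :: "real^'n^'n"
  assumes "\<And>v. v \<noteq> 0 \<Longrightarrow> 0 < v \<bullet> (P *v v)"
  shows "det P \<noteq> 0"
proof -
  have "v = 0" if "P *v v = 0" for v
    using assms[of v] that by (cases "v = 0") auto
  then show ?thesis
    using matrix_left_invertible_ker[of P] invertible_left_inverse[of P] invertible_det_nz[of P] by blast
qed

text \<open>Substitute \<open>v = P w\<close>: the form of the inverse at \<open>v\<close> is the
  form of \<open>P\<close> at \<open>w\<close>.\<close>

lemma matrix_inv_psd: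
  fixes P :: "real^'n^'n"
  assumes "\<And>v. v \<noteq> 0 \<Longrightarrow> 0 < v \<bullet> (P *v v)"
  shows "0 \<le> v \<bullet> (matrix_inv P *v v)"
proof -
  let ?w = "matrix_inv P *v v"
  have "P *v ?w = v"
    using invertible_matrix_inv(1)[OF posdef_det_nonzero[OF assms]]
    by (simp add: matrix_vector_mul_assoc)
  then show ?thesis
    using assms[of ?w] by (cases "?w = 0") (auto simp: inner_commute)
qed


section \<open>Charts\<close>

lemma partial_deriv_dir_deriv:
  "partial_deriv c i v x = dir_deriv (axis i 1) (v \<circ> chart_inv c) (chart_map c x)"
  by (simp add: partial_deriv_def dir_deriv_def)

lemma chart_map_img: "x \<in> chart_dom c \<Longrightarrow> chart_map c x \<in> chart_img c"
  by (simp add: chart_img_def)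

context
  fixes M :: "'a::t2_space set" and A :: "('a, 'n::finite) chart set"
  assumes atlas: "smooth_atlas M A"
begin

lemma chart_homeomorphism: "c \<in> A \<Longrightarrow> homeomorphism (chart_dom c) (chart_img c) (chart_map c) (chart_inv c)"
  and chart_img_open: "c \<in> A \<Longrightarrow> open (chart_img c)"
  and chart_dom_open: "c \<in> A \<Longrightarrow> openin (top_of_set M) (chart_dom c)"
  and chart_cover: "x \<in> M \<Longrightarrow> \<exists>c\<in>A. x \<in> chart_dom c"
  using atlas by (auto simp: smooth_atlas_def)

lemma chart_dom_subset: "c \<in> A \<Longrightarrow> chart_dom c \<subseteq> M"
  using chart_dom_open openin_imp_subset by blast

lemma chart_inv_map: "c \<in> A \<Longrightarrow> x \<in> chart_dom c \<Longrightarrow> chart_inv c (chart_map c x) = x"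
  using homeomorphism_apply1[OF chart_homeomorphism] .

lemma chart_map_inv: "c \<in> A \<Longrightarrow> y \<in> chart_img c \<Longrightarrow> chart_map c (chart_inv c y) = y"
  using homeomorphism_apply2[OF chart_homeomorphism] .

lemma chart_inv_dom: "c \<in> A \<Longrightarrow> y \<in> chart_img c \<Longrightarrow> chart_inv c y \<in> chart_dom c"
  using homeomorphism_image2[OF chart_homeomorphism] by blast

end

section \<open>Transfer of geometric quantities to coordinate spacetime\<close>

lemma quadratic_form_sum:
  fixes P :: "real^'n^'n"
  shows "v \<bullet> (P *v w) = (\<Sum>i\<in>UNIV. \<Sum>j\<in>UNIV. P $ i $ j * v $ i * w $ j)"
  by (simp add: inner_vec_def matrix_vector_mult_def sum_distrib_left mult_ac)

text \<open>The codomain is left general so that one pullback serves both scalar functions and the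
  matrices of the metric.\<close>

definition chart_repr :: "('a, 'n::finite) chart \<Rightarrow> (real \<Rightarrow> 'a \<Rightarrow> 'b) \<Rightarrow> real \<times> (real^'n) \<Rightarrow> 'b" where
  "chart_repr c v z = v (fst z) (chart_inv c (snd z))"

abbreviation space_dir :: "'n::finite \<Rightarrow> real \<times> (real^'n)" where
  "space_dir i \<equiv> (0, axis i 1)"

abbreviation time_dir :: "real \<times> (real^'n)" where
  "time_dir \<equiv> (1, 0)"

locale metric_flow =
  fixes M :: "'a::t2_space set"
    and A :: "('a, 'n::finite) chart set"
    and g :: "('a, 'n) metric_family"
    and T :: real
  assumes manifold: "closed_manifold M A"
    and T_pos: "T > 0"
    and smooth_metric: "smooth_metric_family A T g"
begin

lemma atlas: "smooth_atlas M A"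
  using manifold by (simp add: closed_manifold_def)

text \<open>The end times are excluded to make this set open, so that derivatives are two-sided and
  mixed ones commute.\<close>

abbreviation spacetime :: "('a, 'n) chart \<Rightarrow> (real \<times> (real^'n)) set" where
  "spacetime c \<equiv> {0<..<T} \<times> chart_img c"

lemma metric_posdef: "c \<in> A \<Longrightarrow> t \<in> {0..T} \<Longrightarrow> x \<in> chart_dom c \<Longrightarrow> v \<noteq> 0 \<Longrightarrow> 0 < v \<bullet> (g c t x *v v)"
  and metric_sym: "c \<in> A \<Longrightarrow> t \<in> {0..T} \<Longrightarrow> x \<in> chart_dom c \<Longrightarrow> transpose (g c t x) = g c t x"
  and metric_transform: "c \<in> A \<Longrightarrow> d \<in> A \<Longrightarrow> t \<in> {0..T} \<Longrightarrow> x \<in> chart_dom c \<inter> chart_dom d \<Longrightarrow>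
    g c t x = transpose (jacobian c d x) ** g d t x ** jacobian c d x"
  using smooth_metric unfolding smooth_metric_family_def by blast+

lemma metric_det: "c \<in> A \<Longrightarrow> t \<in> {0..T} \<Longrightarrow> x \<in> chart_dom c \<Longrightarrow> det (g c t x) \<noteq> 0"
  using metric_posdef by (intro posdef_det_nonzero) auto

lemma open_spacetime: "c \<in> A \<Longrightarrow> open (spacetime c)"
  using chart_img_open[OF atlas] by (intro open_Times) auto

lemma smooth_function_repr:
  assumes "c \<in> A" "smooth_function_family A T v"
  shows "smooth_on ({0..T} \<times> chart_img c) (chart_repr c v)" "smooth_on (spacetime c) (chart_repr c v)"
proof -
  show *: "smooth_on ({0..T} \<times> chart_img c) (chart_repr c v)"
    using assms by (simp add: smooth_function_family_def chart_repr_def[abs_def] case_prod_unfold)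
  show "smooth_on (spacetime c) (chart_repr c v)"
    by (rule smooth_on_open_subset[OF * open_spacetime[OF assms(1)]]) auto
qed

lemma smooth_metric_repr:
  assumes "c \<in> A"
  shows "smooth_on ({0..T} \<times> chart_img c) (chart_repr c (g c))" "smooth_on (spacetime c) (chart_repr c (g c))"
proof -
  show *: "smooth_on ({0..T} \<times> chart_img c) (chart_repr c (g c))"
    using assms smooth_metric
    by (simp add: smooth_metric_family_def chart_repr_def[abs_def] case_prod_unfold)
  show "smooth_on (spacetime c) (chart_repr c (g c))"
    by (rule smooth_on_open_subset[OF * open_spacetime[OF assms(1)]]) auto
qed

lemma bounded_linear_entry: "bounded_linear (\<lambda>P :: real^'n^'n. P $ i $ j)"
  using bounded_linear_compose[OF bounded_linear_vec_nth bounded_linear_vec_nth] .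

lemma coordinate_metric_chart:
  assumes c: "c \<in> A"
  shows "coordinate_metric (spacetime c) (chart_repr c (g c))"
proof
  show "open (spacetime c)" by (rule open_spacetime[OF c])
  show "smooth_on (spacetime c) (\<lambda>z. chart_repr c (g c) z $ i $ j)" for i j
    by (rule smooth_on_bounded_linear[OF open_spacetime[OF c] bounded_linear_entry smooth_metric_repr(2)[OF c]])
  show "transpose (chart_repr c (g c) z) = chart_repr c (g c) z" "det (chart_repr c (g c) z) \<noteq> 0"
    if "z \<in> spacetime c" for z
    using that metric_sym[OF c] metric_det[OF c] chart_inv_dom[OF atlas c]
    by (auto simp: chart_repr_def)
qed

context
  fixes c :: "('a, 'n) chart" and t :: real
  assumes c: "c \<in> A" and t: "0 < t" "t < T"
begin

interpretation C: coordinate_metric "spacetime c" space_dir "chart_repr c (g c)"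
  by (rule coordinate_metric_chart[OF c])

lemma point_in_spacetime: "x \<in> chart_dom c \<Longrightarrow> (t, chart_map c x) \<in> spacetime c"
  using t by (auto simp: chart_img_def)

lemma partial_deriv_repr:
  assumes V: "smooth_on (spacetime c) V" and v: "\<And>x. x \<in> chart_dom c \<Longrightarrow> v x = V (t, chart_map c x)"
    and x: "x \<in> chart_dom c"
  shows "partial_deriv c i v x = C.D i V (t, chart_map c x)"
proof -
  have "partial_deriv c i v x = dir_deriv (axis i 1) (\<lambda>y. V (t, y)) (chart_map c x)"
    unfolding partial_deriv_dir_deriv
    by (rule dir_deriv_cong[OF chart_img_open[OF atlas c] chart_map_img[OF x]])
      (simp add: v chart_inv_dom[OF atlas c] chart_map_inv[OF atlas c])
  also have "\<dots> = C.D i V (t, chart_map c x)"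
    by (rule dir_deriv_slice(2)[OF C.diff_at[OF V point_in_spacetime[OF x]]])
  finally show ?thesis .
qed

lemma chart_repr_point: "x \<in> chart_dom c \<Longrightarrow> chart_repr c v (t, chart_map c x) = v t x"
  by (simp add: chart_repr_def chart_inv_map[OF atlas c])

lemma entry_repr: "x \<in> chart_dom c \<Longrightarrow> g c t x $ i $ j = C.GG i j (t, chart_map c x)"
  and inverse_entry_repr: "x \<in> chart_dom c \<Longrightarrow> matrix_inv (g c t x) $ i $ j = C.PP i j (t, chart_map c x)"
  by (simp_all add: C.GG_def C.PP_def chart_repr_point)

lemma christoffel_repr:
  assumes x: "x \<in> chart_dom c"
  shows "christoffel c (g c t) k i j x = C.Gam k i j (t, chart_map c x)"
  unfolding christoffel_def C.Gam_def
  by (simp add: inverse_entry_repr x partial_deriv_repr[OF C.smooth_GG entry_repr])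

lemma ricci_repr:
  assumes x: "x \<in> chart_dom c"
  shows "ricci c (g c t) x $ i $ j = C.ric i j (t, chart_map c x)"
  unfolding ricci_def C.ric_def
  by (simp add: christoffel_repr x partial_deriv_repr[OF C.smooth_Gam christoffel_repr])

context
  fixes v :: "'a \<Rightarrow> real" and V :: "real \<times> (real^'n) \<Rightarrow> real"
  assumes V: "smooth_on (spacetime c) V" and v: "\<And>x. x \<in> chart_dom c \<Longrightarrow> v x = V (t, chart_map c x)"
begin

lemma gradient_repr:
  assumes x: "x \<in> chart_dom c"
  shows "gradient c (g c t) v x $ i = C.grad V i (t, chart_map c x)"
  unfolding gradient_def C.grad_def
  by (simp add: matrix_vector_mult_def inverse_entry_repr x partial_deriv_repr[OF V v])

lemma hessian_repr:
  assumes x: "x \<in> chart_dom c"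
  shows "hessian c (g c t) v x $ i $ j = C.hess V i j (t, chart_map c x)"
  unfolding hessian_def C.hess_def
  by (simp add: christoffel_repr x partial_deriv_repr[OF V v]
      partial_deriv_repr[OF C.smooth(6)[OF V] partial_deriv_repr[OF V v]])

lemma laplacian_repr:
  assumes x: "x \<in> chart_dom c"
  shows "laplacian c (g c t) v x = C.lap V (t, chart_map c x)"
  unfolding laplacian_def C.lap_def by (simp add: inverse_entry_repr hessian_repr x)

end

lemma inner_gradient_repr:
  assumes V: "smooth_on (spacetime c) V" and v: "\<And>x. x \<in> chart_dom c \<Longrightarrow> v x = V (t, chart_map c x)"
    and W: "smooth_on (spacetime c) W" and w: "\<And>x. x \<in> chart_dom c \<Longrightarrow> w x = W (t, chart_map c x)"
    and x: "x \<in> chart_dom c"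
  shows "metric_inner (g c t x) (gradient c (g c t) v x) (gradient c (g c t) w x) = C.inn V W (t, chart_map c x)"
  unfolding metric_inner_def quadratic_form_sum
  by (simp add: entry_repr[OF x] gradient_repr[OF V v x] gradient_repr[OF W w x]
      C.inn_contract[OF point_in_spacetime[OF x]])

lemma time_derivative_repr:
  assumes "chart_repr c v differentiable at (t, chart_map c x)" "x \<in> chart_dom c"
  shows "((\<lambda>s. v s x) has_vector_derivative dir_deriv time_dir (chart_repr c v) (t, chart_map c x)) (at t)"
    and "vector_derivative (\<lambda>s. v s x) (at t within {0..T}) = dir_deriv time_dir (chart_repr c v) (t, chart_map c x)"
proof -
  show *: "((\<lambda>s. v s x) has_vector_derivative dir_deriv time_dir (chart_repr c v) (t, chart_map c x)) (at t)"
    using time_slice_derivative[OF assms(1)] assms(2)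
    by (simp add: chart_repr_def chart_inv_map[OF atlas c])
  show "vector_derivative (\<lambda>s. v s x) (at t within {0..T}) = dir_deriv time_dir (chart_repr c v) (t, chart_map c x)"
    using vector_derivative_at[OF *] t by (simp add: at_within_Icc_at)
qed

end

end

section \<open>The equation for the logarithm of the solution\<close>

locale heat_flow = metric_flow M A g T
  for M :: "'a::t2_space set" and A :: "('a, 'n::finite) chart set" and g and T +
  fixes f u :: "real \<Rightarrow> 'a \<Rightarrow> real"
    and F :: "real \<Rightarrow> real"
    and k D :: real
  assumes smooth_f: "smooth_function_family A T f"
    and k: "k \<ge> 0"
    and flow: "super_perelman_ricci_flow A T k g f"
    and F: "F C1_differentiable_on {0<..}"
    and smooth_u: "smooth_function_family A T u"
    and u: "\<And>x t. x \<in> M \<Longrightarrow> t \<in> {0..T} \<Longrightarrow> 0 < u t x \<and> u t x \<le> D"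
    and heat: "solves_nonlinear_heat A T g f F u"
    and F_nonneg: "\<And>x t. x \<in> M \<Longrightarrow> t \<in> {0..T} \<Longrightarrow> F (u t x) \<ge> 0"
    and F_growth: "\<And>x t. x \<in> M \<Longrightarrow> t \<in> {0..T} \<Longrightarrow> F (u t x) - 2 * u t x * deriv F (u t x) \<ge> 0"
begin

text \<open>The chart is kept as an argument because the calculus is local; chart independence
  follows later from the transformation laws.\<close>

definition q :: "('a, 'n) chart \<Rightarrow> real \<Rightarrow> 'a \<Rightarrow> real" where
  "q c t x = (metric_norm (g c t x) (gradient c (g c t) (\<lambda>z. ln (u t z)) x))\<^sup>2"

context
  fixes c :: "('a, 'n) chart"
  assumes c: "c \<in> A"
begin

interpretation C: coordinate_metric "spacetime c" space_dir "chart_repr c (g c)"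
  by (rule coordinate_metric_chart[OF c])

definition L :: "real \<times> (real^'n) \<Rightarrow> real" where "L z = ln (chart_repr c u z)"

lemma u_repr_pos: "z \<in> spacetime c \<Longrightarrow> 0 < chart_repr c u z"
  using u[of "chart_inv c (snd z)" "fst z"] chart_inv_dom[OF atlas c] chart_dom_subset[OF atlas c]
  by (force simp: chart_repr_def)

lemma smooth_L: "smooth_on (spacetime c) L"
  unfolding L_def[abs_def]
  by (rule smooth_on_ln[OF open_spacetime[OF c] smooth_function_repr(2)[OF c smooth_u] u_repr_pos])

lemma L_point: "x \<in> chart_dom c \<Longrightarrow> ln (u t x) = L (t, chart_map c x)"
  by (simp add: L_def chart_repr_def chart_inv_map[OF atlas c])

lemma metric_inner_nonneg:
  assumes "x \<in> chart_dom c" "t \<in> {0..T}" shows "0 \<le> metric_inner (g c t x) v v"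
  using metric_posdef[OF c assms(2,1), of v] by (cases "v = 0") (auto simp: metric_inner_def)

lemma q_repr:
  assumes t: "0 < t" "t < T" and x: "x \<in> chart_dom c"
  shows "q c t x = C.inn L L (t, chart_map c x)"
proof -
  have "0 \<le> metric_inner (g c t x) (gradient c (g c t) (\<lambda>z. ln (u t z)) x)
      (gradient c (g c t) (\<lambda>z. ln (u t z)) x)"
    using t by (intro metric_inner_nonneg[OF x]) simp
  then show ?thesis
    using inner_gradient_repr[OF c t smooth_L L_point smooth_L L_point x]
    by (simp add: q_def metric_norm_def)
qed

text \<open>Divide the equation by \<open>u\<close>. The Hessian of the logarithm is that of
  \<open>u\<close> divided by \<open>u\<close>, minus the square of the differential of
  \<open>L\<close>; the trace of this square is the term \<open>C.inn L L\<close>.\<close>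

lemma log_heat_equation:
  assumes z: "z \<in> spacetime c"
  shows "dir_deriv time_dir L z - (C.lap L z - C.inn (chart_repr c f) L z)
    = C.inn L L z + F (chart_repr c u z) / chart_repr c u z"
proof -
  let ?U = "chart_repr c u" and ?f = "chart_repr c f"
  note sU = smooth_function_repr(2)[OF c smooth_u] and sf = smooth_function_repr(2)[OF c smooth_f]
  have pos: "?U z > 0" by (rule u_repr_pos[OF z])
  obtain t y where tz: "z = (t, y)" "0 < t" "t < T" "y \<in> chart_img c"
    using z by (cases z) auto
  define x where "x = chart_inv c y"
  have x: "x \<in> chart_dom c" "chart_map c x = y"
    using tz chart_inv_dom[OF atlas c] chart_map_inv[OF atlas c] by (auto simp: x_def)
  have zx: "z = (t, chart_map c x)" using tz x by simp
  note t = tz(2,3)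
  have pU: "u t x' = ?U (t, chart_map c x')" and pf: "f t x' = ?f (t, chart_map c x')" if "x' \<in> chart_dom c" for x'
    using that by (simp_all add: chart_repr_point[OF c t])
  have "vector_derivative (\<lambda>s. u s x) (at t within {0..T}) - weighted_laplacian c (g c t) (f t) (u t) x = F (u t x)"
    using heat c x t by (simp add: solves_nonlinear_heat_def)
  moreover have "vector_derivative (\<lambda>s. u s x) (at t within {0..T}) = dir_deriv time_dir ?U z"
    using time_derivative_repr(2)[OF c t C.diff_at[OF sU] x(1)] z zx by simp
  moreover have "weighted_laplacian c (g c t) (f t) (u t) x = C.lap ?U z - C.inn ?f ?U z"
    unfolding weighted_laplacian_def
    using laplacian_repr[OF c t sU pU x(1)] inner_gradient_repr[OF c t sf pf sU pU x(1)] zx by simp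
  ultimately have heq: "dir_deriv time_dir ?U z - (C.lap ?U z - C.inn ?f ?U z) = F (?U z)"
    using pU[OF x(1)] zx by simp
  have DL: "dir_deriv v L y = dir_deriv v ?U y * inverse (?U y)" if "y \<in> spacetime c" for v y
    unfolding L_def[abs_def]
    by (rule dir_deriv_ln[OF C.diff_at[OF sU that] u_repr_pos[OF that]])
  have sI: "smooth_on (spacetime c) (\<lambda>y. inverse (?U y))"
    using smooth_on_inverse[OF C.open_S sU] u_repr_pos by fastforce
  have "C.D i (C.D j L) z = C.D i (C.D j ?U) z * inverse (?U z) - C.D i L z * C.D j L z" for i j
  proof -
    have "C.D i (C.D j L) z = C.D i (\<lambda>y. C.D j ?U y * inverse (?U y)) z"
      by (rule dir_deriv_cong[OF C.open_S z DL])
    also have "\<dots> = C.D j ?U z * C.D i (\<lambda>y. inverse (?U y)) z + C.D i (C.D j ?U) z * inverse (?U z)"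
      by (rule C.D_mult[OF z C.smooth(6)[OF sU] sI])
    finally show ?thesis
      using dir_deriv_inverse[OF C.diff_at[OF sU z]] pos by (simp add: DL[OF z] mult_ac)
  qed
  then have "C.hess L i j z = C.hess ?U i j z * inverse (?U z) - C.D i L z * C.D j L z" for i j
    by (simp add: C.hess_def DL[OF z] sum_distrib_left left_diff_distrib right_diff_distrib mult_ac)
  then have "C.lap L z = C.lap ?U z * inverse (?U z) - C.inn L L z"
    by (simp add: C.lap_def C.inn_def C.grad_def right_diff_distrib sum_subtractf sum_distrib_left mult_ac)
  moreover have "C.inn ?f L z = C.inn ?f ?U z * inverse (?U z)"
    by (simp add: C.inn_def[of ?f] DL[OF z] sum_distrib_left mult_ac)
  ultimately show ?thesis
    unfolding heq[symmetric] using pos by (simp add: DL[OF z] field_simps)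
qed

text \<open>The constant \<open>p\<close> stands for the value of the time-dependent weight at the time \<open>t\<close>.\<close>

lemma derivative_at_spatial_maximum:
  assumes t: "0 < t" "t < T" and x: "x \<in> chart_dom c" and p: "p \<ge> 0"
    and max: "\<And>x'. x' \<in> chart_dom c \<Longrightarrow> p * q c t x' + ln (u t x') \<le> p * q c t x + ln (u t x)"
  shows "\<exists>dq dl. ((\<lambda>s. q c s x) has_real_derivative dq) (at t) \<and>
      ((\<lambda>s. ln (u s x)) has_real_derivative dl) (at t) \<and>
      p * dq + dl \<le> (2 * k * p - 1) * q c t x + (1 - p * q c t x) * (F (u t x) / u t x)"
proof -
  let ?U = "chart_repr c u" and ?f = "chart_repr c f" and ?z = "(t, chart_map c x)"
  note sU = smooth_function_repr(2)[OF c smooth_u] and sf = smooth_function_repr(2)[OF c smooth_f]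
  have z: "?z \<in> spacetime c" by (rule point_in_spacetime[OF c t x])
  have xM: "x \<in> M" using chart_dom_subset[OF atlas c] x by auto
  have t': "t \<in> {0..T}" using t by simp
  have Uz: "?U ?z = u t x" by (rule chart_repr_point[OF c t x])
  have pos: "u t x > 0" using u[OF xM t'] by simp
  have pf: "f t x' = ?f (t, chart_map c x')" if "x' \<in> chart_dom c" for x'
    using that by (simp add: chart_repr_point[OF c t])
  let ?N = "\<lambda>z. F (?U z) / ?U z"
  \<comment> \<open>The factor in \<open>grad (F u / u) = cc grad (ln u)\<close>, by the quotient
    rule.\<close>
  define cc where "cc = deriv F (u t x) - F (u t x) / u t x"
  have "(F has_real_derivative deriv F (u t x)) (at (u t x))"
    using F pos by (auto simp: C1_differentiable_on_eq field_differentiable_def DERIV_deriv_iff_real_differentiable)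
  then have "(F has_derivative (\<lambda>r. deriv F (u t x) * r)) (at (?U ?z))"
    by (simp add: Uz has_field_derivative_def)
  from diff_chain_at[OF has_derivative_dir_deriv[OF C.diff_at[OF sU z]] this]
  have "((\<lambda>z. F (?U z)) has_derivative (\<lambda>v. deriv F (u t x) * dir_deriv v ?U ?z)) (at ?z)"
    by (simp add: o_def)
  from has_derivative_divide[OF this has_derivative_dir_deriv[OF C.diff_at[OF sU z]]]
  have N: "(?N has_derivative (\<lambda>v. cc * dir_deriv v L ?z)) (at ?z)"
  proof (rule has_derivative_eq_rhs)
    show "?U ?z \<noteq> 0" using pos Uz by simp
    show "(\<lambda>v. - F (?U ?z) * (inverse (?U ?z) * dir_deriv v ?U ?z * inverse (?U ?z)) +
        deriv F (u t x) * dir_deriv v ?U ?z / ?U ?z) = (\<lambda>v. cc * dir_deriv v L ?z)"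
      using pos unfolding L_def[abs_def] dir_deriv_ln[OF C.diff_at[OF sU z] u_repr_pos[OF z]]
      by (intro ext) (simp add: Uz cc_def field_simps)
  qed
  have inv_psd: "0 \<le> v \<bullet> (matrix_inv (chart_repr c (g c) ?z) *v v)" for v
    using matrix_inv_psd[OF metric_posdef[OF c t' x]] by (simp add: chart_repr_point[OF c t x])
  have sG: "chart_repr c (g c) differentiable at ?z"
    using smooth_on_differentiable[OF open_spacetime[OF c] smooth_metric_repr(2)[OF c] z] .
  have flow': "- 2 * k * (\<Sum>i\<in>UNIV. \<Sum>j\<in>UNIV. C.GG i j ?z * w i * w j)
       \<le> (\<Sum>i\<in>UNIV. \<Sum>j\<in>UNIV. (dir_deriv time_dir (C.GG i j) ?z + 2 * (C.ric i j ?z + C.hess ?f i j ?z)) * w i * w j)" for w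
  proof -
    define W :: "real^'n" where "W = (\<chi> i. w i)"
    have "dir_deriv time_dir (chart_repr c (g c)) ?z $ i $ j = dir_deriv time_dir (C.GG i j) ?z" for i j
      using dir_deriv_bounded_linear[OF bounded_linear_entry sG] by (simp add: C.GG_def[abs_def])
    moreover have "W \<bullet> ((- 2 * k) *\<^sub>R g c t x *v W) \<le> W \<bullet> ((dir_deriv time_dir (chart_repr c (g c)) ?z
        + 2 *\<^sub>R weighted_ricci c (g c t) (f t) x) *v W)"
      using flow c x t' time_derivative_repr(2)[OF c t sG x]
      unfolding super_perelman_ricci_flow_def quadratic_le_def by fastforce
    ultimately show ?thesis
      unfolding quadratic_form_sum weighted_ricci_def
      by (simp add: W_def entry_repr[OF c t x] ricci_repr[OF c t x] hessian_repr[OF c t sf pf x]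
          sum_distrib_left mult_ac)
  qed
  have spatial_max: "p * C.inn L L (?z + (\<Sum>i\<in>UNIV. w i *\<^sub>R space_dir i)) + L (?z + (\<Sum>i\<in>UNIV. w i *\<^sub>R space_dir i))
      \<le> p * C.inn L L ?z + L ?z" if "?z + (\<Sum>i\<in>UNIV. w i *\<^sub>R space_dir i) \<in> spacetime c" for w
  proof -
    let ?y = "?z + (\<Sum>i\<in>UNIV. w i *\<^sub>R space_dir i)"
    have "fst ?y = t" by (simp add: fst_sum)
    define x' where "x' = chart_inv c (snd ?y)"
    have s: "snd ?y \<in> chart_img c" using that by (auto simp: mem_Times_iff)
    have x': "x' \<in> chart_dom c" "chart_map c x' = snd ?y"
      using s chart_inv_dom[OF atlas c] chart_map_inv[OF atlas c] unfolding x'_def by auto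
    have y: "?y = (t, chart_map c x')"
      using \<open>fst ?y = t\<close> x'(2) by (metis prod.collapse)
    show ?thesis
      unfolding y using max[OF x'(1)]
      by (simp add: q_repr[OF t x'(1)] q_repr[OF t x] L_point[OF x'(1)] L_point[OF x])
  qed
  have main: "p * dir_deriv time_dir (C.inn L L) ?z + dir_deriv time_dir L ?z
     \<le> (2 * k * p - 1) * C.inn L L ?z + ?N ?z + 2 * p * cc * C.inn L L ?z"
    by (rule C.maximum_inequality[OF z smooth_L sf inv_psd log_heat_equation _ _ flow' p spatial_max])
      (use N dir_deriv_eqI[OF N] in \<open>auto simp: differentiable_def\<close>)
  \<comment> \<open>The growth hypothesis in the form in which it is used: it turns
    \<open>2 p q cc + F u / u\<close> into at most \<open>(1 - p q) F u / u\<close>.\<close>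
  have "2 * cc \<le> - (F (u t x) / u t x)"
    using F_growth[OF xM t'] pos by (simp add: cc_def field_simps)
  moreover have q0: "q c t x \<ge> 0" by (simp add: q_def)
  ultimately have "p * q c t x * (2 * cc) \<le> p * q c t x * (- (F (u t x) / u t x))"
    using p by (intro mult_left_mono) auto
  then have "p * dir_deriv time_dir (C.inn L L) ?z + dir_deriv time_dir L ?z
      \<le> (2 * k * p - 1) * q c t x + (1 - p * q c t x) * (F (u t x) / u t x)"
    using main by (simp add: q_repr[OF t x] Uz algebra_simps)
  moreover have "((\<lambda>s. L (s, chart_map c x)) has_real_derivative dir_deriv time_dir L ?z) (at t)"
    using time_slice_derivative[OF C.diff_at[OF smooth_L z]]
    by (simp add: has_real_derivative_iff_has_vector_derivative)
  moreover have "((\<lambda>s. C.inn L L (s, chart_map c x)) has_real_derivative dir_deriv time_dir (C.inn L L) ?z) (at t)"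
    using time_slice_derivative[OF C.diff_at[OF C.smooth_inn[OF smooth_L smooth_L] z]]
    by (simp add: has_real_derivative_iff_has_vector_derivative)
  then have "((\<lambda>s. q c s x) has_real_derivative dir_deriv time_dir (C.inn L L) ?z) (at t)"
    by (rule has_field_derivative_transform_within_open[of _ _ _ "{0<..<T}"])
      (use t q_repr[OF _ _ x] in auto)
  ultimately show ?thesis
    by (auto simp: L_point[OF x, symmetric])
qed

end

end

section \<open>Change of charts and the gradient estimate\<close>

lemma continuous_on_det:
  fixes G :: "'a::topological_space \<Rightarrow> real^'n^'n"
  assumes "\<And>i j. continuous_on S (\<lambda>x. G x $ i $ j)"
  shows "continuous_on S (\<lambda>x. det (G x))"
  unfolding det_def 
  by (intro continuous_on_sum continuous_on_mult[OF continuous_on_const] continuous_on_prod assms)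

lemma continuous_on_matrix_inv:
  fixes G :: "'a::topological_space \<Rightarrow> real^'n^'n"
  assumes G: "\<And>i j. continuous_on S (\<lambda>x. G x $ i $ j)"
    and nz: "\<And>x. x \<in> S \<Longrightarrow> det (G x) \<noteq> 0"
  shows "continuous_on S (\<lambda>x. matrix_inv (G x) $ k $ l)"
proof -
  have "continuous_on S (\<lambda>x. (\<chi> i j. if j = k then axis l 1 $ i else G x $ i $ j) $ i $ j)" for i j
    using G[of i j] by (cases "j = k") simp_all
  then have "continuous_on S (\<lambda>x. det (\<chi> i j. if j = k then axis l 1 $ i else G x $ i $ j) * inverse (det (G x)))"
    using nz by (intro continuous_on_mult continuous_on_inverse continuous_on_det G) auto
  then show ?thesis
    by (rule continuous_on_eq) (simp add: matrix_inv_cramer nz)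
qed

text \<open>At an end time \<open>V\<close> is only differentiable within the product set, but the
  spatial slice runs in the open set \<open>U\<close> and so has a full derivative. First-order
  spatial quantities thereby make sense on the closed time interval.\<close>

lemma slice_has_derivative:
  assumes "V differentiable (at (t, y) within I \<times> U)" "t \<in> I" "open U" "y \<in> U"
  shows "((\<lambda>y. V (t, y)) has_derivative (\<lambda>w. frechet_derivative V (at (t, y) within I \<times> U) (0, w))) (at y)"
proof -
  have 1: "((\<lambda>y. (t, y)) has_derivative (\<lambda>w. (0, w))) (at y within U)"
    by (auto intro!: derivative_eq_intros)
  have "(V has_derivative frechet_derivative V (at (t, y) within I \<times> U)) (at (t, y) within (\<lambda>y. (t, y)) ` U)"
    using assms(1,2) unfolding frechet_derivative_works by (auto intro: has_derivative_subset)
  from diff_chain_within[OF 1 this] show ?thesis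
    unfolding at_within_open[OF assms(4,3)] by (simp add: o_def)
qed

lemma linear_axis_expansion:
  fixes f :: "real^'n \<Rightarrow> 'b::real_vector"
  assumes "linear f"
  shows "f w = (\<Sum>j\<in>UNIV. w $ j *\<^sub>R f (axis j 1))"
proof -
  have "f w = f (\<Sum>j\<in>UNIV. w $ j *\<^sub>R axis j 1)"
    using basis_expansion[of w] by (simp add: scalar_mult_eq_scaleR)
  then show ?thesis
    by (simp add: linear_sum[OF assms] linear_scale[OF assms])
qed

lemma metric_inner_congruence:
  "metric_inner (transpose J ** P ** J) v w = metric_inner P (J *v v) (J *v w)"
proof -
  have "(J *v v) \<bullet> (P *v (J *v w)) = (v v* transpose J) \<bullet> (P *v (J *v w))"
    by simp
  then show ?thesis
    by (simp only: metric_inner_def dot_lmul_matrix matrix_vector_mul_assoc matrix_mul_assoc)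
qed

section \<open>Transformation laws under a change of charts, and continuity on the closed time
  interval\<close>

context metric_flow
begin

lemma overlap_open:
  assumes "c \<in> A" "d \<in> A"
  shows "open (chart_map c ` (chart_dom c \<inter> chart_dom d))"
proof -
  have "openin (top_of_set M) (chart_dom c \<inter> chart_dom d)"
    using assms chart_dom_open[OF atlas] by (intro openin_Int) auto
  then have "openin (top_of_set (chart_dom c)) (chart_dom c \<inter> chart_dom d)"
    by (rule openin_subset_trans) (use chart_dom_subset[OF atlas assms(1)] in auto)
  then have "openin (top_of_set (chart_img c)) (chart_map c ` (chart_dom c \<inter> chart_dom d))"
    by (rule homeomorphism_imp_open_map[OF chart_homeomorphism[OF atlas assms(1)]])
  then show ?thesis
    using chart_img_open[OF atlas assms(1)] openin_open_trans by blast
qed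

lemma transition_smooth:
  "c \<in> A \<Longrightarrow> d \<in> A \<Longrightarrow> smooth_on (chart_map c ` (chart_dom c \<inter> chart_dom d)) (chart_map d \<circ> chart_inv c)"
  using atlas by (simp add: smooth_atlas_def)

lemma transition_has_derivative:
  assumes "c \<in> A" "d \<in> A" "x \<in> chart_dom c \<inter> chart_dom d"
  shows "((chart_map d \<circ> chart_inv c) has_derivative (\<lambda>w. jacobian c d x *v w)) (at (chart_map c x))"
proof -
  have "(chart_map d \<circ> chart_inv c) differentiable at (chart_map c x)"
    by (rule smooth_on_differentiable[OF overlap_open[OF assms(1,2)] transition_smooth]) (use assms in auto)
  then show ?thesis
    using linear_frechet_derivative[of "chart_map d \<circ> chart_inv c" "at (chart_map c x)"]
    unfolding jacobian_def frechet_derivative_works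
    by (simp add: matrix_works linear_matrix_vector_mul_eq)
qed

lemma metric_inner_transform:
  assumes "c \<in> A" "d \<in> A" "t \<in> {0..T}" "x \<in> chart_dom c \<inter> chart_dom d"
  shows "metric_inner (g c t x) v w = metric_inner (g d t x) (jacobian c d x *v v) (jacobian c d x *v w)"
  unfolding metric_transform[OF assms] metric_inner_congruence ..

text \<open>A vector in the kernel of the Jacobian would have zero length by the transformation law
  of the metric, against positive definiteness. The time \<open>0\<close> is just one at which the
  metric is available.\<close>

lemma jacobian_injective:
  assumes "c \<in> A" "d \<in> A" "x \<in> chart_dom c \<inter> chart_dom d"
  shows "det (jacobian c d x) \<noteq> 0"
proof -
  have "w = 0" if "jacobian c d x *v w = 0" for w
  proof (rule ccontr)
    assume "w \<noteq> 0"
    then have "metric_inner (g c 0 x) w w > 0"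
      using metric_posdef[of c 0 x w] assms T_pos by (simp add: metric_inner_def)
    then show False
      using metric_inner_transform[of c d 0 x w w] assms T_pos that
      by (simp add: metric_inner_def)
  qed
  then show ?thesis
    using matrix_left_invertible_ker[of "jacobian c d x"] invertible_left_inverse[of "jacobian c d x"]
      invertible_det_nz[of "jacobian c d x"] by blast
qed

lemma partial_deriv_transform:
  assumes c: "c \<in> A" and d: "d \<in> A" and x: "x \<in> chart_dom c \<inter> chart_dom d"
    and v: "(v \<circ> chart_inv d) differentiable at (chart_map d x)"
  shows "(\<chi> i. partial_deriv c i v x) = transpose (jacobian c d x) *v (\<chi> j. partial_deriv d j v x)"
proof -
  let ?J = "jacobian c d x" and ?f = "frechet_derivative (v \<circ> chart_inv d) (at (chart_map d x))"
  have xc: "chart_inv c (chart_map c x) = x"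
    using chart_inv_map[OF atlas c] x by auto
  have "((v \<circ> chart_inv d) has_derivative ?f) (at ((chart_map d \<circ> chart_inv c) (chart_map c x)))"
    using v by (simp add: frechet_derivative_works xc)
  from diff_chain_at[OF transition_has_derivative[OF c d x] this]
  have "(((v \<circ> chart_inv d) \<circ> (chart_map d \<circ> chart_inv c)) has_derivative (\<lambda>w. ?f (?J *v w))) (at (chart_map c x))"
    by (simp add: o_def)
  then have "((v \<circ> chart_inv c) has_derivative (\<lambda>w. ?f (?J *v w))) (at (chart_map c x))"
  proof (rule has_derivative_transform_within_open[OF _ overlap_open[OF c d]])
    show "chart_map c x \<in> chart_map c ` (chart_dom c \<inter> chart_dom d)" using x by auto
    show "((v \<circ> chart_inv d) \<circ> (chart_map d \<circ> chart_inv c)) y = (v \<circ> chart_inv c) y"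
      if "y \<in> chart_map c ` (chart_dom c \<inter> chart_dom d)" for y
      using that chart_inv_map[OF atlas c] chart_inv_map[OF atlas d] by auto
  qed
  from dir_deriv_eqI[OF this]
  have "partial_deriv c i v x = ?f (?J *v axis i 1)" for i
    by (simp add: partial_deriv_dir_deriv)
  also have "?f (?J *v axis i 1) = (\<Sum>j\<in>UNIV. ?J $ j $ i * partial_deriv d j v x)" for i
    using linear_axis_expansion[OF linear_frechet_derivative[OF v], of "?J *v axis i 1"]
    by (simp add: partial_deriv_def matrix_vector_mult_basis column_def)
  finally show ?thesis
    by (simp add: vec_eq_iff matrix_vector_mult_def transpose_def)
qed

text \<open>Both the metric applied to the gradient and the differential acquire the factor
  \<open>transpose J\<close>; cancelling this invertible factor identifies \<open>J\<close> times
  one gradient with the other.\<close>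

lemma gradient_transform:
  assumes c: "c \<in> A" and d: "d \<in> A" and t: "t \<in> {0..T}" and x: "x \<in> chart_dom c \<inter> chart_dom d"
    and v: "(v \<circ> chart_inv d) differentiable at (chart_map d x)"
  shows "jacobian c d x *v gradient c (g c t) v x = gradient d (g d t) v x"
proof -
  let ?J = "jacobian c d x" and ?pd = "\<chi> j. partial_deriv d j v x"
  have nz: "det (g c t x) \<noteq> 0" "det (g d t x) \<noteq> 0"
    using metric_det c d t x by auto
  have "transpose ?J *v (g d t x *v (?J *v gradient c (g c t) v x)) = g c t x *v gradient c (g c t) v x"
    by (simp add: metric_transform[OF c d t x] matrix_vector_mul_assoc matrix_mul_assoc)
  also have "\<dots> = transpose ?J *v ?pd"
    using invertible_matrix_inv(1)[OF nz(1)] partial_deriv_transform[OF c d x v]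
    by (simp add: gradient_def matrix_vector_mul_assoc)
  finally have "matrix_inv (transpose ?J) *v (transpose ?J *v (g d t x *v (?J *v gradient c (g c t) v x)))
      = matrix_inv (transpose ?J) *v (transpose ?J *v ?pd)"
    by simp
  moreover have "matrix_inv (transpose ?J) *v (transpose ?J *v w) = w" for w
    unfolding matrix_vector_mul_assoc
    using invertible_matrix_inv(2)[of "transpose ?J"] jacobian_injective[OF c d x] by simp
  ultimately have "g d t x *v (?J *v gradient c (g c t) v x) = ?pd"
    by metis
  then have "matrix_inv (g d t x) *v (g d t x *v (?J *v gradient c (g c t) v x)) = gradient d (g d t) v x"
    by (simp add: gradient_def)
  then show ?thesis
    using invertible_matrix_inv(2)[OF nz(2)] by (simp add: matrix_vector_mul_assoc matrix_mul_assoc)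
qed

lemma chart_coordinates_continuous:
  assumes "c \<in> A"
  shows "continuous_on ({0..T} \<times> chart_dom c) (\<lambda>z. (fst z, chart_map c (snd z)))"
proof -
  have "continuous_on (chart_dom c) (chart_map c)"
    using chart_homeomorphism[OF atlas assms] by (simp add: homeomorphism_def)
  then show ?thesis
    by (intro continuous_on_Pair continuous_on_fst continuous_on_id continuous_on_compose2[of _ "chart_map c" _ snd])
      (auto intro: continuous_on_snd continuous_on_id)
qed

lemma continuous_on_chart_repr:
  assumes c: "c \<in> A" and h: "continuous_on ({0..T} \<times> chart_img c) h"
  shows "continuous_on ({0..T} \<times> chart_dom c) (\<lambda>z. h (fst z, chart_map c (snd z)))"
proof -
  have "(\<lambda>z. (fst z, chart_map c (snd z))) ` ({0..T} \<times> chart_dom c) \<subseteq> {0..T} \<times> chart_img c"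
    unfolding chart_img_def by fastforce
  from continuous_on_compose2[OF h chart_coordinates_continuous[OF c] this] show ?thesis .
qed

text \<open>Chart domains are relatively open in \<open>M\<close>, so near each point the cylinder
  over a chart domain and the one over \<open>M\<close> define the same limits.\<close>

lemma continuous_on_atlas:
  fixes h :: "real \<times> 'a \<Rightarrow> 'b::topological_space"
  assumes "\<And>c. c \<in> A \<Longrightarrow> continuous_on ({0..T} \<times> chart_dom c) h"
  shows "continuous_on ({0..T} \<times> M) h"
  unfolding continuous_on_eq_continuous_within
proof
  fix z assume z: "z \<in> {0..T} \<times> M"
  then have "snd z \<in> M" by auto
  then obtain c where c: "c \<in> A" "snd z \<in> chart_dom c"
    using chart_cover[OF atlas] by blast
  obtain U where U: "open U" "chart_dom c = M \<inter> U"
    using chart_dom_open[OF atlas c(1)] by (auto simp: openin_open)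
  have "at z within {0..T} \<times> chart_dom c = at z within {0..T} \<times> M"
    by (rule at_within_nhd[of _ "UNIV \<times> U"]) (use z c U in \<open>auto intro: open_Times simp: mem_Times_iff\<close>)
  moreover have "continuous (at z within {0..T} \<times> chart_dom c) h"
    using assms[OF c(1)] z c(2) unfolding continuous_on_eq_continuous_within by (metis mem_Times_iff)
  ultimately show "continuous (at z within {0..T} \<times> M) h"
    by simp
qed

lemma metric_continuous:
  assumes c: "c \<in> A"
  shows "continuous_on ({0..T} \<times> chart_dom c) (\<lambda>z. g c (fst z) (snd z))"
proof -
  have "continuous_on ({0..T} \<times> chart_dom c) (\<lambda>z. chart_repr c (g c) (fst z, chart_map c (snd z)))"
    using smooth_metric_repr(1)[OF c] unfolding smooth_on_def
    by (intro continuous_on_chart_repr[OF c]) (metis Ck_on.simps(1))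
  then show ?thesis
    by (rule continuous_on_eq) (auto simp: chart_repr_def chart_inv_map[OF atlas c])
qed

context
  fixes v :: "real \<Rightarrow> 'a \<Rightarrow> real"
  assumes v: "smooth_function_family A T v"
begin

lemma function_continuous: "continuous_on ({0..T} \<times> M) (\<lambda>z. v (fst z) (snd z))"
proof (rule continuous_on_atlas)
  fix c assume c: "c \<in> A"
  have "continuous_on ({0..T} \<times> chart_dom c) (\<lambda>z. chart_repr c v (fst z, chart_map c (snd z)))"
    using smooth_function_repr(1)[OF c v] unfolding smooth_on_def
    by (intro continuous_on_chart_repr[OF c]) (metis Ck_on.simps(1))
  then show "continuous_on ({0..T} \<times> chart_dom c) (\<lambda>z. v (fst z) (snd z))"
    by (rule continuous_on_eq) (auto simp: chart_repr_def chart_inv_map[OF atlas c])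
qed

context
  fixes c assumes c: "c \<in> A"
begin

lemma function_slice_has_derivative:
  assumes "t \<in> {0..T}" "x \<in> chart_dom c"
  shows "((v t \<circ> chart_inv c) has_derivative
    (\<lambda>w. frechet_derivative (chart_repr c v) (at (t, chart_map c x) within {0..T} \<times> chart_img c) (0, w))) (at (chart_map c x))"
proof -
  have "Ck_on 1 ({0..T} \<times> chart_img c) (chart_repr c v)"
    using smooth_function_repr(1)[OF c v] unfolding smooth_on_def by blast
  then have "chart_repr c v differentiable (at (t, chart_map c x) within {0..T} \<times> chart_img c)"
    using assms by (auto simp: differentiable_on_def chart_img_def)
  from slice_has_derivative[OF this assms(1) chart_img_open[OF atlas c] chart_map_img[OF assms(2)]]
  show ?thesis by (simp add: chart_repr_def o_def)
qed

lemma function_slice_differentiable: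
  "t \<in> {0..T} \<Longrightarrow> x \<in> chart_dom c \<Longrightarrow> (v t \<circ> chart_inv c) differentiable at (chart_map c x)"
  unfolding differentiable_def by (rule exI, rule function_slice_has_derivative)

lemma partial_deriv_continuous:
  "continuous_on ({0..T} \<times> chart_dom c) (\<lambda>z. partial_deriv c i (v (fst z)) (snd z))"
proof -
  have "Ck_on 1 ({0..T} \<times> chart_img c) (chart_repr c v)"
    using smooth_function_repr(1)[OF c v] unfolding smooth_on_def by blast
  then have "continuous_on ({0..T} \<times> chart_img c)
      (\<lambda>z. frechet_derivative (chart_repr c v) (at z within {0..T} \<times> chart_img c) (0, axis i 1))"
    by auto
  from continuous_on_chart_repr[OF c this] show ?thesis
    by (rule continuous_on_eq)
      (auto simp: partial_deriv_dir_deriv dir_deriv_eqI[OF function_slice_has_derivative])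
qed

end

end

end

section \<open>The squared gradient of the logarithm as a global continuous function\<close>

context heat_flow
begin

lemma log_slice_has_derivative:
  assumes c: "c \<in> A" and t: "t \<in> {0..T}" and x: "x \<in> chart_dom c"
  shows "((\<lambda>z. ln (u t z)) \<circ> chart_inv c has_derivative
     (\<lambda>w. dir_deriv w (u t \<circ> chart_inv c) (chart_map c x) * inverse (u t x))) (at (chart_map c x))"
proof -
  have xc: "chart_inv c (chart_map c x) = x" by (rule chart_inv_map[OF atlas c x])
  have "u t x > 0" using u[of x t] chart_dom_subset[OF atlas c] x t by auto
  with has_derivative_ln[OF _ has_derivative_dir_deriv[OF function_slice_differentiable[OF smooth_u c t x]]]
  show ?thesis by (simp add: o_def xc)
qed

lemma log_slice_differentiable:
  "c \<in> A \<Longrightarrow> t \<in> {0..T} \<Longrightarrow> x \<in> chart_dom c \<Longrightarrow> ((\<lambda>z. ln (u t z)) \<circ> chart_inv c) differentiable at (chart_map c x)"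
  unfolding differentiable_def by (rule exI, rule log_slice_has_derivative)

lemma partial_deriv_log:
  "c \<in> A \<Longrightarrow> t \<in> {0..T} \<Longrightarrow> x \<in> chart_dom c \<Longrightarrow>
    partial_deriv c i (\<lambda>z. ln (u t z)) x = partial_deriv c i (u t) x * inverse (u t x)"
  unfolding partial_deriv_dir_deriv by (rule dir_deriv_eqI[OF log_slice_has_derivative])

lemma q_inner:
  assumes "c \<in> A" "t \<in> {0..T}" "x \<in> chart_dom c"
  shows "q c t x = metric_inner (g c t x) (gradient c (g c t) (\<lambda>z. ln (u t z)) x) (gradient c (g c t) (\<lambda>z. ln (u t z)) x)"
  using metric_inner_nonneg[OF assms(1,3,2)] by (simp add: q_def metric_norm_def)

lemma q_chart_independent:
  assumes "c \<in> A" "d \<in> A" "t \<in> {0..T}" "x \<in> chart_dom c \<inter> chart_dom d"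
  shows "q c t x = q d t x"
  using assms by (simp add: q_inner metric_inner_transform[OF assms]
    gradient_transform[OF assms log_slice_differentiable[OF assms(2,3)]])

text \<open>Continuity must include both end times: \<open>0\<close> for the maximum over a compact
  set, \<open>T\<close> for the Harnack inequality. It is read off from an explicit expression in
  the metric, its inverse and the first derivatives of \<open>u\<close>.\<close>

lemma q_continuous:
  assumes c: "c \<in> A"
  shows "continuous_on ({0..T} \<times> chart_dom c) (\<lambda>z. q c (fst z) (snd z))"
proof -
  let ?S = "{0..T} \<times> chart_dom c"
  let ?v = "\<lambda>z i. \<Sum>j\<in>UNIV. matrix_inv (g c (fst z) (snd z)) $ i $ j *
      (partial_deriv c j (u (fst z)) (snd z) * inverse (u (fst z) (snd z)))"
  have cG: "continuous_on ?S (\<lambda>z. g c (fst z) (snd z) $ i $ j)" for i j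
    using metric_continuous[OF c] by (intro continuous_intros)
  have "continuous_on ?S (\<lambda>z. u (fst z) (snd z))"
    by (rule continuous_on_subset[OF function_continuous[OF smooth_u]])
      (use chart_dom_subset[OF atlas c] in auto)
  moreover have "u (fst z) (snd z) \<noteq> 0" if "z \<in> ?S" for z
    using u[of "snd z" "fst z"] chart_dom_subset[OF atlas c] that by force
  ultimately have "continuous_on ?S (\<lambda>z. \<Sum>i\<in>UNIV. \<Sum>j\<in>UNIV. g c (fst z) (snd z) $ i $ j * ?v z i * ?v z j)"
    by (intro continuous_on_sum continuous_on_mult continuous_on_inverse cG continuous_on_matrix_inv
        partial_deriv_continuous[OF smooth_u c] ballI) (use metric_det[OF c] in auto)
  moreover have "q c (fst z) (snd z) = (\<Sum>i\<in>UNIV. \<Sum>j\<in>UNIV. g c (fst z) (snd z) $ i $ j * ?v z i * ?v z j)"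
    if "z \<in> ?S" for z
  proof -
    have z: "fst z \<in> {0..T}" "snd z \<in> chart_dom c" using that by auto
    show ?thesis
      unfolding q_inner[OF c z] metric_inner_def quadratic_form_sum
      by (simp add: gradient_def matrix_vector_mult_def partial_deriv_log[OF c z])
  qed
  ultimately show ?thesis
    using continuous_on_eq[where g = "\<lambda>z. q c (fst z) (snd z)"] by fastforce
qed

definition Q :: "real \<Rightarrow> 'a \<Rightarrow> real" where
  "Q t x = q (SOME c. c \<in> A \<and> x \<in> chart_dom c) t x"

lemma Q_eq:
  assumes "c \<in> A" "t \<in> {0..T}" "x \<in> chart_dom c"
  shows "Q t x = q c t x"
proof -
  let ?c = "SOME c. c \<in> A \<and> x \<in> chart_dom c"
  have "?c \<in> A \<and> x \<in> chart_dom ?c"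
    by (rule someI[of "\<lambda>c. c \<in> A \<and> x \<in> chart_dom c" c]) (use assms in auto)
  then show ?thesis
    unfolding Q_def using assms by (intro q_chart_independent) auto
qed

lemma Q_continuous: "continuous_on ({0..T} \<times> M) (\<lambda>z. Q (fst z) (snd z))"
proof (rule continuous_on_atlas)
  fix c assume c: "c \<in> A"
  show "continuous_on ({0..T} \<times> chart_dom c) (\<lambda>z. Q (fst z) (snd z))"
    by (rule continuous_on_eq[OF q_continuous[OF c]]) (auto simp: Q_eq[OF c])
qed

section \<open>The gradient estimate by the maximum principle\<close>

definition weight :: "real \<Rightarrow> real" where "weight t = t / (1 + 2 * k * t)"

lemma weight_denominator: "t \<ge> 0 \<Longrightarrow> 1 + 2 * k * t > 0"
  using k by (simp add: add_pos_nonneg)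

lemma weight_nonneg: "t \<ge> 0 \<Longrightarrow> weight t \<ge> 0"
  using weight_denominator[of t] by (simp add: weight_def)

text \<open>The weight is a subsolution of \<open>w' + 2 k w = 1\<close> that vanishes at time
  \<open>0\<close>. Over the common denominator the claim reduces to
  \<open>k t \<ge> 0\<close>.\<close>

lemma weight_derivative:
  assumes "t \<ge> 0"
  shows "(weight has_real_derivative 1 / (1 + 2 * k * t)\<^sup>2) (at t)"
    and "1 / (1 + 2 * k * t)\<^sup>2 + 2 * k * weight t \<le> 1"
proof -
  note p = weight_denominator[OF assms]
  show "(weight has_real_derivative 1 / (1 + 2 * k * t)\<^sup>2) (at t)"
    unfolding weight_def[abs_def] using p
    by (auto intro!: derivative_eq_intros simp: power2_eq_square)
  have "k * t \<ge> 0" using k assms by simp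
  then have "1 + 2 * k * t * (1 + 2 * k * t) \<le> (1 + 2 * k * t)\<^sup>2"
    by (simp add: power2_eq_square algebra_simps)
  moreover have "1 / (1 + 2 * k * t)\<^sup>2 + 2 * k * weight t = (1 + 2 * k * t * (1 + 2 * k * t)) / (1 + 2 * k * t)\<^sup>2"
    using p by (simp add: weight_def power2_eq_square add_divide_distrib)
  ultimately show "1 / (1 + 2 * k * t)\<^sup>2 + 2 * k * weight t \<le> 1"
    using p by simp
qed

text \<open>The inequality at a spatial maximum is not strict, so \<open>\<epsilon> t\<close> is
  subtracted from \<open>R\<close> before maximising over the compact set
  \<open>{0..t0} x M\<close>. Stopping at \<open>t0 < T\<close> keeps the maximum time inside the
  range where time derivatives are two-sided.\<close>

lemma weighted_estimate:
  assumes t0: "0 < t0" "t0 < T" and x0: "x0 \<in> M"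
  shows "weight t0 * Q t0 x0 + ln (u t0 x0) \<le> 1 + ln D"
proof (rule ccontr)
  define R where "R t x = weight t * Q t x + ln (u t x)" for t x
  \<comment> \<open>The correction at time \<open>t0\<close> uses up half of the excess of
    \<open>R\<close> over the threshold, so the corrected function still exceeds it at
    \<open>(t0, x0)\<close>.\<close>
  define \<epsilon> where "\<epsilon> = (R t0 x0 - (1 + ln D)) / (2 * t0)"
  assume "\<not> ?thesis"
  then have big: "R t0 x0 > 1 + ln D" by (simp add: R_def)
  then have \<epsilon>: "\<epsilon> > 0" using t0 by (simp add: \<epsilon>_def)
  have "R t0 x0 - \<epsilon> * t0 = (R t0 x0 + (1 + ln D)) / 2"
    using t0 by (simp add: \<epsilon>_def field_simps)
  then have big': "R t0 x0 - \<epsilon> * t0 > 1 + ln D" using big by simp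
  let ?K = "{0..t0} \<times> M"
  have K: "?K \<subseteq> {0..T} \<times> M" using t0 by auto
  have "continuous_on ?K (\<lambda>z. weight (fst z))"
    unfolding weight_def using weight_denominator by (intro continuous_intros) (force simp: less_le)
  moreover have "continuous_on ?K (\<lambda>z. ln (u (fst z) (snd z)))"
    using continuous_on_subset[OF function_continuous[OF smooth_u] K] u[of "snd _" "fst _"] t0
    by (intro continuous_on_ln) (auto simp: less_le)
  ultimately have "continuous_on ?K (\<lambda>z. R (fst z) (snd z) - \<epsilon> * fst z)"
    unfolding R_def using continuous_on_subset[OF Q_continuous K]
    by (auto intro!: continuous_on_diff continuous_on_add continuous_on_mult continuous_on_fst
        continuous_on_const continuous_on_id)
  moreover have "compact ?K"
    using manifold by (intro compact_Times) (auto simp: closed_manifold_def)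
  moreover have "?K \<noteq> {}" using t0 x0 by auto
  ultimately obtain z where z: "z \<in> ?K" "\<And>y. y \<in> ?K \<Longrightarrow> R (fst y) (snd y) - \<epsilon> * fst y \<le> R (fst z) (snd z) - \<epsilon> * fst z"
    using continuous_attains_sup[of ?K "\<lambda>z. R (fst z) (snd z) - \<epsilon> * fst z"] by blast
  obtain t x where tx: "z = (t, x)" by (cases z)
  then have x: "x \<in> M" and t: "0 \<le> t" "t \<le> t0" and t': "t \<in> {0..T}" using z(1) t0 by auto
  have max: "R s y - \<epsilon> * s \<le> R t x - \<epsilon> * t" if "0 \<le> s" "s \<le> t0" "y \<in> M" for s y
    using z(2)[of "(s, y)"] that tx by auto
  have large: "R t x - \<epsilon> * t > 1 + ln D"
    using max[of t0 x0] big' t0 x0 by simp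
  have lnu: "ln (u t x) \<le> ln D" using u[OF x t'] by (simp add: ln_mono)
  \<comment> \<open>At time \<open>0\<close> the weight vanishes and \<open>R\<close> is
    \<open>ln u\<close>, at most \<open>ln D\<close>.\<close>
  have "t \<noteq> 0" using large lnu by (auto simp: R_def weight_def)
  then have t1: "0 < t" "t < T" using t t0 by auto
  obtain c where c: "c \<in> A" "x \<in> chart_dom c" using chart_cover[OF atlas x] by blast
  have "weight t * q c t x' + ln (u t x') \<le> weight t * q c t x + ln (u t x)" if "x' \<in> chart_dom c" for x'
    using max[OF t, of x'] that chart_dom_subset[OF atlas c(1)] Q_eq[OF c(1) t' that] Q_eq[OF c(1) t' c(2)]
    by (auto simp: R_def)
  from derivative_at_spatial_maximum[OF c(1) t1 c(2) weight_nonneg[OF t(1)] this]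
  obtain dq dl where dq: "((\<lambda>s. q c s x) has_real_derivative dq) (at t)"
    and dl: "((\<lambda>s. ln (u s x)) has_real_derivative dl) (at t)"
    and le: "weight t * dq + dl \<le> (2 * k * weight t - 1) * q c t x + (1 - weight t * q c t x) * (F (u t x) / u t x)"
    by blast
  let ?w' = "1 / (1 + 2 * k * t)\<^sup>2"
  have "((\<lambda>s. weight s * q c s x + ln (u s x) - \<epsilon> * s) has_real_derivative
      ?w' * q c t x + weight t * dq + dl - \<epsilon>) (at t)"
    using DERIV_diff[OF DERIV_add[OF DERIV_mult[OF weight_derivative(1)[OF t(1)] dq] dl] DERIV_cmult_Id[of \<epsilon>]]
    by (simp add: mult.commute)
  then have "((\<lambda>s. R s x - \<epsilon> * s) has_real_derivative ?w' * q c t x + weight t * dq + dl - \<epsilon>) (at t)"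
    by (rule has_field_derivative_transform_within_open[of _ _ _ "{0<..<T}"])
      (use t1 Q_eq[OF c(1) _ c(2)] in \<open>auto simp: R_def\<close>)
  moreover have "?w' * q c t x + weight t * dq + dl - \<epsilon> < 0"
  proof -
    have "(?w' + 2 * k * weight t) * q c t x \<le> 1 * q c t x"
      using weight_derivative(2)[OF t(1)] by (intro mult_right_mono) (auto simp: q_def)
    moreover have "(1 - weight t * q c t x) * (F (u t x) / u t x) \<le> 0"
    proof (rule mult_nonpos_nonneg)
      have "\<epsilon> * t \<ge> 0" using \<epsilon> t by simp
      then show "1 - weight t * q c t x \<le> 0"
        using large lnu by (simp add: R_def Q_eq[OF c(1) t' c(2)])
      show "0 \<le> F (u t x) / u t x"
        using F_nonneg[OF x t'] u[OF x t'] by simp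
    qed
    ultimately show ?thesis using le \<epsilon> by (simp add: algebra_simps)
  qed
  \<comment> \<open>A negative time derivative means larger values slightly earlier. Looking
    backwards stays in \<open>{0..t0}\<close> even if the maximum is attained at
    \<open>t0\<close>.\<close>
  ultimately obtain d where d: "d > 0" "\<And>h. h > 0 \<Longrightarrow> h < d \<Longrightarrow> R t x - \<epsilon> * t < R (t - h) x - \<epsilon> * (t - h)"
    using DERIV_neg_dec_left by blast
  define h where "h = min d t / 2"
  have "h > 0" "h < d" "h \<le> t" using d t1 by (auto simp: h_def)
  then show False
    using d(2)[of h] max[of "t - h" x] t x by auto
qed

theorem log_gradient_estimate:
  assumes t: "0 < t" "t < T" and c: "c \<in> A" and x: "x \<in> chart_dom c"
  shows "t * (metric_norm (g c t x) (gradient c (g c t) (\<lambda>z. ln (u t z)) x))\<^sup>2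
     \<le> (1 + 2 * k * t) * (1 + ln (D / u t x))"
proof -
  have xM: "x \<in> M" using chart_dom_subset[OF atlas c] x by auto
  have pos: "u t x > 0" "D > 0" using u[OF xM, of t] t by auto
  have "weight t * q c t x \<le> 1 + ln (D / u t x)"
    using weighted_estimate[OF t xM] Q_eq[OF c _ x, of t] t pos by (simp add: ln_div)
  moreover have "1 + 2 * k * t > 0" using weight_denominator t by simp
  ultimately show ?thesis
    by (simp add: weight_def q_def field_simps)
qed

end

section \<open>Piecewise differentiable curves\<close>

lemma at_within_relatively_open:
  assumes "openin (top_of_set I) W" "s \<in> W"
  shows "at s within W = at s within I"
proof -
  obtain U where "open U" "W = I \<inter> U"
    using assms(1) by (auto simp: openin_open)
  then show ?thesis
    using assms(2) by (intro at_within_nhd[of s U]) auto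
qed

lemma has_derivative_real_domain:
  fixes h :: "real \<Rightarrow> 'b::real_normed_vector"
  assumes "(h has_derivative L) (at s within W)"
  shows "L = (\<lambda>r. r *\<^sub>R L 1)" and "(h has_vector_derivative L 1) (at s within W)"
proof -
  show *: "L = (\<lambda>r. r *\<^sub>R L 1)"
  proof
    show "L r = r *\<^sub>R L 1" for r
      using linear_scale[OF has_derivative_linear[OF assms], of r 1] by simp
  qed
  show "(h has_vector_derivative L 1) (at s within W)"
    unfolding has_vector_derivative_def using assms * by metis
qed

lemma vector_derivative_Icc:
  assumes "a < b" "s \<in> {a..b}" "(h has_vector_derivative h') (at s within {a..b})"
  shows "vector_derivative h (at s within {a..b}) = h'"
  using vector_derivative_within_cbox[of a b s h h'] assms by simp

lemma Ck_on_1_vector_derivative: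
  fixes h :: "real \<Rightarrow> 'b::real_normed_vector"
  assumes "openin (top_of_set {a..b}) W" "Ck_on 1 W h"
  shows "\<exists>h'. continuous_on W h' \<and> (\<forall>s\<in>W. (h has_vector_derivative h' s) (at s within {a..b}))"
proof (intro exI conjI ballI)
  let ?h' = "\<lambda>s. frechet_derivative h (at s within W) 1"
  show "continuous_on W ?h'"
    using assms(2) by simp
  fix s assume s: "s \<in> W"
  then have "(h has_derivative frechet_derivative h (at s within W)) (at s within W)"
    using assms(2) by (auto simp: differentiable_on_def frechet_derivative_works)
  then have "(h has_vector_derivative ?h' s) (at s within W)"
    by (rule has_derivative_real_domain(2))
  then show "(h has_vector_derivative ?h' s) (at s within {a..b})"
    by (simp add: at_within_relatively_open[OF assms(1) s])
qed

text \<open>\<open>frechet_derivative\<close> denotes a chosen derivative, so continuity of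
  \<open>h'\<close> transfers only where derivatives are unique. Uniqueness holds within the
  nondegenerate interval and passes to \<open>W\<close> because \<open>W\<close> is relatively open
  in it.\<close>

lemma vector_derivative_Ck_on_1:
  fixes h :: "real \<Rightarrow> 'b::real_normed_vector"
  assumes "a < b" "openin (top_of_set {a..b}) W" "continuous_on W h'"
    and h': "\<And>s. s \<in> W \<Longrightarrow> (h has_vector_derivative h' s) (at s within {a..b})"
  shows "Ck_on 1 W h"
proof -
  have W: "W \<subseteq> {a..b}" using assms(2) openin_imp_subset by blast
  have *: "(h has_derivative (\<lambda>r. r *\<^sub>R h' s)) (at s within W)" if "s \<in> W" for s
    using h'[OF that] by (simp add: has_vector_derivative_def at_within_relatively_open[OF assms(2) that])
  have "frechet_derivative h (at s within W) = (\<lambda>r. r *\<^sub>R h' s)" if "s \<in> W" for s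
  proof -
    let ?L = "frechet_derivative h (at s within {a..b})"
    have L: "(h has_derivative ?L) (at s within {a..b})"
      using h'[OF that] frechet_derivative_works differentiableI has_vector_derivative_def by metis
    have "?L 1 = h' s"
      using vector_derivative_Icc[OF assms(1) _ has_derivative_real_domain(2)[OF L]]
        vector_derivative_Icc[OF assms(1) _ h'[OF that]] W that by auto
    then have "?L = (\<lambda>r. r *\<^sub>R h' s)"
      using has_derivative_real_domain(1)[OF L] by simp
    then show ?thesis
      by (simp add: at_within_relatively_open[OF assms(2) that])
  qed
  then have "continuous_on W (\<lambda>s. frechet_derivative h (at s within W) v)" for v
    using assms(3) by (auto intro!: continuous_intros)
  moreover have "h differentiable_on W"
    using * by (auto simp: differentiable_on_def differentiable_def)
  ultimately show ?thesis by simp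
qed

section \<open>Pieces of class C^1: velocity, speed and integrability\<close>

context metric_flow
begin

text \<open>An equivalent of \<open>Ck_on 1\<close> in each chart, with derivatives taken within the
  fixed interval instead of the chart-dependent preimage and with an explicit continuous derivative;
  this form is stable under reparametrisation and joining.\<close>

definition C1_piece :: "(real \<Rightarrow> 'a) \<Rightarrow> real \<Rightarrow> real \<Rightarrow> bool" where
  "C1_piece \<gamma> a b \<longleftrightarrow> (\<forall>c\<in>A. \<exists>h'. continuous_on {s \<in> {a..b}. \<gamma> s \<in> chart_dom c} h' \<and>
     (\<forall>s\<in>{a..b}. \<gamma> s \<in> chart_dom c \<longrightarrow> ((chart_map c \<circ> \<gamma>) has_vector_derivative h' s) (at s within {a..b})))"

lemma chart_preimage_open:
  assumes "continuous_on {a..b} \<gamma>" "\<gamma> ` {a..b} \<subseteq> M" "c \<in> A"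
  shows "openin (top_of_set {a..b}) {s \<in> {a..b}. \<gamma> s \<in> chart_dom c}"
proof -
  have "openin (top_of_set {a..b}) ({a..b} \<inter> \<gamma> -` chart_dom c)"
    by (rule continuous_openin_preimage[OF assms(1) _ chart_dom_open[OF atlas assms(3)]]) (use assms(2) in auto)
  moreover have "{a..b} \<inter> \<gamma> -` chart_dom c = {s \<in> {a..b}. \<gamma> s \<in> chart_dom c}" by auto
  ultimately show ?thesis by simp
qed

lemma piecewise_C1_curve_iff:
  "piecewise_C1_curve M A \<gamma> \<longleftrightarrow> continuous_on {0..1} \<gamma> \<and> \<gamma> ` {0..1} \<subseteq> M \<and>
     (\<exists>P. finite P \<and> (\<forall>a b. 0 \<le> a \<and> a < b \<and> b \<le> 1 \<and> {a<..<b} \<inter> P = {} \<longrightarrow> C1_piece \<gamma> a b))"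
proof -
  have "(\<forall>c\<in>A. Ck_on 1 {s \<in> {a..b}. \<gamma> s \<in> chart_dom c} (chart_map c \<circ> \<gamma>)) \<longleftrightarrow> C1_piece \<gamma> a b"
    if ab: "0 \<le> a" "a < b" "b \<le> 1" and \<gamma>: "continuous_on {0..1} \<gamma>" "\<gamma> ` {0..1} \<subseteq> M" for a b
  proof -
    have "continuous_on {a..b} \<gamma>" "\<gamma> ` {a..b} \<subseteq> M"
      using ab \<gamma> by (auto intro: continuous_on_subset)
    note o = chart_preimage_open[OF this]
    have "Ck_on 1 {s \<in> {a..b}. \<gamma> s \<in> chart_dom c} (chart_map c \<circ> \<gamma>) \<longleftrightarrow>
       (\<exists>h'. continuous_on {s \<in> {a..b}. \<gamma> s \<in> chart_dom c} h' \<and>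
     (\<forall>s\<in>{a..b}. \<gamma> s \<in> chart_dom c \<longrightarrow> ((chart_map c \<circ> \<gamma>) has_vector_derivative h' s) (at s within {a..b})))"
      if c: "c \<in> A" for c
      using Ck_on_1_vector_derivative[OF o[OF c], of "chart_map c \<circ> \<gamma>"]
        vector_derivative_Ck_on_1[OF ab(2) o[OF c], of _ "chart_map c \<circ> \<gamma>"]
      by (metis (no_types, lifting) mem_Collect_eq)
    then show ?thesis unfolding C1_piece_def by blast
  qed
  then show ?thesis
    unfolding piecewise_C1_curve_def by (smt (verit, best))
qed

lemma metric_norm_nonneg:
  "c \<in> A \<Longrightarrow> t \<in> {0..T} \<Longrightarrow> x \<in> chart_dom c \<Longrightarrow> 0 \<le> metric_norm (g c t x) v"
  using metric_posdef[of c t x v] by (cases "v = 0") (auto simp: metric_norm_def metric_inner_def)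

lemma metric_cauchy_schwarz:
  assumes c: "c \<in> A" "t \<in> {0..T}" "x \<in> chart_dom c"
  shows "\<bar>metric_inner (g c t x) v w\<bar> \<le> metric_norm (g c t x) v * metric_norm (g c t x) w"
proof -
  let ?B = "metric_inner (g c t x)"
  have nn: "0 \<le> ?B v v" for v
    using metric_posdef[OF c, of v] by (cases "v = 0") (auto simp: metric_inner_def)
  have sym: "?B w v = ?B v w"
    using metric_sym[OF c] dot_lmul_matrix[of w "g c t x" v]
    by (metis inner_commute metric_inner_def transpose_matrix_vector)
  have "(?B v w)\<^sup>2 \<le> ?B v v * ?B w w"
  proof (cases "w = 0")
    case False
    then have pos: "?B w w > 0"
      using metric_posdef[OF c] by (simp add: metric_inner_def)
    define r where "r = ?B v w / ?B w w"
    have "?B (v - r *\<^sub>R w) (v - r *\<^sub>R w) = ?B v v - r * ?B v w - r * ?B w v + r * r * ?B w w"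
      by (simp add: metric_inner_def matrix_vector_mult_diff_distrib matrix_vector_mult_scaleR
          inner_diff_left inner_diff_right algebra_simps)
    also have "\<dots> = ?B v v - (?B v w)\<^sup>2 / ?B w w"
      using pos by (simp add: sym r_def power2_eq_square field_simps)
    finally have "(?B v w)\<^sup>2 / ?B w w \<le> ?B v v" using nn[of "v - r *\<^sub>R w"] by simp
    then show ?thesis using pos by (simp add: field_simps)
  qed (simp add: metric_inner_def)
  then have "sqrt ((?B v w)\<^sup>2) \<le> sqrt (?B v v * ?B w w)" by (rule real_sqrt_le_mono)
  then show ?thesis by (simp add: metric_norm_def real_sqrt_mult)
qed

context
  fixes \<gamma> :: "real \<Rightarrow> 'a" and a b :: real
  assumes ab: "a < b" and cont: "continuous_on {a..b} \<gamma>" and img: "\<gamma> ` {a..b} \<subseteq> M"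
    and C1: "C1_piece \<gamma> a b"
begin

text \<open>Taken within the piece, so that it is the one-sided derivative at the ends, where the
  two-sided derivative in \<open>curve_speed\<close> may fail to exist.\<close>

definition velocity :: "('a, 'n) chart \<Rightarrow> real \<Rightarrow> real^'n" where
  "velocity c s = vector_derivative (chart_map c \<circ> \<gamma>) (at s within {a..b})"

lemma velocity:
  assumes c: "c \<in> A"
  shows "\<And>s. s \<in> {a..b} \<Longrightarrow> \<gamma> s \<in> chart_dom c \<Longrightarrow>
      ((chart_map c \<circ> \<gamma>) has_vector_derivative velocity c s) (at s within {a..b})"
    and "continuous_on {s \<in> {a..b}. \<gamma> s \<in> chart_dom c} (velocity c)"
proof -
  obtain h' where h': "continuous_on {s \<in> {a..b}. \<gamma> s \<in> chart_dom c} h'"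
     "\<And>s. s\<in>{a..b} \<Longrightarrow> \<gamma> s \<in> chart_dom c \<Longrightarrow> ((chart_map c \<circ> \<gamma>) has_vector_derivative h' s) (at s within {a..b})"
    using C1 c unfolding C1_piece_def by blast
  have eq: "velocity c s = h' s" if "s \<in> {a..b}" "\<gamma> s \<in> chart_dom c" for s
    unfolding velocity_def using vector_derivative_Icc[OF ab _ h'(2)[OF that]] that by simp
  show "((chart_map c \<circ> \<gamma>) has_vector_derivative velocity c s) (at s within {a..b})"
    if "s \<in> {a..b}" "\<gamma> s \<in> chart_dom c" for s
    using eq[OF that] h'(2)[OF that] by simp
  show "continuous_on {s \<in> {a..b}. \<gamma> s \<in> chart_dom c} (velocity c)"
    by (rule continuous_on_eq[OF h'(1)]) (simp add: eq)
qed

lemma velocity_transform: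
  assumes c: "c \<in> A" and d: "d \<in> A" and s: "s \<in> {a..b}" and \<gamma>: "\<gamma> s \<in> chart_dom c \<inter> chart_dom d"
  shows "velocity d s = jacobian c d (\<gamma> s) *v velocity c s"
proof -
  let ?W = "{s \<in> {a..b}. \<gamma> s \<in> chart_dom c}"
  have sW: "s \<in> ?W" using s \<gamma> by auto
  have W: "at s within ?W = at s within {a..b}"
    by (rule at_within_relatively_open[OF chart_preimage_open[OF cont img c] sW])
  have "((chart_map c \<circ> \<gamma>) has_derivative (\<lambda>r. r *\<^sub>R velocity c s)) (at s within ?W)"
    using velocity(1)[OF c s] \<gamma> unfolding W has_vector_derivative_def by auto
  moreover have "((chart_map d \<circ> chart_inv c) has_derivative (\<lambda>w. jacobian c d (\<gamma> s) *v w))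
      (at ((chart_map c \<circ> \<gamma>) s) within ((chart_map c \<circ> \<gamma>) ` ?W))"
    using transition_has_derivative[OF c d \<gamma>] by (auto intro: has_derivative_at_withinI)
  ultimately have "((chart_map d \<circ> chart_inv c) \<circ> (chart_map c \<circ> \<gamma>) has_derivative
      (\<lambda>r. jacobian c d (\<gamma> s) *v (r *\<^sub>R velocity c s))) (at s within ?W)"
    using diff_chain_within[of "chart_map c \<circ> \<gamma>" _ s ?W "chart_map d \<circ> chart_inv c"] by (simp add: o_def)
  then have "((chart_map d \<circ> \<gamma>) has_derivative (\<lambda>r. jacobian c d (\<gamma> s) *v (r *\<^sub>R velocity c s))) (at s within ?W)"
    by (subst has_derivative_within_cong[OF sW, of _ "(chart_map d \<circ> chart_inv c) \<circ> (chart_map c \<circ> \<gamma>)"])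
      (auto simp: chart_inv_map[OF atlas c])
  then have "((chart_map d \<circ> \<gamma>) has_vector_derivative jacobian c d (\<gamma> s) *v velocity c s) (at s within {a..b})"
    unfolding W[symmetric] has_vector_derivative_def by (simp only: matrix_vector_mult_scaleR)
  then show ?thesis
    unfolding velocity_def using vector_derivative_Icc[OF ab] s by simp
qed

lemma speed_chart_independent:
  assumes "c \<in> A" "d \<in> A" "s \<in> {a..b}" "\<gamma> s \<in> chart_dom c \<inter> chart_dom d" "t \<in> {0..T}"
  shows "metric_norm (g c t (\<gamma> s)) (velocity c s) = metric_norm (g d t (\<gamma> s)) (velocity d s)"
  by (simp add: metric_norm_def metric_inner_transform[OF assms(1,2,5,4)] velocity_transform[OF assms(1-4)])

lemma curve_speed_velocity:
  assumes c: "c \<in> A" and s: "s \<in> {a<..<b}" and \<gamma>: "\<gamma> s \<in> chart_dom c" and t: "t \<in> {0..T}"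
  shows "curve_speed A g t \<gamma> s = metric_norm (g c t (\<gamma> s)) (velocity c s)"
proof -
  let ?c = "SOME c. c \<in> A \<and> \<gamma> s \<in> chart_dom c"
  have c': "?c \<in> A" "\<gamma> s \<in> chart_dom ?c"
    using someI[of "\<lambda>c. c \<in> A \<and> \<gamma> s \<in> chart_dom c" c] c \<gamma> by auto
  have "at s within {a..b} = at s"
    using s by (simp add: at_within_Icc_at)
  then have "curve_speed A g t \<gamma> s = metric_norm (g ?c t (\<gamma> s)) (velocity ?c s)"
    by (simp add: curve_speed_def velocity_def Let_def)
  then show ?thesis
    using speed_chart_independent[OF c'(1) c] c' \<gamma> s t by auto
qed

text \<open>The speed \<open>\<sigma>\<close> built from one-sided derivatives is continuous up to
  the ends and agrees with \<open>curve_speed\<close> in the interior; the two end points do not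
  affect integrability.\<close>

lemma curve_speed_integrable_piece:
  assumes t: "t \<in> {0..T}"
  shows "curve_speed A g t \<gamma> integrable_on {a..b}"
proof -
  \<comment> \<open>The chart may jump with \<open>s\<close>, but near each point
    \<open>\<sigma>\<close> can be computed in one fixed chart by
    \<open>speed_chart_independent\<close>, which gives its continuity.\<close>
  define C where "C s = (SOME c. c \<in> A \<and> \<gamma> s \<in> chart_dom c)" for s
  have C: "C s \<in> A \<and> \<gamma> s \<in> chart_dom (C s)" if "s \<in> {a..b}" for s
  proof -
    have "\<gamma> s \<in> M" using img that by auto
    then have "\<exists>c. c \<in> A \<and> \<gamma> s \<in> chart_dom c" using chart_cover[OF atlas] by blast
    then show ?thesis unfolding C_def by (rule someI_ex)
  qed
  define \<sigma> where "\<sigma> s = metric_norm (g (C s) t (\<gamma> s)) (velocity (C s) s)" for s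
  have "continuous_on {a..b} \<sigma>"
    unfolding continuous_on_eq_continuous_within
  proof
    fix s assume s: "s \<in> {a..b}"
    let ?c = "C s"
    let ?W = "{s \<in> {a..b}. \<gamma> s \<in> chart_dom ?c}"
    have c: "?c \<in> A" and sW: "s \<in> ?W" using C[OF s] s by auto
    have "continuous_on ?W (\<lambda>r. (t, \<gamma> r))"
      using cont by (intro continuous_intros) (auto intro: continuous_on_subset)
    then have "continuous_on ?W (\<lambda>r. g ?c (fst (t, \<gamma> r)) (snd (t, \<gamma> r)))"
      by (rule continuous_on_compose2[OF metric_continuous[OF c]]) (use t in auto)
    then have "continuous_on ?W (\<lambda>r. g ?c t (\<gamma> r) $ i $ j)" for i j
      by (intro continuous_on_component) simp
    moreover have "continuous_on ?W (\<lambda>r. velocity ?c r $ i)" for i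
      by (intro continuous_on_component velocity(2)[OF c])
    ultimately have "continuous_on ?W (\<lambda>r. metric_norm (g ?c t (\<gamma> r)) (velocity ?c r))"
      unfolding metric_norm_def metric_inner_def quadratic_form_sum
      by (intro continuous_on_real_sqrt continuous_on_sum continuous_on_mult) auto
    then have "continuous_on ?W \<sigma>"
      by (rule continuous_on_eq)
        (unfold \<sigma>_def, rule speed_chart_independent, use C c t in auto)
    then show "continuous (at s within {a..b}) \<sigma>"
      using sW at_within_relatively_open[OF chart_preimage_open[OF cont img c] sW]
      by (metis continuous_on_eq_continuous_within)
  qed
  then have "\<sigma> integrable_on cbox a b"
    using integrable_continuous_interval by simp
  then have "curve_speed A g t \<gamma> integrable_on cbox a b"
  proof (rule integrable_spike_interior[rotated])
    show "curve_speed A g t \<gamma> s = \<sigma> s" if "s \<in> box a b" for s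
      using curve_speed_velocity[of "C s" s t] C[of s] that t by (simp add: \<sigma>_def)
  qed
  then show ?thesis by simp
qed

end

lemma curve_speed_nonneg:
  assumes "\<gamma> s \<in> M" "t \<in> {0..T}"
  shows "0 \<le> curve_speed A g t \<gamma> s"
proof -
  have "\<exists>c. c \<in> A \<and> \<gamma> s \<in> chart_dom c" using chart_cover[OF atlas assms(1)] by blast
  from someI_ex[OF this] show ?thesis
    unfolding curve_speed_def Let_def by (intro metric_norm_nonneg assms) auto
qed

text \<open>Induction on the number of break points inside the interval: cutting at one of them
  leaves strictly fewer in either half.\<close>

lemma curve_speed_integrable:
  assumes \<gamma>: "continuous_on {0..1} \<gamma>" "\<gamma> ` {0..1} \<subseteq> M" and P: "finite P"
    and pieces: "\<And>a b. 0 \<le> a \<Longrightarrow> a < b \<Longrightarrow> b \<le> 1 \<Longrightarrow> {a<..<b} \<inter> P = {} \<Longrightarrow> C1_piece \<gamma> a b"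
    and t: "t \<in> {0..T}"
  shows "curve_speed A g t \<gamma> integrable_on {0..1}"
proof -
  have "curve_speed A g t \<gamma> integrable_on {a..b}" if "0 \<le> a" "a < b" "b \<le> 1" for a b
    using that
  proof (induction "card ({a<..<b} \<inter> P)" arbitrary: a b rule: less_induct)
    case less
    show ?case
    proof (cases "{a<..<b} \<inter> P = {}")
      case True
      show ?thesis
        by (rule curve_speed_integrable_piece[OF less.prems(2) _ _ pieces[OF less.prems True] t])
          (use less.prems \<gamma> in \<open>auto intro: continuous_on_subset\<close>)
    next
      case False
      then obtain p where p: "a < p" "p < b" "p \<in> P" by auto
      have "{a<..<p} \<inter> P \<subset> {a<..<b} \<inter> P" "{p<..<b} \<inter> P \<subset> {a<..<b} \<inter> P"
        using p by auto
      then have "card ({a<..<p} \<inter> P) < card ({a<..<b} \<inter> P)" "card ({p<..<b} \<inter> P) < card ({a<..<b} \<inter> P)"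
        using P by (auto intro!: psubset_card_mono)
      then have "curve_speed A g t \<gamma> integrable_on {a..p}" "curve_speed A g t \<gamma> integrable_on {p..b}"
        using less.hyps[of a p] less.hyps[of p b] less.prems p by auto
      then show ?thesis
        using p by (intro Henstock_Kurzweil_Integration.integrable_combine[of a p b]) auto
    qed
  qed
  then show ?thesis by simp
qed

section \<open>Construction of curves joining two points\<close>

lemma C1_piece_affine:
  assumes \<gamma>: "C1_piece \<gamma> (m * a + r) (m * b + r)" and m: "m > 0" and ab: "a < b"
    and \<sigma>: "\<And>s. s \<in> {a..b} \<Longrightarrow> \<sigma> s = \<gamma> (m * s + r)"
  shows "C1_piece \<sigma> a b"
  unfolding C1_piece_def
proof
  fix c assume c: "c \<in> A"
  let ?l = "\<lambda>s. m * s + r"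
  have l: "?l ` {a..b} = {?l a..?l b}"
    using image_affinity_atLeastAtMost[of m r a b] m ab by auto
  have lin: "?l s \<in> {?l a..?l b}" if "s \<in> {a..b}" for s
    using that l by blast
  obtain h' where h': "continuous_on {s \<in> {?l a..?l b}. \<gamma> s \<in> chart_dom c} h'"
     "\<And>s. s\<in>{?l a..?l b} \<Longrightarrow> \<gamma> s \<in> chart_dom c \<Longrightarrow>
        ((chart_map c \<circ> \<gamma>) has_vector_derivative h' s) (at s within {?l a..?l b})"
    using \<gamma> c unfolding C1_piece_def by blast
  have "continuous_on {s \<in> {a..b}. \<sigma> s \<in> chart_dom c} (\<lambda>s. m *\<^sub>R h' (?l s))"
  proof (intro continuous_on_scaleR continuous_on_const continuous_on_compose2[OF h'(1)])
    show "continuous_on {s \<in> {a..b}. \<sigma> s \<in> chart_dom c} ?l" by (intro continuous_intros)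
    show "?l ` {s \<in> {a..b}. \<sigma> s \<in> chart_dom c} \<subseteq> {s \<in> {?l a..?l b}. \<gamma> s \<in> chart_dom c}"
      using lin \<sigma> by auto
  qed
  moreover have "((chart_map c \<circ> \<sigma>) has_vector_derivative m *\<^sub>R h' (?l s)) (at s within {a..b})"
    if s: "s \<in> {a..b}" "\<sigma> s \<in> chart_dom c" for s
  proof -
    have "(?l has_vector_derivative m) (at s within {a..b})"
      by (auto intro!: derivative_eq_intros)
    moreover have "((chart_map c \<circ> \<gamma>) has_vector_derivative h' (?l s)) (at (?l s) within ?l ` {a..b})"
      unfolding l using s \<sigma>[OF s(1)] lin[OF s(1)] by (intro h'(2)) auto
    ultimately have "((chart_map c \<circ> \<gamma>) \<circ> ?l has_vector_derivative m *\<^sub>R h' (?l s)) (at s within {a..b})"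
      by (rule vector_diff_chain_within)
    then show ?thesis
      unfolding has_vector_derivative_def
      by (subst has_derivative_within_cong[OF s(1), of _ "(chart_map c \<circ> \<gamma>) \<circ> ?l"]) (auto simp: \<sigma>)
  qed
  ultimately show "\<exists>h'. continuous_on {s \<in> {a..b}. \<sigma> s \<in> chart_dom c} h' \<and>
     (\<forall>s\<in>{a..b}. \<sigma> s \<in> chart_dom c \<longrightarrow> ((chart_map c \<circ> \<sigma>) has_vector_derivative h' s) (at s within {a..b}))"
    by blast
qed

lemma C1_piece_segment:
  assumes c: "c \<in> A" and seg: "\<And>s. s \<in> {a..b} \<Longrightarrow> y + s *\<^sub>R w \<in> chart_img c"
  shows "C1_piece (\<lambda>s. chart_inv c (y + s *\<^sub>R w)) a b"
  unfolding C1_piece_def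
proof
  let ?\<gamma> = "\<lambda>s. chart_inv c (y + s *\<^sub>R w)"
  fix d assume d: "d \<in> A"
  let ?U = "chart_map c ` (chart_dom c \<inter> chart_dom d)" and ?\<tau> = "chart_map d \<circ> chart_inv c"
  note U = overlap_open[OF c d] and \<tau> = transition_smooth[OF c d]
  have inU: "y + s *\<^sub>R w \<in> ?U" if "s \<in> {a..b}" "?\<gamma> s \<in> chart_dom d" for s
    using seg[OF that(1)] that chart_inv_dom[OF atlas c] chart_map_inv[OF atlas c]
    by (intro image_eqI[of _ _ "?\<gamma> s"]) auto
  let ?h = "\<lambda>s. dir_deriv w ?\<tau> (y + s *\<^sub>R w)"
  have "continuous_on {s \<in> {a..b}. ?\<gamma> s \<in> chart_dom d} ?h"
    by (rule continuous_on_compose2[OF smooth_on_continuous[OF U smooth_on_dir_deriv[OF U \<tau>]]])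
      (use inU in \<open>auto intro!: continuous_intros\<close>)
  moreover have "((chart_map d \<circ> ?\<gamma>) has_vector_derivative ?h s) (at s within {a..b})"
    if "s \<in> {a..b}" "?\<gamma> s \<in> chart_dom d" for s
  proof -
    have "chart_map d \<circ> ?\<gamma> = (\<lambda>s. ?\<tau> (y + s *\<^sub>R w))" by (simp add: fun_eq_iff)
    then show ?thesis
      using has_vector_derivative_at_within[OF line_has_derivative[OF smooth_on_differentiable[OF U \<tau> inU[OF that]]]]
      by metis
  qed
  ultimately show "\<exists>h'. continuous_on {s \<in> {a..b}. ?\<gamma> s \<in> chart_dom d} h' \<and>
     (\<forall>s\<in>{a..b}. ?\<gamma> s \<in> chart_dom d \<longrightarrow> ((chart_map d \<circ> ?\<gamma>) has_vector_derivative h' s) (at s within {a..b}))"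
    by blast
qed

text \<open>The joined curve runs through each half at double speed, so its break points are the
  halved ones of \<open>\<gamma>\<close> together with \<open>1 / 2\<close>; an admissible piece
  lies on one side of \<open>1 / 2\<close>.\<close>

lemma piecewise_C1_curve_join:
  assumes \<gamma>: "piecewise_C1_curve M A \<gamma>" and \<delta>: "path \<delta>" "path_image \<delta> \<subseteq> M"
    and C1: "\<And>a b. 0 \<le> a \<Longrightarrow> a < b \<Longrightarrow> b \<le> 1 \<Longrightarrow> C1_piece \<delta> a b" and join: "\<gamma> 1 = \<delta> 0"
  shows "piecewise_C1_curve M A (\<gamma> +++ \<delta>)"
proof -
  obtain P where P: "finite P"
    "\<And>a b. 0 \<le> a \<Longrightarrow> a < b \<Longrightarrow> b \<le> 1 \<Longrightarrow> {a<..<b} \<inter> P = {} \<Longrightarrow> C1_piece \<gamma> a b"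
    and p: "path \<gamma>" "path_image \<gamma> \<subseteq> M"
    using \<gamma> unfolding piecewise_C1_curve_iff path_def path_image_def by auto
  have "path (\<gamma> +++ \<delta>)" "path_image (\<gamma> +++ \<delta>) \<subseteq> M"
    using p \<delta> join path_image_join_subset[of \<gamma> \<delta>]
    by (auto simp: pathfinish_def pathstart_def)
  moreover have "C1_piece (\<gamma> +++ \<delta>) a b"
    if ab: "0 \<le> a" "a < b" "b \<le> 1" and P': "{a<..<b} \<inter> insert (1/2) ((\<lambda>p. p / 2) ` P) = {}" for a b
  proof (cases "b \<le> 1 / 2")
    case True
    have "C1_piece \<gamma> (2 * a + 0) (2 * b + 0)"
    proof (rule P(2))
      show "{2 * a + 0<..<2 * b + 0} \<inter> P = {}"
      proof (rule ccontr)
        assume "\<not> ?thesis"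
        then obtain p where "p \<in> P" "2 * a < p" "p < 2 * b" by auto
        then have "p / 2 \<in> {a<..<b} \<inter> insert (1/2) ((\<lambda>p. p / 2) ` P)" by auto
        then show False using P' by auto
      qed
    qed (use ab True in auto)
    then show ?thesis
      by (rule C1_piece_affine) (use ab True in \<open>auto simp: joinpaths_def\<close>)
  next
    case False
    have a: "a \<ge> 1 / 2"
    proof (rule ccontr)
      assume "\<not> ?thesis"
      then have "1 / 2 \<in> {a<..<b} \<inter> insert (1/2) ((\<lambda>p. p / 2) ` P)" using False by auto
      then show False using P' by auto
    qed
    have "C1_piece \<delta> (2 * a + - 1) (2 * b + - 1)"
      by (rule C1) (use ab a in auto)
    then show ?thesis
    proof (rule C1_piece_affine)
      show "(\<gamma> +++ \<delta>) s = \<delta> (2 * s + - 1)" if "s \<in> {a..b}" for s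
      \<comment> \<open>At \<open>1 / 2\<close> \<open>joinpaths\<close> takes its first branch, so
        agreement with \<open>\<delta>\<close> there rests on the matching end points.\<close>
      proof (cases "s = 1 / 2")
        case True
        show ?thesis unfolding True joinpaths_def using join by simp
      next
        case False
        then have "\<not> s \<le> 1 / 2" using that a by auto
        then show ?thesis by (simp add: joinpaths_def)
      qed
    qed (use ab in auto)
  qed
  ultimately show ?thesis
    unfolding piecewise_C1_curve_iff path_def path_image_def using P(1)
    by (intro conjI exI[of _ "insert (1/2) ((\<lambda>p. p / 2) ` P)"]) simp_all
qed

text \<open>Reachability from \<open>x1\<close> is locally constant on a connected set: within the
  image of a coordinate ball any two points are joined by a straight segment of the chart, which can
  be appended to a given curve. The segments run in \<open>M\<close>; only their end points are
  required to lie in \<open>S\<close>.\<close>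

lemma piecewise_C1_curve_exists:
  assumes "connected_component M x1 x2"
  shows "\<exists>\<gamma>. piecewise_C1_curve M A \<gamma> \<and> \<gamma> 0 = x1 \<and> \<gamma> 1 = x2"
proof -
  obtain S where S: "connected S" "S \<subseteq> M" "x1 \<in> S" "x2 \<in> S"
    using assms unfolding connected_component_def by blast
  let ?R = "\<lambda>x. \<exists>\<gamma>. piecewise_C1_curve M A \<gamma> \<and> \<gamma> 0 = x1 \<and> \<gamma> 1 = x"
  have segment: "path (\<lambda>s. chart_inv c (y + s *\<^sub>R w))"
      "path_image (\<lambda>s. chart_inv c (y + s *\<^sub>R w)) \<subseteq> M"
      "\<And>a b. 0 \<le> a \<Longrightarrow> a < b \<Longrightarrow> b \<le> 1 \<Longrightarrow> C1_piece (\<lambda>s. chart_inv c (y + s *\<^sub>R w)) a b"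
    if c: "c \<in> A" and seg: "\<And>s. s \<in> {0..1} \<Longrightarrow> y + s *\<^sub>R w \<in> chart_img c" for c y w
  proof -
    have "continuous_on (chart_img c) (chart_inv c)"
      using chart_homeomorphism[OF atlas c] by (simp add: homeomorphism_def)
    then show "path (\<lambda>s. chart_inv c (y + s *\<^sub>R w))"
      unfolding path_def by (rule continuous_on_compose2) (use seg in \<open>auto intro!: continuous_intros\<close>)
    show "path_image (\<lambda>s. chart_inv c (y + s *\<^sub>R w)) \<subseteq> M"
      using seg chart_inv_dom[OF atlas c] chart_dom_subset[OF atlas c] unfolding path_image_def by blast
    show "C1_piece (\<lambda>s. chart_inv c (y + s *\<^sub>R w)) a b" if "0 \<le> a" "a < b" "b \<le> 1" for a b
      by (rule C1_piece_segment[OF c seg]) (use that in auto)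
  qed
  have "?R x1"
  proof -
    have "x1 \<in> M" using S by auto
    then obtain c where c: "c \<in> A" "x1 \<in> chart_dom c" using chart_cover[OF atlas] by blast
    have "chart_map c x1 + s *\<^sub>R 0 \<in> chart_img c" for s :: real
      using chart_map_img[OF c(2)] by simp
    from segment[OF c(1) this] have "piecewise_C1_curve M A (\<lambda>s. chart_inv c (chart_map c x1 + s *\<^sub>R 0))"
      unfolding piecewise_C1_curve_iff path_def path_image_def by (intro conjI exI[of _ "{}"]) simp_all
    then show ?thesis
      using chart_inv_map[OF atlas c] by (intro exI[of _ "\<lambda>s. chart_inv c (chart_map c x1 + s *\<^sub>R 0)"]) simp
  qed
  show ?thesis
  proof (rule connected_induction_simple[OF S(1,3,4), of ?R])
    show "?R x1" by fact
    fix x assume "x \<in> S"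
    then have "x \<in> M" using S by auto
    then obtain c where c: "c \<in> A" "x \<in> chart_dom c" using chart_cover[OF atlas] by blast
    obtain r where r: "r > 0" "ball (chart_map c x) r \<subseteq> chart_img c"
      using chart_img_open[OF atlas c(1)] chart_map_img[OF c(2)] open_contains_ball by blast
    let ?B = "ball (chart_map c x) r" and ?V = "chart_inv c ` ball (chart_map c x) r"
    have "openin (top_of_set (chart_img c)) ?B"
      using r by (simp add: open_openin_trans openin_open_eq chart_img_open[OF atlas c(1)])
    then have "openin (top_of_set (chart_dom c)) ?V"
      using homeomorphism_imp_open_map[OF homeomorphism_symD[OF chart_homeomorphism[OF atlas c(1)]]] by blast
    then have "openin (top_of_set M) ?V"
      using chart_dom_open[OF atlas c(1)] openin_trans by blast
    then obtain O' where O': "open O'" "?V = M \<inter> O'" by (auto simp: openin_open)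
    have xV: "x \<in> ?V"
      using r(1) chart_inv_map[OF atlas c] by (intro image_eqI[of _ _ "chart_map c x"]) auto
    have step: "?R z" if yz: "y \<in> ?V" "z \<in> ?V" and Ry: "?R y" for y z
    proof -
      obtain p q where pq: "p \<in> ?B" "q \<in> ?B" "y = chart_inv c p" "z = chart_inv c q"
        using yz by auto
      obtain \<gamma> where \<gamma>: "piecewise_C1_curve M A \<gamma>" "\<gamma> 0 = x1" "\<gamma> 1 = y" using Ry by blast
      let ?\<delta> = "\<lambda>s. chart_inv c (p + s *\<^sub>R (q - p))"
      have "p + s *\<^sub>R (q - p) \<in> chart_img c" if "s \<in> {0..1}" for s
      proof -
        have "(1 - s) *\<^sub>R p + s *\<^sub>R q \<in> ?B"
          using convexD_alt[OF convex_ball pq(1,2)] that by auto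
        then show ?thesis using r(2) by (auto simp: algebra_simps)
      qed
      note seg = segment[OF c(1) this]
      have "piecewise_C1_curve M A (\<gamma> +++ ?\<delta>)"
        by (rule piecewise_C1_curve_join[OF \<gamma>(1) seg]) (use \<gamma> pq in auto)
      moreover have "(\<gamma> +++ ?\<delta>) 0 = x1" "(\<gamma> +++ ?\<delta>) 1 = z"
        using \<gamma> pq by (auto simp: joinpaths_def)
      ultimately show ?thesis by blast
    qed
    have "S \<inter> O' \<subseteq> ?V" unfolding O'(2) using S(2) by auto
    moreover have "openin (top_of_set S) (S \<inter> O')" by (rule openin_open_Int[OF O'(1)])
    moreover have "x \<in> S \<inter> O'" using xV \<open>x \<in> S\<close> unfolding O'(2) by auto
    moreover have "\<forall>y\<in>S \<inter> O'. \<forall>z\<in>S \<inter> O'. ?R y \<longrightarrow> ?R z"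
    proof (intro ballI impI)
      fix y z assume yz: "y \<in> S \<inter> O'" "z \<in> S \<inter> O'" and Ry: "?R y"
      from yz \<open>S \<inter> O' \<subseteq> ?V\<close> have "y \<in> ?V" "z \<in> ?V" by (simp_all only: subset_iff)
      then show "?R z" using Ry by (rule step)
    qed
    ultimately show "\<exists>V. openin (top_of_set S) V \<and> x \<in> V \<and> (\<forall>y\<in>V. \<forall>z\<in>V. ?R y \<longrightarrow> ?R z)"
      by (intro exI[of _ "S \<inter> O'"] conjI)
  qed
qed

end

section \<open>Integration of the gradient estimate along curves\<close>

context heat_flow
begin

text \<open>The time \<open>T\<close> is added by continuity; the Harnack inequality includes it
  although the derivation of the gradient estimate does not reach it.\<close>

lemma log_gradient_estimate_closed:
  assumes t: "0 < t" "t \<le> T" and c: "c \<in> A" and x: "x \<in> chart_dom c"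
  shows "t * q c t x \<le> (1 + 2 * k * t) * (1 + ln (D / u t x))"
proof -
  let ?h = "\<lambda>s. (1 + 2 * k * s) * (1 + ln (D / u s x)) - s * q c s x"
  have xM: "x \<in> M" using chart_dom_subset[OF atlas c] x by auto
  have pair: "continuous_on {0..T} (\<lambda>s. (s, x))" by (intro continuous_intros)
  have q: "continuous_on {0..T} (\<lambda>s. q c s x)"
    using continuous_on_compose2[OF q_continuous[OF c] pair] x by auto
  have cu: "continuous_on {0..T} (\<lambda>s. u s x)"
    using continuous_on_compose2[OF function_continuous[OF smooth_u] pair] xM by auto
  have pos: "0 < u s x \<and> u s x \<le> D" if "s \<in> {0..T}" for s by (rule u[OF xM that])
  have "continuous_on {0..T} ?h"
  proof (intro continuous_on_diff continuous_on_mult continuous_on_add continuous_on_const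
      continuous_on_id q continuous_on_ln continuous_on_divide cu ballI)
    fix s assume "s \<in> {0..T}"
    from pos[OF this] show "u s x \<noteq> 0" "D / u s x \<noteq> 0" by auto
  qed
  then have "continuous_on (closure {0<..<T}) ?h"
    using T_pos by (simp add: closure_greaterThanLessThan)
  then have "0 \<le> ?h t"
  proof (rule continuous_ge_on_closure)
    show "t \<in> closure {0<..<T}" using t T_pos by (simp add: closure_greaterThanLessThan)
    show "0 \<le> ?h s" if "s \<in> {0<..<T}" for s
      using log_gradient_estimate[OF _ _ c x, of s] that by (simp add: q_def)
  qed
  then show ?thesis by simp
qed

definition rlog :: "real \<Rightarrow> 'a \<Rightarrow> real" where
  "rlog t x = sqrt (1 + ln (D / u t x))"

lemma rlog_pos: "x \<in> M \<Longrightarrow> t \<in> {0..T} \<Longrightarrow> 1 + ln (D / u t x) > 0"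
proof -
  assume "x \<in> M" "t \<in> {0..T}"
  then have "D / u t x \<ge> 1" using u[of x t] by simp
  then show ?thesis using ln_ge_zero[of "D / u t x"] by linarith
qed

text \<open>Differentiating the square root divides the gradient of \<open>ln u\<close> by twice the
  root. The gradient estimate bounds that gradient by the same root times
  \<open>sqrt ((1 + 2 k t) / t)\<close>, so the dependence on \<open>u\<close> cancels;
  Cauchy-Schwarz brings in the speed.\<close>

lemma rlog_derivative_along_curve:
  assumes t: "0 < t" "t \<le> T" and c: "c \<in> A" and \<gamma>: "\<gamma> s \<in> chart_dom c"
    and near: "open I" "s \<in> I" "\<And>r. r \<in> I \<Longrightarrow> \<gamma> r \<in> chart_dom c"
    and w: "((chart_map c \<circ> \<gamma>) has_vector_derivative w) (at s)"
  shows "\<exists>r'. ((\<lambda>r. rlog t (\<gamma> r)) has_vector_derivative r') (at s) \<and>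
     \<bar>r'\<bar> \<le> sqrt ((1 + 2 * k * t) / t) / 2 * metric_norm (g c t (\<gamma> s)) w"
proof -
  let ?x = "\<gamma> s" and ?v = "\<lambda>z. ln (u t z)"
  have t': "t \<in> {0..T}" using t by simp
  have xM: "?x \<in> M" using chart_dom_subset[OF atlas c] \<gamma> by auto
  have pos: "0 < u t ?x" "0 < D" using u[OF xM t'] by auto
  let ?grad = "gradient c (g c t) ?v ?x"
  let ?L = "frechet_derivative (?v \<circ> chart_inv c) (at (chart_map c ?x))"
  have dv: "(?v \<circ> chart_inv c) differentiable at (chart_map c ?x)"
    by (rule log_slice_differentiable[OF c t' \<gamma>])
  have "?L w = (\<Sum>j\<in>UNIV. w $ j * partial_deriv c j ?v ?x)"
    using linear_axis_expansion[OF linear_frechet_derivative[OF dv], of w] by (simp add: partial_deriv_def)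
  also have "\<dots> = metric_inner (g c t ?x) w ?grad"
    using invertible_matrix_inv(1)[OF metric_det[OF c t' \<gamma>]]
    by (simp add: metric_inner_def gradient_def matrix_vector_mul_assoc inner_vec_def)
  finally have Lw: "?L w = metric_inner (g c t ?x) w ?grad" .
  have "((?v \<circ> chart_inv c) \<circ> (chart_map c \<circ> \<gamma>) has_derivative (\<lambda>r. ?L (r *\<^sub>R w))) (at s)"
    using diff_chain_at[of "chart_map c \<circ> \<gamma>" "\<lambda>r. r *\<^sub>R w" s "?v \<circ> chart_inv c" ?L] w dv
    by (simp add: has_vector_derivative_def frechet_derivative_works o_def)
  then have "((\<lambda>r. ?v (\<gamma> r)) has_derivative (\<lambda>r. ?L (r *\<^sub>R w))) (at s)"
    by (rule has_derivative_transform_within_open[OF _ near(1,2)]) (simp add: near(3) chart_inv_map[OF atlas c])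
  then have dl: "((\<lambda>r. ?v (\<gamma> r)) has_real_derivative ?L w) (at s)"
    using linear_scale[OF linear_frechet_derivative[OF dv]]
    by (simp add: has_field_derivative_def mult.commute[of _ "?L w"])
  let ?h = "1 + ln (D / u t ?x)"
  have h: "?h > 0" by (rule rlog_pos[OF xM t'])
  have h': "1 + ln D - ln (u t ?x) = ?h" using pos by (simp add: ln_div)
  have "((\<lambda>r. 1 + ln D - ?v (\<gamma> r)) has_real_derivative (0 - ?L w)) (at s)"
    by (rule DERIV_diff[OF DERIV_const dl])
  moreover have "(sqrt has_real_derivative inverse (sqrt ?h) / 2) (at (1 + ln D - ?v (\<gamma> s)))"
    unfolding h' by (rule DERIV_real_sqrt[OF h])
  ultimately have "((\<lambda>r. sqrt (1 + ln D - ?v (\<gamma> r))) has_real_derivative inverse (sqrt ?h) / 2 * (0 - ?L w)) (at s)"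
    by (rule DERIV_chain2[rotated])
  then have "((\<lambda>r. rlog t (\<gamma> r)) has_real_derivative - ?L w * (inverse (sqrt ?h) / 2)) (at s)"
  proof (rule has_field_derivative_transform_within_open[OF _ near(1,2), THEN DERIV_cong])
    show "sqrt (1 + ln D - ?v (\<gamma> r)) = rlog t (\<gamma> r)" if "r \<in> I" for r
      using u[of "\<gamma> r" t] near(3)[OF that] chart_dom_subset[OF atlas c] t' pos
      by (auto simp: rlog_def ln_div)
  qed simp
  moreover have "\<bar>- ?L w * (inverse (sqrt ?h) / 2)\<bar> \<le> sqrt ((1 + 2 * k * t) / t) / 2 * metric_norm (g c t ?x) w"
  proof -
    have "metric_norm (g c t ?x) ?grad = sqrt (q c t ?x)"
      using metric_norm_nonneg[OF c t' \<gamma>] by (simp add: q_def)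
    also have "\<dots> \<le> sqrt ((1 + 2 * k * t) / t * ?h)"
      using log_gradient_estimate_closed[OF t c \<gamma>] t by (intro real_sqrt_le_mono) (simp add: field_simps)
    finally have "metric_norm (g c t ?x) ?grad \<le> sqrt ((1 + 2 * k * t) / t) * sqrt ?h"
      by (simp only: real_sqrt_mult)
    then have "metric_norm (g c t ?x) w * metric_norm (g c t ?x) ?grad
        \<le> metric_norm (g c t ?x) w * (sqrt ((1 + 2 * k * t) / t) * sqrt ?h)"
      using metric_norm_nonneg[OF c t' \<gamma>] by (intro mult_left_mono)
    then have "\<bar>?L w\<bar> \<le> metric_norm (g c t ?x) w * (sqrt ((1 + 2 * k * t) / t) * sqrt ?h)"
      using metric_cauchy_schwarz[OF c t' \<gamma>, of w ?grad] unfolding Lw by linarith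
    moreover have "sqrt ?h > 0" using h by simp
    ultimately show ?thesis
      by (simp add: abs_mult field_simps)
  qed
  ultimately show ?thesis
    by (auto simp: has_real_derivative_iff_has_vector_derivative)
qed

text \<open>The fundamental theorem of calculus in the version that tolerates finitely many
  exceptional points, here the break points of the curve.\<close>

lemma rlog_along_curve:
  assumes t: "0 < t" "t \<le> T" and \<gamma>: "piecewise_C1_curve M A \<gamma>"
  shows "rlog t (\<gamma> 1) - rlog t (\<gamma> 0) \<le> sqrt ((1 + 2 * k * t) / t) / 2 * curve_length A g t \<gamma>"
proof -
  let ?C = "sqrt ((1 + 2 * k * t) / t) / 2"
  have t': "t \<in> {0..T}" using t by simp
  obtain P where P: "finite P"
    "\<And>a b. 0 \<le> a \<Longrightarrow> a < b \<Longrightarrow> b \<le> 1 \<Longrightarrow> {a<..<b} \<inter> P = {} \<Longrightarrow> C1_piece \<gamma> a b"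
    and cont: "continuous_on {0..1} \<gamma>" and img: "\<gamma> ` {0..1} \<subseteq> M"
    using \<gamma> unfolding piecewise_C1_curve_iff by blast
  have "\<exists>r'. ((\<lambda>r. rlog t (\<gamma> r)) has_vector_derivative r') (at s) \<and> \<bar>r'\<bar> \<le> ?C * curve_speed A g t \<gamma> s"
    if s: "s \<in> {0<..<1} - P" for s
  proof -
    have "open ({0<..<1} - P)" using P(1) by (intro open_Diff finite_imp_closed) auto
    then obtain e where e: "e > 0" "ball s e \<subseteq> {0<..<1} - P" using s open_contains_ball by blast
    \<comment> \<open>Half the radius makes the closed interval fit into the ball, so that it
      contains no break point and forms a C^1 piece around \<open>s\<close>.\<close>
    define a b where "a = s - e / 2" and "b = s + e / 2"
    have "{a..b} \<subseteq> ball s e" using e by (auto simp: a_def b_def dist_real_def)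
    then have sub: "{a..b} \<subseteq> {0<..<1} - P" using e by blast
    have ab: "a < b" "s \<in> {a<..<b}" using e by (auto simp: a_def b_def)
    moreover have "{a<..<b} \<subseteq> {a..b}" by auto
    ultimately have ab: "a < b" "s \<in> {a<..<b}" "{a..b} \<subseteq> {0<..<1}" "{a<..<b} \<inter> P = {}"
      using sub by blast+
    have "a \<in> {0<..<1}" "b \<in> {0<..<1}" by (rule subsetD[OF ab(3)], use ab(1) in simp)+
    then have C1: "C1_piece \<gamma> a b" by (intro P(2)) (use ab in auto)
    have ab': "{a..b} \<subseteq> {0..1}" using ab(3) by auto
    have cont': "continuous_on {a..b} \<gamma>" and img': "\<gamma> ` {a..b} \<subseteq> M"
      using ab' cont img by (auto intro: continuous_on_subset)
    have "\<gamma> s \<in> M" using img' ab by auto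
    then obtain c where c: "c \<in> A" "\<gamma> s \<in> chart_dom c" using chart_cover[OF atlas] by blast
    have at: "at s within {a..b} = at s" using ab by (simp add: at_within_Icc_at)
    have "s \<in> {a..b}" using ab by auto
    from velocity(1)[OF ab(1) cont' img' C1 c(1) this c(2)]
    have w: "((chart_map c \<circ> \<gamma>) has_vector_derivative velocity \<gamma> a b c s) (at s)"
      unfolding at .
    obtain U where U: "open U" "{s \<in> {a..b}. \<gamma> s \<in> chart_dom c} = {a..b} \<inter> U"
      using chart_preimage_open[OF cont' img' c(1)] by (auto simp: openin_open)
    have "\<exists>r'. ((\<lambda>r. rlog t (\<gamma> r)) has_vector_derivative r') (at s) \<and>
       \<bar>r'\<bar> \<le> ?C * metric_norm (g c t (\<gamma> s)) (velocity \<gamma> a b c s)"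
    proof (rule rlog_derivative_along_curve[where \<gamma> = \<gamma> and s = s and c = c and I = "{a<..<b} \<inter> U", OF t c])
      have *: "\<gamma> r \<in> chart_dom c \<longleftrightarrow> r \<in> U" if "r \<in> {a<..<b}" for r
      proof -
        have "r \<in> {s \<in> {a..b}. \<gamma> s \<in> chart_dom c} \<longleftrightarrow> r \<in> {a..b} \<inter> U" by (simp only: U(2))
        then show ?thesis using that by simp
      qed
      show "open ({a<..<b} \<inter> U)" using U(1) by auto
      show "s \<in> {a<..<b} \<inter> U" using ab(2) c(2) * by auto
      show "\<gamma> r \<in> chart_dom c" if "r \<in> {a<..<b} \<inter> U" for r using that * by auto
    qed (rule w)
    then show ?thesis
      using curve_speed_velocity[OF ab(1) cont' img' C1 c(1) ab(2) c(2) t'] by simp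
  qed
  then obtain r' where r': "\<And>s. s \<in> {0<..<1} - P \<Longrightarrow> ((\<lambda>r. rlog t (\<gamma> r)) has_vector_derivative r' s) (at s)"
    "\<And>s. s \<in> {0<..<1} - P \<Longrightarrow> \<bar>r' s\<bar> \<le> ?C * curve_speed A g t \<gamma> s"
    by metis
  \<comment> \<open>The value \<open>0\<close> at the exceptional points keeps \<open>f'\<close>
    below the nonnegative speed bound on all of \<open>{0..1}\<close>, as the comparison of
    integrals requires.\<close>
  define f' where "f' s = (if s \<in> {0<..<1} - P then r' s else 0)" for s
  have C: "?C \<ge> 0" using k t by simp
  have "(f' has_integral (rlog t (\<gamma> 1) - rlog t (\<gamma> 0))) {0..1}"
  proof (rule fundamental_theorem_of_calculus_interior_strong[OF P(1)])
    show "((\<lambda>r. rlog t (\<gamma> r)) has_vector_derivative f' s) (at s)" if "s \<in> {0<..<1} - P" for s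
      using r'(1)[OF that] that by (simp add: f'_def)
    have "continuous_on {0..1} (\<lambda>s. (t, \<gamma> s))" using cont by (intro continuous_intros)
    then have cu: "continuous_on {0..1} (\<lambda>s. u (fst (t, \<gamma> s)) (snd (t, \<gamma> s)))"
      by (rule continuous_on_compose2[OF function_continuous[OF smooth_u]]) (use img t in auto)
    have "0 < u t (\<gamma> s) \<and> u t (\<gamma> s) \<le> D" if "s \<in> {0..1}" for s
      using img that t' by (intro u) auto
    then show "continuous_on {0..1} (\<lambda>s. rlog t (\<gamma> s))"
      using cu unfolding rlog_def by (intro continuous_intros) force+
  qed simp
  moreover have "((\<lambda>s. ?C * curve_speed A g t \<gamma> s) has_integral ?C * curve_length A g t \<gamma>) {0..1}"
    unfolding curve_length_def
    by (intro has_integral_mult_right integrable_integral curve_speed_integrable[OF cont img P(1) P(2) t'])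
  ultimately show ?thesis
  proof (rule has_integral_le)
    fix s :: real assume s: "s \<in> {0..1}"
    then have "0 \<le> curve_speed A g t \<gamma> s" using img t' by (intro curve_speed_nonneg) auto
    then have "0 \<le> ?C * curve_speed A g t \<gamma> s" using C by simp
    then show "f' s \<le> ?C * curve_speed A g t \<gamma> s"
      using r'(2)[of s] by (auto simp: f'_def)
  qed
qed

lemma rlog_distance:
  assumes t: "0 < t" "t \<le> T" and "connected_component M x1 x2"
  shows "rlog t x2 - rlog t x1 \<le> sqrt ((1 + 2 * k * t) / t) / 2 * riemannian_dist M A g t x1 x2"
    and "0 \<le> riemannian_dist M A g t x1 x2"
proof -
  let ?C = "sqrt ((1 + 2 * k * t) / t) / 2"
  let ?Ls = "{curve_length A g t \<gamma> |\<gamma>. piecewise_C1_curve M A \<gamma> \<and> \<gamma> 0 = x1 \<and> \<gamma> 1 = x2}"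
  have t': "t \<in> {0..T}" using t by simp
  have C: "?C > 0" using weight_denominator[of t] t by simp
  have ne: "?Ls \<noteq> {}" using piecewise_C1_curve_exists[OF assms(3)] by auto
  have "(rlog t x2 - rlog t x1) / ?C \<le> l" if l: "l \<in> ?Ls" for l
  proof -
    obtain \<gamma> where \<gamma>: "l = curve_length A g t \<gamma>" "piecewise_C1_curve M A \<gamma>" "\<gamma> 0 = x1" "\<gamma> 1 = x2"
      using l by blast
    have "rlog t x2 - rlog t x1 \<le> ?C * l"
      using rlog_along_curve[OF t \<gamma>(2)] \<gamma> by simp
    then show ?thesis using C by (simp only: pos_divide_le_eq mult.commute)
  qed
  then have "(rlog t x2 - rlog t x1) / ?C \<le> riemannian_dist M A g t x1 x2"
    unfolding riemannian_dist_def by (rule cInf_greatest[OF ne])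
  then show "rlog t x2 - rlog t x1 \<le> ?C * riemannian_dist M A g t x1 x2"
    using C by (simp only: pos_divide_le_eq mult.commute)
  have "0 \<le> l" if l: "l \<in> ?Ls" for l
  proof -
    obtain \<gamma> where \<gamma>: "l = curve_length A g t \<gamma>" "piecewise_C1_curve M A \<gamma>" using l by blast
    have "\<gamma> s \<in> M" if "s \<in> {0..1}" for s
      using \<gamma>(2) that by (auto simp: piecewise_C1_curve_def)
    \<comment> \<open>The integral of a function that is not integrable is \<open>0\<close> by
      convention, so that case also yields a nonnegative length.\<close>
    then show ?thesis
      unfolding \<gamma>(1) curve_length_def using curve_speed_nonneg[OF _ t']
      by (cases "curve_speed A g t \<gamma> integrable_on {0..1}")
        (auto intro!: integral_nonneg simp: not_integrable_integral)
  qed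
  then show "0 \<le> riemannian_dist M A g t x1 x2"
    unfolding riemannian_dist_def by (rule cInf_greatest[OF ne])
qed

text \<open>The square of \<open>rlog\<close> is \<open>1 + ln D - ln u\<close>, decreasing in
  \<open>u\<close>; hence an upper bound for \<open>rlog\<close> at \<open>x2\<close> in terms of
  \<open>x1\<close> becomes an upper bound for \<open>u\<close> at \<open>x1\<close>.\<close>

theorem harnack:
  assumes s: "0 < s" and t: "0 < t" "t \<le> T" and x: "x1 \<in> M" "x2 \<in> M" "connected_component M x1 x2"
  shows "u t x1 \<le> (exp 1 * D) powr (s / (1 + s))
              * exp ((riemannian_dist M A g t x1 x2)\<^sup>2 * ((1 + 2 * k * t) / (4 * s * t)))
              * u t x2 powr (1 / (1 + s))"
proof -
  have t': "t \<in> {0..T}" using t by simp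
  define d where "d = riemannian_dist M A g t x1 x2"
  define K where "K = (1 + 2 * k * t) / t"
  define H1 H2 where "H1 = rlog t x1" and "H2 = rlog t x2"
  have K: "K > 0" using weight_denominator[of t] t by (simp add: K_def)
  have u1: "0 < u t x1" "u t x1 \<le> D" and u2: "0 < u t x2" using u[OF x(1) t'] u[OF x(2) t'] by auto
  then have D: "D > 0" by simp
  have H1: "H1\<^sup>2 = 1 + ln D - ln (u t x1)" "H1 \<ge> 0" and H2: "H2\<^sup>2 = 1 + ln D - ln (u t x2)" "H2 \<ge> 0"
    using rlog_pos[OF x(1) t'] rlog_pos[OF x(2) t'] u1 u2 D
    by (auto simp: H1_def H2_def rlog_def ln_div)
  define e where "e = sqrt K / 2 * d"
  have "H2 \<le> H1 + e"
    using rlog_distance(1)[OF t x(3)] by (simp add: H1_def H2_def e_def d_def K_def)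
  then have "H2\<^sup>2 \<le> (H1 + e)\<^sup>2" using H2(2) by (rule power_mono)
  \<comment> \<open>Expanded, this is \<open>2 H1 e \<le> s H1^2 + e^2 / s\<close>, the weighted
    arithmetic-geometric mean inequality with free parameter \<open>s\<close>.\<close>
  moreover have "0 \<le> (s * H1 - e)\<^sup>2 / s" using s by simp
  then have "(H1 + e)\<^sup>2 \<le> (1 + s) * H1\<^sup>2 + (1 + s) * e\<^sup>2 / s"
    using s by (simp add: power2_eq_square field_simps)
  ultimately have "H2\<^sup>2 \<le> (1 + s) * H1\<^sup>2 + (1 + s) * e\<^sup>2 / s" by linarith
  then have "(1 + s) * ln (u t x1) \<le> s * (1 + ln D) + (1 + s) * (e\<^sup>2 / s) + ln (u t x2)"
    unfolding H1 H2 by (simp add: algebra_simps)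
  \<comment> \<open>Division by \<open>1 + s\<close> produces the exponents
    \<open>s / (1 + s)\<close> and \<open>1 / (1 + s)\<close> and removes the factor in front of
    \<open>e^2 / s\<close>.\<close>
  then have "ln (u t x1) \<le> (s * (1 + ln D) + (1 + s) * (e\<^sup>2 / s) + ln (u t x2)) / (1 + s)"
    using s by (simp add: pos_le_divide_eq mult.commute)
  also have "\<dots> = s / (1 + s) * (1 + ln D) + e\<^sup>2 / s + 1 / (1 + s) * ln (u t x2)"
    using s by (simp add: add_divide_distrib)
  finally have "exp (ln (u t x1)) \<le> exp (s / (1 + s) * (1 + ln D) + e\<^sup>2 / s + 1 / (1 + s) * ln (u t x2))"
    by simp
  \<comment> \<open>The \<open>4\<close> is the square of the \<open>2\<close> in the Lipschitz
    constant of \<open>rlog\<close>.\<close>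
  moreover have "e\<^sup>2 / s = d\<^sup>2 * ((1 + 2 * k * t) / (4 * s * t))"
    using K s t by (simp add: e_def power_mult_distrib power_divide K_def field_simps)
  moreover have "(exp 1 * D) powr (s / (1 + s)) = exp (s / (1 + s) * (1 + ln D))"
    using D ln_mult[of "exp 1" D] by (simp add: powr_def)
  moreover have "u t x2 powr (1 / (1 + s)) = exp (1 / (1 + s) * ln (u t x2))"
    using u2 by (simp add: powr_def)
  ultimately show ?thesis
    using u1(1) unfolding d_def by (simp only: exp_add exp_ln)
qed

end

text \<open>The gradient estimate is stated in every chart around a point. The Harnack inequality is
  stated for points of one connected component: across components the distance is infinite and the
  bound is void, whereas the infimum of an empty set of lengths would be an arbitrary real
  number.\<close>

theorem theorem2p11:
  fixes M :: "'a::t2_space set"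
    and A :: "('a, 'n::finite) chart set"
    and g :: "('a, 'n) metric_family"
    and f u :: "real \<Rightarrow> 'a \<Rightarrow> real"
    and F :: "real \<Rightarrow> real"
    and T k D :: real
  assumes "closed_manifold M A"
    and "CARD('n) \<ge> 2"
    and "T > 0"
    and "smooth_metric_family A T g"
    and "smooth_function_family A T f"
    and "k \<ge> 0"
    and "super_perelman_ricci_flow A T k g f"
    and "F C1_differentiable_on {0<..}"
    and "smooth_function_family A T u"
    and "\<And>x t. x \<in> M \<Longrightarrow> t \<in> {0..T} \<Longrightarrow> 0 < u t x \<and> u t x \<le> D"
    and "solves_nonlinear_heat A T g f F u"
    and "\<And>x t. x \<in> M \<Longrightarrow> t \<in> {0..T} \<Longrightarrow> F (u t x) \<ge> 0"
    and "\<And>x t. x \<in> M \<Longrightarrow> t \<in> {0..T} \<Longrightarrow> F (u t x) - 2 * u t x * deriv F (u t x) \<ge> 0"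
  shows "(\<forall>t. 0 < t \<and> t < T \<longrightarrow>
            (\<forall>c\<in>A. \<forall>x\<in>chart_dom c.
               t * (metric_norm (g c t x) (gradient c (g c t) (\<lambda>z. ln (u t z)) x))\<^sup>2
                 \<le> (1 + 2 * k * t) * (1 + ln (D / u t x)))) \<and>
         (\<forall>s t x1 x2. 0 < s \<and> 0 < t \<and> t \<le> T \<and> x1 \<in> M \<and> x2 \<in> M \<and> connected_component M x1 x2 \<longrightarrow>
            u t x1 \<le> (exp 1 * D) powr (s / (1 + s))
              * exp ((riemannian_dist M A g t x1 x2)\<^sup>2 * ((1 + 2 * k * t) / (4 * s * t)))
              * u t x2 powr (1 / (1 + s)))"
proof -
  interpret heat_flow M A g T f u F k D
    by unfold_locales (fact assms)+
  show ?thesis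
    using log_gradient_estimate harnack by blast
qed

end
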